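(* Let $\mathbb T_0$ be a finitary algebraic theory with a set of sorts and a set-sized signature. Let $\mathbb T$ be obtained by adding to $\mathbb T_0$, in the same signature, a set of axioms of the form $$\top\ \vdash_{\vec x}\quad\bigvee_{i\in I}\ \bigwedge_{j=1}^{n_i}t_{ij}(\vec x)=s_{ij}(\vec x),$$ where $\vec x$ is a finite context of sorted variables, $I$ is a set, each $n_i$ is finite, and each displayed equation is a well-sorted equation between terms. Then the category $\operatorname{Mod}_{\mathbf{Set}}(\mathbb T)$ of set-based models and homomorphisms admits a noetherian form whose quotients are exactly the sortwise-surjective homomorphisms and whose embeddings are exactly the sortwise-injective homomorphisms. Its fibres can be chosen complete, algebraic and modular. Moreover, the full inclusion of $\operatorname{Mod}_{\mathbf{Set}}(\mathbb T)$ into $\operatorname{Mod}_{\mathbf{Set}}(\mathbb T_0)$ is a transfer functor for the factorization systems of sortwise-surjective and sortwise-injective homomorphisms.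
   Context: Models are set-based, with empty carriers permitted when the axioms permit them. A model satisfies the displayed axiom when for every assignment of the variables $\vec x$ to elements of the carriers of the respective sorts there is $i\in I$ such that all equations $t_{ij}=s_{ij}$, $1\le j\le n_i$, hold. A complete lattice is algebraic when each element is a join of compact elements. Conventions: categories are locally small; "set" is relative to a fixed universe. A conservative functor is one that reflects isomorphisms. A proper factorization system $(\mathcal E,\mathcal M)$ is an orthogonal factorization system with every morphism in $\mathcal E$ an epimorphism and every morphism in $\mathcal M$ a monomorphism. Transfer functors. Let $\mathcal C,\mathcal D$ have specified proper factorization systems $(\mathcal E_{\mathcal C},\mathcal M_{\mathcal C})$, $(\mathcal E_{\mathcal D},\mathcal M_{\mathcal D})$, and suppose both have pullbacks of two right-class morphisms with common codomain and pushouts of two left-class morphisms with common domain (existence of these diagrams is part of what is asserted when a functor is called a transfer functor). A transfer functor $T:\mathcal C\to\mathcal D$ is a conservative functor with $T(\mathcal E_{\mathcal C})\subseteq\mathcal E_{\mathcal D}$, $T(\mathcal M_{\mathcal C})\subseteq\mathcal M_{\mathcal D}$, preserving pullbacks of two $\mathcal M_{\mathcal C}$-morphisms and pushouts of two $\mathcal E_{\mathcal C}$-morphisms. Forms. An (orean) form $\mathsf F$ on a category $\mathcal C$ assigns to each object $X$ a set-sized bounded lattice $\mathsf F(X)$ (the fibre over $X$; its elements are called clusters) and to each morphism $f:X\to Y$ monotone maps $f_!:\mathsf F(X)\to\mathsf F(Y)$ and $f^*:\mathsf F(Y)\to\mathsf F(X)$ with $f_!S\le T\iff S\le f^*T$,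 such that $(gf)_!=g_!f_!$, $(gf)^*=f^*g^*$, and identities act as identities. Put $\operatorname{Im}f=f_!\top_X$ and $\operatorname{Ker}f=f^*\bot_Y$. A cluster in $\mathsf F(X)$ is conormal if it is the image of some morphism of $\mathcal C$ with codomain $X$, and normal if it is the kernel of some morphism of $\mathcal C$ with domain $X$. An embedding of a conormal $S\in\mathsf F(X)$ is a morphism $\iota$ into $X$ with $\operatorname{Im}\iota=S$ such that every morphism $f$ into $X$ with $\operatorname{Im}f\le S$ factors as $f=\iota h$ for a unique $h$. A quotient of a normal $K\in\mathsf F(X)$ is a morphism $\pi$ out of $X$ with $\operatorname{Ker}\pi=K$ such that every morphism $g$ out of $X$ with $K\le\operatorname{Ker}g$ factors as $g=h\pi$ for a unique $h$. The form is noetherian if: (N1) $f^*f_!S=S\vee\operatorname{Ker}f$ and $f_!f^*T=T\wedge\operatorname{Im}f$ for all $f,S,T$; (N2) every morphism $f$ factors as $f=me$ with $e$ a quotient of $\operatorname{Ker}f$ and $m$ an embedding of $\operatorname{Im}f$; (N3) the join of two normal clusters (in the same fibre) is normal, and the meet of two conormal clusters is conormal. The quotients of the form are all quotients of normal clusters; the embeddings of the form are all embeddings of conormal clusters. *)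

theory Defs
  imports
    Main
    "HOL-Library.FuncSet"
    "HOL-Library.Equipollence"
    "HOL-Algebra.Complete_Lattice"
begin

section \<open>Universes\<close>

text \<open>
  \<open>\<W>\<close> is the collection of sets that may be carriers. Either it consists of all subsets of
  \<open>'u\<close> (then "set" means "set of HOL", and there is no further distinction of size), or it is the
  collection of small sets of a Grothendieck universe coded on \<open>'u\<close>: closed under subsets,
  replacement, small unions and powersets, the last up to an injection since the members of \<open>\<W>\<close>
  are not elements of one another. Infinity is not demanded, so the finite subsets of an infinite
  type are an instance; in an extension of HOL with a type of ZF sets, so are its small sets.
\<close>

definition grothendieck_universe :: "'u set set \<Rightarrow> bool" where
  "grothendieck_universe \<W> \<longleftrightarrow>
     \<W> \<noteq> {} \<and>
     (\<forall>A\<in>\<W>. \<forall>B. B \<subseteq> A \<longrightarrow> B \<in> \<W>) \<and>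
     (\<forall>A\<in>\<W>. \<forall>f. f ` A \<in> \<W>) \<and>
     (\<forall>A\<in>\<W>. \<exists>B\<in>\<W>. Pow A \<lesssim> B) \<and>
     (\<forall>A\<in>\<W>. \<forall>B. (\<forall>a\<in>A. B a \<in> \<W>) \<longrightarrow> (\<Union>a\<in>A. B a) \<in> \<W>)"

definition universe :: "'u set set \<Rightarrow> bool" where
  "universe \<W> \<longleftrightarrow> \<W> = UNIV \<or> grothendieck_universe \<W>"

definition set_sized :: "'u set set \<Rightarrow> 'a set \<Rightarrow> bool" where
  "set_sized \<W> A \<longleftrightarrow> \<W> = UNIV \<or> (\<exists>B\<in>\<W>. A \<lesssim> B)"


section \<open>Categories\<close>

record ('o, 'm) cat =
  Obj :: "'o set"
  Arr :: "'m set"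
  Dom :: "'m \<Rightarrow> 'o"
  Cod :: "'m \<Rightarrow> 'o"
  Ident :: "'o \<Rightarrow> 'm"
  Comp :: "'m \<Rightarrow> 'm \<Rightarrow> 'm"  \<comment> \<open>\<open>Comp C g f\<close> is \<open>g\<close> after \<open>f\<close>\<close>

definition Hom :: "('o, 'm) cat \<Rightarrow> 'o \<Rightarrow> 'o \<Rightarrow> 'm set" where
  "Hom C X Y = {f \<in> Arr C. Dom C f = X \<and> Cod C f = Y}"

definition category :: "'u set set \<Rightarrow> ('o, 'm) cat \<Rightarrow> bool"  \<comment> \<open>locally small\<close> where
  "category \<W> C \<longleftrightarrow>
     (\<forall>f\<in>Arr C. Dom C f \<in> Obj C \<and> Cod C f \<in> Obj C) \<and>
     (\<forall>X\<in>Obj C. Ident C X \<in> Hom C X X) \<and>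
     (\<forall>f\<in>Arr C. \<forall>g\<in>Arr C. Dom C g = Cod C f \<longrightarrow> Comp C g f \<in> Hom C (Dom C f) (Cod C g)) \<and>
     (\<forall>f\<in>Arr C. Comp C f (Ident C (Dom C f)) = f \<and> Comp C (Ident C (Cod C f)) f = f) \<and>
     (\<forall>f\<in>Arr C. \<forall>g\<in>Arr C. \<forall>h\<in>Arr C. Dom C g = Cod C f \<and> Dom C h = Cod C g \<longrightarrow>
        Comp C h (Comp C g f) = Comp C (Comp C h g) f) \<and>
     (\<forall>X\<in>Obj C. \<forall>Y\<in>Obj C. set_sized \<W> (Hom C X Y))"

definition iso_arr :: "('o, 'm) cat \<Rightarrow> 'm \<Rightarrow> bool" where
  "iso_arr C f \<longleftrightarrow> f \<in> Arr C \<and>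
     (\<exists>g\<in>Hom C (Cod C f) (Dom C f).
        Comp C g f = Ident C (Dom C f) \<and> Comp C f g = Ident C (Cod C f))"

definition epi_arr :: "('o, 'm) cat \<Rightarrow> 'm \<Rightarrow> bool" where
  "epi_arr C f \<longleftrightarrow> f \<in> Arr C \<and>
     (\<forall>g\<in>Arr C. \<forall>h\<in>Arr C. Dom C g = Cod C f \<and> Dom C h = Cod C f \<and> Cod C g = Cod C h \<and>
        Comp C g f = Comp C h f \<longrightarrow> g = h)"

definition mono_arr :: "('o, 'm) cat \<Rightarrow> 'm \<Rightarrow> bool" where
  "mono_arr C f \<longleftrightarrow> f \<in> Arr C \<and>
     (\<forall>g\<in>Arr C. \<forall>h\<in>Arr C. Cod C g = Dom C f \<and> Cod C h = Dom C f \<and> Dom C g = Dom C h \<and>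
        Comp C f g = Comp C f h \<longrightarrow> g = h)"

text \<open>
  In a pullback, \<open>p\<close> and \<open>q\<close> are the projections to the domains of \<open>f\<close> and \<open>g\<close>; dually, in a
  pushout, the injections of their codomains.
\<close>

definition pullback_square :: "('o, 'm) cat \<Rightarrow> 'm \<Rightarrow> 'm \<Rightarrow> 'm \<Rightarrow> 'm \<Rightarrow> bool" where
  "pullback_square C f g p q \<longleftrightarrow>
     f \<in> Arr C \<and> g \<in> Arr C \<and> p \<in> Arr C \<and> q \<in> Arr C \<and>
     Cod C f = Cod C g \<and> Cod C p = Dom C f \<and> Cod C q = Dom C g \<and> Dom C p = Dom C q \<and>
     Comp C f p = Comp C g q \<and>
     (\<forall>a\<in>Arr C. \<forall>b\<in>Arr C. Cod C a = Dom C f \<and> Cod C b = Dom C g \<and> Dom C a = Dom C b \<and>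
        Comp C f a = Comp C g b \<longrightarrow>
        (\<exists>!u. u \<in> Hom C (Dom C a) (Dom C p) \<and> Comp C p u = a \<and> Comp C q u = b))"

definition pushout_square :: "('o, 'm) cat \<Rightarrow> 'm \<Rightarrow> 'm \<Rightarrow> 'm \<Rightarrow> 'm \<Rightarrow> bool" where
  "pushout_square C f g p q \<longleftrightarrow>
     f \<in> Arr C \<and> g \<in> Arr C \<and> p \<in> Arr C \<and> q \<in> Arr C \<and>
     Dom C f = Dom C g \<and> Dom C p = Cod C f \<and> Dom C q = Cod C g \<and> Cod C p = Cod C q \<and>
     Comp C p f = Comp C q g \<and>
     (\<forall>a\<in>Arr C. \<forall>b\<in>Arr C. Dom C a = Cod C f \<and> Dom C b = Cod C g \<and> Cod C a = Cod C b \<and>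
        Comp C a f = Comp C b g \<longrightarrow>
        (\<exists>!u. u \<in> Hom C (Cod C p) (Cod C a) \<and> Comp C u p = a \<and> Comp C u q = b))"

definition factorization_system :: "('o, 'm) cat \<Rightarrow> 'm set \<Rightarrow> 'm set \<Rightarrow> bool"  \<comment> \<open>orthogonal\<close> where
  "factorization_system C E M \<longleftrightarrow>
     E \<subseteq> Arr C \<and> M \<subseteq> Arr C \<and>
     {f. iso_arr C f} \<subseteq> E \<and> {f. iso_arr C f} \<subseteq> M \<and>
     (\<forall>f\<in>E. \<forall>g\<in>E. Dom C g = Cod C f \<longrightarrow> Comp C g f \<in> E) \<and>
     (\<forall>f\<in>M. \<forall>g\<in>M. Dom C g = Cod C f \<longrightarrow> Comp C g f \<in> M) \<and>
     (\<forall>f\<in>Arr C. \<exists>e\<in>E. \<exists>m\<in>M. Dom C m = Cod C e \<and> f = Comp C m e) \<and>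
     (\<forall>e\<in>E. \<forall>m\<in>M. \<forall>a\<in>Hom C (Dom C e) (Dom C m). \<forall>b\<in>Hom C (Cod C e) (Cod C m).
        Comp C m a = Comp C b e \<longrightarrow>
        (\<exists>!d. d \<in> Hom C (Cod C e) (Dom C m) \<and> Comp C d e = a \<and> Comp C m d = b))"

definition proper_factorization_system :: "('o, 'm) cat \<Rightarrow> 'm set \<Rightarrow> 'm set \<Rightarrow> bool" where
  "proper_factorization_system C E M \<longleftrightarrow>
     factorization_system C E M \<and> (\<forall>e\<in>E. epi_arr C e) \<and> (\<forall>m\<in>M. mono_arr C m)"

definition is_functor ::
  "('o, 'm) cat \<Rightarrow> ('p, 'n) cat \<Rightarrow> ('o \<Rightarrow> 'p) \<Rightarrow> ('m \<Rightarrow> 'n) \<Rightarrow> bool" where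
  "is_functor C D To Ta \<longleftrightarrow>
     (\<forall>X\<in>Obj C. To X \<in> Obj D \<and> Ta (Ident C X) = Ident D (To X)) \<and>
     (\<forall>f\<in>Arr C. Ta f \<in> Hom D (To (Dom C f)) (To (Cod C f))) \<and>
     (\<forall>f\<in>Arr C. \<forall>g\<in>Arr C. Dom C g = Cod C f \<longrightarrow> Ta (Comp C g f) = Comp D (Ta g) (Ta f))"

definition full ::
  "('o, 'm) cat \<Rightarrow> ('p, 'n) cat \<Rightarrow> ('o \<Rightarrow> 'p) \<Rightarrow> ('m \<Rightarrow> 'n) \<Rightarrow> bool" where
  "full C D To Ta \<longleftrightarrow> (\<forall>X\<in>Obj C. \<forall>Y\<in>Obj C. Ta ` Hom C X Y = Hom D (To X) (To Y))"

definition conservative :: "('o, 'm) cat \<Rightarrow> ('p, 'n) cat \<Rightarrow> ('m \<Rightarrow> 'n) \<Rightarrow> bool" where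
  "conservative C D Ta \<longleftrightarrow> (\<forall>f\<in>Arr C. iso_arr D (Ta f) \<longrightarrow> iso_arr C f)"

text \<open>
  A category with a proper factorization system \<open>(E, M)\<close>, pullbacks of pairs from \<open>M\<close> and
  pushouts of pairs from \<open>E\<close>.
\<close>

definition transfer_category :: "'u set set \<Rightarrow> ('o, 'm) cat \<Rightarrow> 'm set \<Rightarrow> 'm set \<Rightarrow> bool" where
  "transfer_category \<W> C E M \<longleftrightarrow>
     category \<W> C \<and> proper_factorization_system C E M \<and>
     (\<forall>f\<in>M. \<forall>g\<in>M. Cod C f = Cod C g \<longrightarrow> (\<exists>p q. pullback_square C f g p q)) \<and>
     (\<forall>f\<in>E. \<forall>g\<in>E. Dom C f = Dom C g \<longrightarrow> (\<exists>p q. pushout_square C f g p q))"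

definition transfer_functor ::
  "'u set set \<Rightarrow> ('o, 'm) cat \<Rightarrow> 'm set \<Rightarrow> 'm set \<Rightarrow> ('p, 'n) cat \<Rightarrow> 'n set \<Rightarrow> 'n set \<Rightarrow>
   ('o \<Rightarrow> 'p) \<Rightarrow> ('m \<Rightarrow> 'n) \<Rightarrow> bool" where
  "transfer_functor \<W> C E\<^sub>C M\<^sub>C D E\<^sub>D M\<^sub>D To Ta \<longleftrightarrow>
     transfer_category \<W> C E\<^sub>C M\<^sub>C \<and> transfer_category \<W> D E\<^sub>D M\<^sub>D \<and>
     is_functor C D To Ta \<and> conservative C D Ta \<and>
     Ta ` E\<^sub>C \<subseteq> E\<^sub>D \<and> Ta ` M\<^sub>C \<subseteq> M\<^sub>D \<and>
     (\<forall>f\<in>M\<^sub>C. \<forall>g\<in>M\<^sub>C. \<forall>p q. pullback_square C f g p q \<longrightarrow>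
        pullback_square D (Ta f) (Ta g) (Ta p) (Ta q)) \<and>
     (\<forall>f\<in>E\<^sub>C. \<forall>g\<in>E\<^sub>C. \<forall>p q. pushout_square C f g p q \<longrightarrow>
        pushout_square D (Ta f) (Ta g) (Ta p) (Ta q))"


section \<open>Lattices\<close>

definition compact_element :: "'a gorder \<Rightarrow> 'a \<Rightarrow> bool" where
  "compact_element L c \<longleftrightarrow> c \<in> carrier L \<and>
     (\<forall>A\<subseteq>carrier L. c \<sqsubseteq>\<^bsub>L\<^esub> \<Squnion>\<^bsub>L\<^esub> A \<longrightarrow> (\<exists>B\<subseteq>A. finite B \<and> c \<sqsubseteq>\<^bsub>L\<^esub> \<Squnion>\<^bsub>L\<^esub> B))"

definition algebraic_lattice :: "'a gorder \<Rightarrow> bool" where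
  "algebraic_lattice L \<longleftrightarrow> complete_lattice L \<and>
     (\<forall>x\<in>carrier L. \<exists>A\<subseteq>{c. compact_element L c}. x = \<Squnion>\<^bsub>L\<^esub> A)"

definition modular_lattice :: "'a gorder \<Rightarrow> bool" where
  "modular_lattice L \<longleftrightarrow> lattice L \<and>
     (\<forall>x\<in>carrier L. \<forall>y\<in>carrier L. \<forall>z\<in>carrier L. x \<sqsubseteq>\<^bsub>L\<^esub> z \<longrightarrow>
        x \<squnion>\<^bsub>L\<^esub> (y \<sqinter>\<^bsub>L\<^esub> z) = (x \<squnion>\<^bsub>L\<^esub> y) \<sqinter>\<^bsub>L\<^esub> z)"


section \<open>Forms\<close>

text \<open>
  HOL does not quantify over the type \<open>'c\<close> of clusters, so an assertion that a form exists has to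
  name a type large enough to hold the fibres.
\<close>

record ('o, 'm, 'c) form =
  Fib :: "'o \<Rightarrow> 'c gorder"
  push :: "'m \<Rightarrow> 'c \<Rightarrow> 'c"  \<comment> \<open>\<open>f\<^sub>!\<close>\<close>
  pull :: "'m \<Rightarrow> 'c \<Rightarrow> 'c"  \<comment> \<open>\<open>f\<^sup>*\<close>\<close>

definition orean_form :: "'u set set \<Rightarrow> ('o, 'm) cat \<Rightarrow> ('o, 'm, 'c) form \<Rightarrow> bool" where
  "orean_form \<W> C F \<longleftrightarrow>
     category \<W> C \<and>
     (\<forall>X\<in>Obj C. bounded_lattice (Fib F X) \<and> set_sized \<W> (carrier (Fib F X))) \<and>
     (\<forall>f\<in>Arr C.
        push F f \<in> carrier (Fib F (Dom C f)) \<rightarrow> carrier (Fib F (Cod C f)) \<and>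
        pull F f \<in> carrier (Fib F (Cod C f)) \<rightarrow> carrier (Fib F (Dom C f)) \<and>
        isotone (Fib F (Dom C f)) (Fib F (Cod C f)) (push F f) \<and>
        isotone (Fib F (Cod C f)) (Fib F (Dom C f)) (pull F f) \<and>
        (\<forall>S\<in>carrier (Fib F (Dom C f)). \<forall>T\<in>carrier (Fib F (Cod C f)).
           push F f S \<sqsubseteq>\<^bsub>Fib F (Cod C f)\<^esub> T \<longleftrightarrow> S \<sqsubseteq>\<^bsub>Fib F (Dom C f)\<^esub> pull F f T)) \<and>
     (\<forall>f\<in>Arr C. \<forall>g\<in>Arr C. Dom C g = Cod C f \<longrightarrow>
        (\<forall>S\<in>carrier (Fib F (Dom C f)). push F (Comp C g f) S = push F g (push F f S)) \<and>
        (\<forall>T\<in>carrier (Fib F (Cod C g)). pull F (Comp C g f) T = pull F f (pull F g T))) \<and>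
     (\<forall>X\<in>Obj C. \<forall>S\<in>carrier (Fib F X). push F (Ident C X) S = S \<and> pull F (Ident C X) S = S)"

definition Img :: "('o, 'm) cat \<Rightarrow> ('o, 'm, 'c) form \<Rightarrow> 'm \<Rightarrow> 'c" where
  "Img C F f = push F f \<top>\<^bsub>Fib F (Dom C f)\<^esub>"

definition Ker :: "('o, 'm) cat \<Rightarrow> ('o, 'm, 'c) form \<Rightarrow> 'm \<Rightarrow> 'c" where
  "Ker C F f = pull F f \<bottom>\<^bsub>Fib F (Cod C f)\<^esub>"

definition conormal :: "('o, 'm) cat \<Rightarrow> ('o, 'm, 'c) form \<Rightarrow> 'o \<Rightarrow> 'c \<Rightarrow> bool" where
  "conormal C F X S \<longleftrightarrow> (\<exists>f\<in>Arr C. Cod C f = X \<and> Img C F f = S)"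

definition normal :: "('o, 'm) cat \<Rightarrow> ('o, 'm, 'c) form \<Rightarrow> 'o \<Rightarrow> 'c \<Rightarrow> bool" where
  "normal C F X K \<longleftrightarrow> (\<exists>f\<in>Arr C. Dom C f = X \<and> Ker C F f = K)"

definition is_embedding :: "('o, 'm) cat \<Rightarrow> ('o, 'm, 'c) form \<Rightarrow> 'o \<Rightarrow> 'c \<Rightarrow> 'm \<Rightarrow> bool" where
  "is_embedding C F X S \<iota> \<longleftrightarrow> conormal C F X S \<and>
     \<iota> \<in> Arr C \<and> Cod C \<iota> = X \<and> Img C F \<iota> = S \<and>
     (\<forall>f\<in>Arr C. Cod C f = X \<and> Img C F f \<sqsubseteq>\<^bsub>Fib F X\<^esub> S \<longrightarrow>
        (\<exists>!h. h \<in> Hom C (Dom C f) (Dom C \<iota>) \<and> f = Comp C \<iota> h))"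

definition is_quotient :: "('o, 'm) cat \<Rightarrow> ('o, 'm, 'c) form \<Rightarrow> 'o \<Rightarrow> 'c \<Rightarrow> 'm \<Rightarrow> bool" where
  "is_quotient C F X K \<pi> \<longleftrightarrow> normal C F X K \<and>
     \<pi> \<in> Arr C \<and> Dom C \<pi> = X \<and> Ker C F \<pi> = K \<and>
     (\<forall>g\<in>Arr C. Dom C g = X \<and> K \<sqsubseteq>\<^bsub>Fib F X\<^esub> Ker C F g \<longrightarrow>
        (\<exists>!h. h \<in> Hom C (Cod C \<pi>) (Cod C g) \<and> g = Comp C h \<pi>))"

definition embeddings :: "('o, 'm) cat \<Rightarrow> ('o, 'm, 'c) form \<Rightarrow> 'm set" where
  "embeddings C F = {\<iota>. \<exists>X\<in>Obj C. \<exists>S. is_embedding C F X S \<iota>}"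

definition quotients :: "('o, 'm) cat \<Rightarrow> ('o, 'm, 'c) form \<Rightarrow> 'm set" where
  "quotients C F = {\<pi>. \<exists>X\<in>Obj C. \<exists>K. is_quotient C F X K \<pi>}"

definition noetherian_form :: "'u set set \<Rightarrow> ('o, 'm) cat \<Rightarrow> ('o, 'm, 'c) form \<Rightarrow> bool" where
  "noetherian_form \<W> C F \<longleftrightarrow>
     orean_form \<W> C F \<and>
     (\<forall>f\<in>Arr C.
        (\<forall>S\<in>carrier (Fib F (Dom C f)).
           pull F f (push F f S) = S \<squnion>\<^bsub>Fib F (Dom C f)\<^esub> Ker C F f) \<and>
        (\<forall>T\<in>carrier (Fib F (Cod C f)).
           push F f (pull F f T) = T \<sqinter>\<^bsub>Fib F (Cod C f)\<^esub> Img C F f)) \<and>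
     (\<forall>f\<in>Arr C. \<exists>e m. is_quotient C F (Dom C f) (Ker C F f) e \<and>
        is_embedding C F (Cod C f) (Img C F f) m \<and> Dom C m = Cod C e \<and> f = Comp C m e) \<and>
     (\<forall>X\<in>Obj C. \<forall>S T.
        (normal C F X S \<and> normal C F X T \<longrightarrow> normal C F X (S \<squnion>\<^bsub>Fib F X\<^esub> T)) \<and>
        (conormal C F X S \<and> conormal C F X T \<longrightarrow> conormal C F X (S \<sqinter>\<^bsub>Fib F X\<^esub> T)))"


section \<open>Many-sorted theories and their models\<close>

record ('s, 'f) signature =
  sorts :: "'s set"
  ops :: "'f set"
  arity :: "'f \<Rightarrow> 's list"
  res :: "'f \<Rightarrow> 's"

definition wf_signature :: "'u set set \<Rightarrow> ('s, 'f) signature \<Rightarrow> bool" where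
  "wf_signature \<W> \<Sigma> \<longleftrightarrow>
     (\<forall>f\<in>ops \<Sigma>. set (arity \<Sigma> f) \<subseteq> sorts \<Sigma> \<and> res \<Sigma> f \<in> sorts \<Sigma>) \<and>
     set_sized \<W> (sorts \<Sigma>) \<and> set_sized \<W> (ops \<Sigma>)"

text \<open>
  A context is the list of the sorts of its variables; \<open>Var i\<close> is the variable at position \<open>i\<close>.
\<close>

datatype 'f trm = Var nat | App 'f "'f trm list"

inductive has_sort :: "('s, 'f) signature \<Rightarrow> 's list \<Rightarrow> 'f trm \<Rightarrow> 's \<Rightarrow> bool"
  for \<Sigma> :: "('s, 'f) signature" and \<Gamma> :: "'s list" where
  "i < length \<Gamma> \<Longrightarrow> has_sort \<Sigma> \<Gamma> (Var i) (\<Gamma> ! i)"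
| "f \<in> ops \<Sigma> \<Longrightarrow> length ts = length (arity \<Sigma> f) \<Longrightarrow>
   (\<forall>j<length ts. has_sort \<Sigma> \<Gamma> (ts ! j) (arity \<Sigma> f ! j)) \<Longrightarrow>
   has_sort \<Sigma> \<Gamma> (App f ts) (res \<Sigma> f)"

definition wf_equation :: "('s, 'f) signature \<Rightarrow> 's list \<Rightarrow> 'f trm \<times> 'f trm \<Rightarrow> bool" where
  "wf_equation \<Sigma> \<Gamma> = (\<lambda>(t, s). \<exists>\<sigma>. has_sort \<Sigma> \<Gamma> t \<sigma> \<and> has_sort \<Sigma> \<Gamma> s \<sigma>)"

record ('s, 'f) equational_axiom =
  ectx :: "'s list"
  eqn :: "'f trm \<times> 'f trm"

record ('s, 'f, 'i) disjunctive_axiom =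
  dctx :: "'s list"
  index :: "'i set"
  disjunct :: "'i \<Rightarrow> ('f trm \<times> 'f trm) list"

definition algebraic_theory ::
  "'u set set \<Rightarrow> ('s, 'f) signature \<Rightarrow> ('s, 'f) equational_axiom set \<Rightarrow> bool" where
  "algebraic_theory \<W> \<Sigma> T\<^sub>0 \<longleftrightarrow>
     wf_signature \<W> \<Sigma> \<and> set_sized \<W> T\<^sub>0 \<and>
     (\<forall>a\<in>T\<^sub>0. set (ectx a) \<subseteq> sorts \<Sigma> \<and> wf_equation \<Sigma> (ectx a) (eqn a))"

definition disjunctive_axioms ::
  "'u set set \<Rightarrow> ('s, 'f) signature \<Rightarrow> ('s, 'f, 'i) disjunctive_axiom set \<Rightarrow> bool" where
  "disjunctive_axioms \<W> \<Sigma> A \<longleftrightarrow>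
     set_sized \<W> A \<and>
     (\<forall>a\<in>A. set (dctx a) \<subseteq> sorts \<Sigma> \<and> set_sized \<W> (index a) \<and>
        (\<forall>i\<in>index a. \<forall>e\<in>set (disjunct a i). wf_equation \<Sigma> (dctx a) e))"

record ('s, 'f, 'u) struct =
  car :: "'s \<Rightarrow> 'u set"
  opn :: "'f \<Rightarrow> 'u list \<Rightarrow> 'u"

definition tuples :: "('s, 'f, 'u) struct \<Rightarrow> 's list \<Rightarrow> 'u list set" where
  "tuples M \<Gamma> = {vs. list_all2 (\<lambda>v s. v \<in> car M s) vs \<Gamma>}"

text \<open>
  Carriers off the sorts, and operations off their domain, are given a default value, so that
  equality of structures and of homomorphisms is the mathematical one.
\<close>

definition structures :: "'u set set \<Rightarrow> ('s, 'f) signature \<Rightarrow> ('s, 'f, 'u) struct set" where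
  "structures \<W> \<Sigma> = {M.
     (\<forall>s\<in>sorts \<Sigma>. car M s \<in> \<W>) \<and> (\<forall>s. s \<notin> sorts \<Sigma> \<longrightarrow> car M s = {}) \<and>
     (\<forall>f\<in>ops \<Sigma>. opn M f \<in> tuples M (arity \<Sigma> f) \<rightarrow>\<^sub>E car M (res \<Sigma> f)) \<and>
     (\<forall>f. f \<notin> ops \<Sigma> \<longrightarrow> opn M f = (\<lambda>_. undefined))}"

definition homs ::
  "('s, 'f) signature \<Rightarrow> ('s, 'f, 'u) struct \<Rightarrow> ('s, 'f, 'u) struct \<Rightarrow> ('s \<Rightarrow> 'u \<Rightarrow> 'u) set" where
  "homs \<Sigma> M N = {h.
     (\<forall>s. h s \<in> car M s \<rightarrow>\<^sub>E car N s) \<and>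
     (\<forall>f\<in>ops \<Sigma>. \<forall>vs\<in>tuples M (arity \<Sigma> f).
        h (res \<Sigma> f) (opn M f vs) = opn N f (map2 h (arity \<Sigma> f) vs))}"

primrec interp :: "('s, 'f, 'u) struct \<Rightarrow> 'u list \<Rightarrow> 'f trm \<Rightarrow> 'u" where
  "interp M vs (Var i) = vs ! i"
| "interp M vs (App f ts) = opn M f (map (interp M vs) ts)"

definition holds :: "('s, 'f, 'u) struct \<Rightarrow> 'u list \<Rightarrow> 'f trm \<times> 'f trm \<Rightarrow> bool" where
  "holds M vs = (\<lambda>(t, s). interp M vs t = interp M vs s)"

definition sat_equational ::
  "('s, 'f, 'u) struct \<Rightarrow> ('s, 'f) equational_axiom \<Rightarrow> bool" where
  "sat_equational M a \<longleftrightarrow> (\<forall>vs\<in>tuples M (ectx a). holds M vs (eqn a))"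

definition sat_disjunctive ::
  "('s, 'f, 'u) struct \<Rightarrow> ('s, 'f, 'i) disjunctive_axiom \<Rightarrow> bool" where
  "sat_disjunctive M a \<longleftrightarrow>
     (\<forall>vs\<in>tuples M (dctx a). \<exists>i\<in>index a. \<forall>e\<in>set (disjunct a i). holds M vs e)"

type_synonym ('s, 'f, 'u) arrow =
  "('s, 'f, 'u) struct \<times> ('s \<Rightarrow> 'u \<Rightarrow> 'u) \<times> ('s, 'f, 'u) struct"

definition full_subcat ::
  "('s, 'f) signature \<Rightarrow> ('s, 'f, 'u) struct set \<Rightarrow> (('s, 'f, 'u) struct, ('s, 'f, 'u) arrow) cat"
  where
  "full_subcat \<Sigma> \<M> = \<lparr>
     Obj = \<M>,
     Arr = {(M, h, N). M \<in> \<M> \<and> N \<in> \<M> \<and> h \<in> homs \<Sigma> M N},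
     Dom = (\<lambda>(M, h, N). M),
     Cod = (\<lambda>(M, h, N). N),
     Ident = (\<lambda>M. (M, \<lambda>s. restrict id (car M s), M)),
     Comp = (\<lambda>(M', k, N) (M, h, N'). (M, \<lambda>s. compose (car M s) (k s) (h s), N)) \<rparr>"

definition Mod\<^sub>0 ::
  "'u set set \<Rightarrow> ('s, 'f) signature \<Rightarrow> ('s, 'f) equational_axiom set \<Rightarrow>
   (('s, 'f, 'u) struct, ('s, 'f, 'u) arrow) cat" where
  "Mod\<^sub>0 \<W> \<Sigma> T\<^sub>0 = full_subcat \<Sigma> {M \<in> structures \<W> \<Sigma>. \<forall>a\<in>T\<^sub>0. sat_equational M a}"

definition Mod ::
  "'u set set \<Rightarrow> ('s, 'f) signature \<Rightarrow> ('s, 'f) equational_axiom set \<Rightarrow>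
   ('s, 'f, 'i) disjunctive_axiom set \<Rightarrow> (('s, 'f, 'u) struct, ('s, 'f, 'u) arrow) cat" where
  "Mod \<W> \<Sigma> T\<^sub>0 A = full_subcat \<Sigma> {M \<in> structures \<W> \<Sigma>.
     (\<forall>a\<in>T\<^sub>0. sat_equational M a) \<and> (\<forall>a\<in>A. sat_disjunctive M a)}"

definition sortwise_surj ::
  "('s, 'f) signature \<Rightarrow> (('s, 'f, 'u) struct, ('s, 'f, 'u) arrow) cat \<Rightarrow> ('s, 'f, 'u) arrow set"
  where
  "sortwise_surj \<Sigma> C = {(M, h, N). (M, h, N) \<in> Arr C \<and> (\<forall>s\<in>sorts \<Sigma>. h s ` car M s = car N s)}"

definition sortwise_inj ::
  "('s, 'f) signature \<Rightarrow> (('s, 'f, 'u) struct, ('s, 'f, 'u) arrow) cat \<Rightarrow> ('s, 'f, 'u) arrow set"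
  where
  "sortwise_inj \<Sigma> C = {(M, h, N). (M, h, N) \<in> Arr C \<and> (\<forall>s\<in>sorts \<Sigma>. inj_on (h s) (car M s))}"

end

theory Submission
  imports Defs
begin

text \<open>
  Send a model \<open>M\<close> to the vector space over the field with two elements on the disjoint union of its
  carriers, and let the clusters over \<open>M\<close> be the subspaces, with direct and inverse images. Then (N1)
  is linear algebra, and the fibres are complete, algebraic and modular. The image of \<open>h\<close> is
  spanned by the image of \<open>h\<close> as a map, and its kernel is spanned by the differences \<open>x - y\<close> with
  \<open>h x = h y\<close>; so conormal clusters are the subalgebras and normal clusters are the congruences.
  As the axioms are positive and universal, models are closed under subalgebras and quotients.
  In the same way, pullbacks of injections and pushouts of surjections are intersections of
  subalgebras and quotients by joins of congruences, in the smaller category as in the larger one.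
\<close>

section \<open>Vector spaces of finite sets over the field with two elements\<close>

text \<open>One lattice per model has to hold both its subalgebras and its congruences and be
  modular, although the congruence lattice of an algebra need not be. Linearization resolves this:
  the fibres forget the operations, which only decide which clusters are images or kernels.
  Congruences embed in the subspaces with their joins but not with their meets: on four points the
  partitions 12|34 and 13|24 meet trivially, while both subspaces contain the vector 1+2+3+4. (N3)
  asks for joins of normal clusters and meets of conormal ones, and these do come out right. Over
  the field with two elements a vector of finite support is a finite set, addition is symmetric
  difference, and no coefficients or signs occur. Points carry their sort, so a many-sorted
  homomorphism induces a single linear map, and empty carriers merely contribute no basis vectors.
  Pullbacks of injections and pushouts of surjections are characterised by conditions on elements
  that do not mention the ambient category; this lets such squares pass to a larger one.\<close>

definition sdiff :: "'a set \<Rightarrow> 'a set \<Rightarrow> 'a set" (infixl "\<triangle>" 65) where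
  "A \<triangle> B = (A - B) \<union> (B - A)"

lemma mem_sdiff [simp]: "x \<in> A \<triangle> B \<longleftrightarrow> (x \<in> A) \<noteq> (x \<in> B)"
  by (auto simp: sdiff_def)

lemma sdiff_self [simp]: "A \<triangle> A = {}" and sdiff_empty [simp]: "A \<triangle> {} = A" "{} \<triangle> A = A"
  by auto

lemma sdiff_assoc: "A \<triangle> B \<triangle> C = A \<triangle> (B \<triangle> C)"
  by auto

lemma sdiff_cancel [simp]: "A \<triangle> (A \<triangle> B) = B"
  by auto

lemma finite_sdiff [simp]: "finite A \<Longrightarrow> finite B \<Longrightarrow> finite (A \<triangle> B)"
  by (simp add: sdiff_def)

lemma empty_mem_Fpow [simp]: "{} \<in> Fpow P"
  by (simp add: empty_in_Fpow)

lemma sdiff_Fpow: "A \<in> Fpow P \<Longrightarrow> B \<in> Fpow P \<Longrightarrow> A \<triangle> B \<in> Fpow P"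
  by (auto simp: Fpow_def)

text \<open>Elements of \<open>A \<inter> B\<close> are counted twice in
  \<open>card A + card B\<close>, so parity of the cardinality is an additive functional. Applied
  fibre by fibre, this makes \<open>fpush\<close> linear.\<close>

lemma even_card_sdiff:
  assumes "finite A" "finite B"
  shows "even (card (A \<triangle> B)) \<longleftrightarrow> (even (card A) \<longleftrightarrow> even (card B))"
proof -
  have "card A = card (A - B) + card (A \<inter> B)" "card B = card (B - A) + card (A \<inter> B)"
    using assms by (metis card_Int_Diff add.commute Int_commute)+
  moreover have "card (A \<triangle> B) = card (A - B) + card (B - A)"
    using assms by (auto simp: sdiff_def intro!: card_Un_disjoint)
  ultimately show ?thesis by (simp, blast)
qed

section \<open>Linear maps induced by functions between bases\<close>

text \<open>The linear extension of \<open>f\<close>, on supports: the coefficient at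
  \<open>b\<close> is the sum modulo 2 of the coefficients of the points over \<open>b\<close>.
  Points with the same value cancel in pairs, so the result may be smaller than the image of
  \<open>A\<close>.\<close>

definition fpush :: "('a \<Rightarrow> 'b) \<Rightarrow> 'a set \<Rightarrow> 'b set" where
  "fpush f A = {b. odd (card {a \<in> A. f a = b})}"

lemma fpush_empty [simp]: "fpush f {} = {}"
  by (simp add: fpush_def)

lemma fpush_singleton [simp]: "fpush f {a} = {f a}"
proof -
  have "{x. x = a \<and> f x = b} = (if f a = b then {a} else {})" for b by auto
  then show ?thesis by (auto simp: fpush_def)
qed

lemma fpush_sdiff:
  assumes "finite A" "finite B"
  shows "fpush f (A \<triangle> B) = fpush f A \<triangle> fpush f B"
proof -
  have "{a \<in> A \<triangle> B. f a = b} = {a \<in> A. f a = b} \<triangle> {a \<in> B. f a = b}" for b by auto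
  then show ?thesis using assms by (auto simp: fpush_def even_card_sdiff)
qed

lemma fpush_subset: "fpush f A \<subseteq> f ` A"
proof
  fix b assume "b \<in> fpush f A"
  then have "{a \<in> A. f a = b} \<noteq> {}" by (intro notI) (simp add: fpush_def)
  then show "b \<in> f ` A" by blast
qed

lemma finite_fpush [simp]: "finite A \<Longrightarrow> finite (fpush f A)"
  using fpush_subset finite_surj by metis

lemma fpush_Fpow: "A \<in> Fpow P \<Longrightarrow> f ` P \<subseteq> Q \<Longrightarrow> fpush f A \<in> Fpow Q"
  using fpush_subset[of f A] finite_fpush[of A f] unfolding Fpow_def by blast

lemma fpush_cong: "(\<And>a. a \<in> A \<Longrightarrow> f a = g a) \<Longrightarrow> fpush f A = fpush g A"
  unfolding fpush_def by (simp cong: conj_cong)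

lemma insert_eq_sdiff: "a \<notin> A \<Longrightarrow> insert a A = {a} \<triangle> A"
  by auto

lemma fpush_insert:
  "a \<notin> A \<Longrightarrow> finite A \<Longrightarrow> fpush f (insert a A) = {f a} \<triangle> fpush f A"
  unfolding insert_eq_sdiff[of a A] by (simp add: fpush_sdiff)

text \<open>Both sides are additive in \<open>A\<close>, so induction on the support reduces the
  claim to singletons.\<close>

lemma fpush_comp: "finite A \<Longrightarrow> fpush g (fpush f A) = fpush (g \<circ> f) A"
  by (induction rule: finite_induct) (simp_all add: fpush_insert fpush_sdiff)

lemma fpush_id:
  assumes "finite A" "\<And>a. a \<in> A \<Longrightarrow> f a = a"
  shows "fpush f A = A"
proof -
  have "fpush (\<lambda>a. a) A = A"
    using assms(1) by (induction rule: finite_induct) (simp_all add: fpush_insert insert_eq_sdiff[symmetric])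
  then show ?thesis using fpush_cong[of A f "\<lambda>a. a"] assms(2) by simp
qed

text \<open>Basis vectors of the target lift, and the lifts are added up one at a time. This is what
  identifies the image of a homomorphism in the form with its image as a map.\<close>

lemma fpush_image_Fpow: "fpush f ` Fpow P = Fpow (f ` P)"
proof
  show "fpush f ` Fpow P \<subseteq> Fpow (f ` P)"
    by (auto intro: fpush_Fpow)
  show "Fpow (f ` P) \<subseteq> fpush f ` Fpow P"
  proof
    fix B assume "B \<in> Fpow (f ` P)"
    then have "finite B" "B \<subseteq> f ` P" by (auto simp: Fpow_def)
    then show "B \<in> fpush f ` Fpow P"
    proof (induction rule: finite_induct)
      case empty
      then show ?case by (force simp: Fpow_def)
    next
      case (insert b B)
      then obtain A a where A: "B = fpush f A" "A \<in> Fpow P" and a: "b = f a" "a \<in> P"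
        by blast
      \<comment> \<open>The sum \<open>{a} \<triangle> A\<close> is used and not
        \<open>insert a A\<close>: points of \<open>A\<close> that cancel under \<open>f\<close> may
        include \<open>a\<close>.\<close>
      then have "fpush f ({a} \<triangle> A) = {b} \<triangle> B" "{a} \<triangle> A \<in> Fpow P"
        by (auto simp: fpush_sdiff Fpow_def)
      then show ?case unfolding insert_eq_sdiff[OF insert.hyps(2)] by (metis image_eqI)
    qed
  qed
qed

text \<open>Two points of \<open>v\<close> in the same fibre can be cancelled, since fibres of \<open>v\<close> are even.\<close>

lemma fpush_kernel_induct:
  assumes "finite v" "fpush f v = {}" and "v \<subseteq> P"
    and "S {}" and "\<And>a b w. a \<in> P \<Longrightarrow> b \<in> P \<Longrightarrow> f a = f b \<Longrightarrow> S w \<Longrightarrow> S ({a} \<triangle> {b} \<triangle> w)"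
  shows "S v"
  using assms(1-3)
proof (induction "card v" arbitrary: v rule: less_induct)
  case less
  show ?case
  proof (cases "v = {}")
    case False
    then obtain a where a: "a \<in> v" by blast
    have "even (card {x \<in> v. f x = f a})"
      using less.prems(2) by (auto simp: fpush_def)
    moreover have "a \<in> {x \<in> v. f x = f a}" using a by simp
    ultimately have "{x \<in> v. f x = f a} \<noteq> {a}" by auto
    then obtain b where b: "b \<in> v" "b \<noteq> a" "f b = f a" using a by blast
    define w where "w = v - {a, b}"
    have v: "v = {a} \<triangle> {b} \<triangle> w" using a b unfolding w_def by auto
    have w: "finite w" "w \<subseteq> P" "card w < card v"
      using less.prems(1,3) a unfolding w_def by (auto intro!: psubset_card_mono)
    have "fpush f v = fpush f w"
      using w(1) b(3) by (subst v) (simp add: fpush_sdiff)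
    then have "S w" using less.hyps[OF w(3,1) _ w(2)] less.prems(2) by simp
    then have "S ({a} \<triangle> {b} \<triangle> w)"
      using assms(5)[of a b w] a b less.prems(3) by auto
    then show ?thesis using v by simp
  qed (use assms in simp)
qed

section \<open>The lattice of subspaces\<close>

text \<open>The only scalars are 0 and 1, so closure under addition together with the zero vector
  already gives a linear subspace.\<close>

definition subspace_of :: "'a set \<Rightarrow> 'a set set \<Rightarrow> bool" where
  "subspace_of P S \<longleftrightarrow> S \<subseteq> Fpow P \<and> {} \<in> S \<and> (\<forall>A\<in>S. \<forall>B\<in>S. A \<triangle> B \<in> S)"

definition subspaces :: "'a set \<Rightarrow> 'a set set gorder" where
  "subspaces P = \<lparr>carrier = {S. subspace_of P S}, eq = (=), le = (\<subseteq>)\<rparr>"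

lemma subspaces_sel [simp]:
  "S \<in> carrier (subspaces P) \<longleftrightarrow> subspace_of P S"
  "S \<sqsubseteq>\<^bsub>subspaces P\<^esub> T \<longleftrightarrow> S \<subseteq> T"
  "S .=\<^bsub>subspaces P\<^esub> T \<longleftrightarrow> S = T"
  by (simp_all add: subspaces_def)

lemma subspace_ofD:
  assumes "subspace_of P S"
  shows "{} \<in> S" "a \<in> S \<Longrightarrow> b \<in> S \<Longrightarrow> a \<triangle> b \<in> S" "a \<in> S \<Longrightarrow> a \<in> Fpow P" "a \<in> S \<Longrightarrow> finite a"
  using assms by (auto simp: subspace_of_def Fpow_def)

lemma subspace_of_Fpow: "subspace_of P (Fpow P)"
  by (auto simp: subspace_of_def sdiff_Fpow)

lemma subspace_of_zero: "subspace_of P {{}}"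
  by (auto simp: subspace_of_def)

lemma subspace_of_Inter:
  "\<A> \<noteq> {} \<Longrightarrow> (\<And>S. S \<in> \<A> \<Longrightarrow> subspace_of P S) \<Longrightarrow> subspace_of P (\<Inter>\<A>)"
  unfolding subspace_of_def by blast

lemma subspace_of_Int: "subspace_of P S \<Longrightarrow> subspace_of P T \<Longrightarrow> subspace_of P (S \<inter> T)"
  unfolding subspace_of_def by blast

lemma subspace_of_sum:
  assumes "subspace_of P S" "subspace_of P T"
  shows "subspace_of P {a \<triangle> b | a b. a \<in> S \<and> b \<in> T}"
  unfolding subspace_of_def
proof (intro conjI ballI)
  show "{a \<triangle> b | a b. a \<in> S \<and> b \<in> T} \<subseteq> Fpow P"
    using assms by (auto dest: subspace_ofD intro: sdiff_Fpow)
  show "{} \<in> {a \<triangle> b | a b. a \<in> S \<and> b \<in> T}"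
    using subspace_ofD(1)[OF assms(1)] subspace_ofD(1)[OF assms(2)]
    by (intro CollectI exI[of _ "{}"] conjI) simp_all
  fix x y assume "x \<in> {a \<triangle> b | a b. a \<in> S \<and> b \<in> T}" "y \<in> {a \<triangle> b | a b. a \<in> S \<and> b \<in> T}"
  then obtain a b a' b' where *: "x = a \<triangle> b" "y = a' \<triangle> b'" "a \<in> S" "a' \<in> S" "b \<in> T" "b' \<in> T"
    by blast
  then have "x \<triangle> y = (a \<triangle> a') \<triangle> (b \<triangle> b')" by auto
  moreover have "a \<triangle> a' \<in> S" "b \<triangle> b' \<in> T" using * assms by (simp_all add: subspace_ofD(2))
  ultimately show "x \<triangle> y \<in> {a \<triangle> b | a b. a \<in> S \<and> b \<in> T}" by blast
qed

lemma subspaces_partial_order: "partial_order (subspaces P)"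
  by unfold_locales (auto simp: subspaces_def)

lemma subspaces_complete: "complete_lattice (subspaces P)"
proof (rule partial_order.complete_lattice_criterion1[OF subspaces_partial_order])
  show "\<exists>g. greatest (subspaces P) g (carrier (subspaces P))"
    by (rule exI[of _ "Fpow P"])
      (auto simp: greatest_def subspace_of_Fpow subspace_of_def sdiff_Fpow)
  fix \<A> assume "\<A> \<subseteq> carrier (subspaces P)" "\<A> \<noteq> {}"
  moreover from this have "subspace_of P (\<Inter>\<A>)" by (intro subspace_of_Inter) auto
  ultimately show "\<exists>i. greatest (subspaces P) i (Lower (subspaces P) \<A>)"
    by (intro exI[of _ "\<Inter>\<A>"]) (auto simp: greatest_def Lower_def subset_iff)
qed

lemma subspaces_bounded: "bounded_lattice (subspaces P)"
proof -
  interpret complete_lattice "subspaces P" by (rule subspaces_complete)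
  show ?thesis by unfold_locales
qed

lemma subspaces_lattice: "lattice (subspaces P)"
  by (rule bounded_lattice.axioms(1)[OF subspaces_bounded])

text \<open>Completeness is obtained from intersections, so suprema are known only as least upper
  bounds; joins of families are handled through these three properties.\<close>

lemma subspaces_Sup:
  assumes "\<A> \<subseteq> Collect (subspace_of P)"
  shows "subspace_of P (\<Squnion>\<^bsub>subspaces P\<^esub> \<A>)"
    and "S \<in> \<A> \<Longrightarrow> S \<subseteq> \<Squnion>\<^bsub>subspaces P\<^esub> \<A>"
    and "subspace_of P T \<Longrightarrow> (\<And>S. S \<in> \<A> \<Longrightarrow> S \<subseteq> T) \<Longrightarrow> \<Squnion>\<^bsub>subspaces P\<^esub> \<A> \<subseteq> T"
proof -
  interpret complete_lattice "subspaces P" by (rule subspaces_complete)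
  have A: "\<A> \<subseteq> carrier (subspaces P)" using assms by auto
  show "subspace_of P (\<Squnion>\<^bsub>subspaces P\<^esub> \<A>)" using sup_closed[OF A] by simp
  show "S \<in> \<A> \<Longrightarrow> S \<subseteq> \<Squnion>\<^bsub>subspaces P\<^esub> \<A>" using sup_upper[OF A] by simp
  show "subspace_of P T \<Longrightarrow> (\<And>S. S \<in> \<A> \<Longrightarrow> S \<subseteq> T) \<Longrightarrow> \<Squnion>\<^bsub>subspaces P\<^esub> \<A> \<subseteq> T"
    using sup_least[OF A, of T] by simp
qed

lemma subspaces_top: "\<top>\<^bsub>subspaces P\<^esub> = Fpow P"
proof -
  interpret bounded_lattice "subspaces P" by (rule subspaces_bounded)
  show ?thesis
    using top_eq[of "Fpow P"] by (simp add: subspace_of_Fpow subspace_of_def sdiff_Fpow)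
qed

lemma subspaces_bottom: "\<bottom>\<^bsub>subspaces P\<^esub> = {{}}"
proof -
  interpret bounded_lattice "subspaces P" by (rule subspaces_bounded)
  show ?thesis
    using bottom_eq[of "{{}}"] by (simp add: subspace_of_zero subspace_of_def)
qed

text \<open>The sums form a subspace that contains \<open>S\<close> and \<open>T\<close>, by taking
  the other summand to be zero, and every subspace above both contains all these sums.\<close>

lemma subspaces_join:
  assumes "subspace_of P S" "subspace_of P T"
  shows "S \<squnion>\<^bsub>subspaces P\<^esub> T = {a \<triangle> b | a b. a \<in> S \<and> b \<in> T}"
proof -
  have ST: "{S, T} \<subseteq> Collect (subspace_of P)" using assms by simp
  note J = subspaces_Sup[OF ST]
  show ?thesis unfolding join_def
  proof
    have "a \<in> {a \<triangle> b | a b. a \<in> S \<and> b \<in> T}" if "a \<in> S" for a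
      using that subspace_ofD(1)[OF assms(2)] by (intro CollectI exI[of _ a] exI[of _ "{}"]) simp
    moreover have "b \<in> {a \<triangle> b | a b. a \<in> S \<and> b \<in> T}" if "b \<in> T" for b
      using that subspace_ofD(1)[OF assms(1)] by (intro CollectI exI[of _ "{}"] exI[of _ b]) simp
    ultimately show "\<Squnion>\<^bsub>subspaces P\<^esub> {S, T} \<subseteq> {a \<triangle> b | a b. a \<in> S \<and> b \<in> T}"
      by (intro J(3)[OF subspace_of_sum[OF assms]]) blast
    have "a \<triangle> b \<in> \<Squnion>\<^bsub>subspaces P\<^esub> {S, T}" if "a \<in> S" "b \<in> T" for a b
      using that J(2)[of S] J(2)[of T] by (intro subspace_ofD(2)[OF J(1)]) auto
    then show "{a \<triangle> b | a b. a \<in> S \<and> b \<in> T} \<subseteq> \<Squnion>\<^bsub>subspaces P\<^esub> {S, T}"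
      by blast
  qed
qed

lemma subspaces_meet:
  assumes "subspace_of P S" "subspace_of P T"
  shows "S \<sqinter>\<^bsub>subspaces P\<^esub> T = S \<inter> T"
proof -
  interpret lattice "subspaces P" by (rule subspaces_lattice)
  show ?thesis
    using meet_left[of S T] meet_right[of S T] meet_le[of "S \<inter> T" S T] subspace_of_Int[of P S T] assms
    by auto
qed

text \<open>Only one inclusion needs an argument: if \<open>c = a \<triangle> b\<close> lies in
  \<open>U\<close> and \<open>a\<close> lies in \<open>S \<subseteq> U\<close>, then so does
  \<open>b = a \<triangle> c\<close>, as addition is its own inverse.\<close>

lemma subspaces_modular: "modular_lattice (subspaces P)"
  unfolding modular_lattice_def
proof (intro conjI subspaces_lattice ballI impI, unfold subspaces_sel)
  fix S T U assume S: "subspace_of P S" and T: "subspace_of P T" and U: "subspace_of P U" and SU: "S \<subseteq> U"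
  have "c \<in> {a \<triangle> b | a b. a \<in> S \<and> b \<in> T \<inter> U} \<longleftrightarrow> c \<in> {a \<triangle> b | a b. a \<in> S \<and> b \<in> T} \<inter> U" for c
  proof
    assume "c \<in> {a \<triangle> b | a b. a \<in> S \<and> b \<in> T} \<inter> U"
    then obtain a b where *: "c = a \<triangle> b" "a \<in> S" "b \<in> T" "c \<in> U" by blast
    then have "b = a \<triangle> c" by simp
    then have "b \<in> U" using * SU subspace_ofD(2)[OF U] by blast
    then show "c \<in> {a \<triangle> b | a b. a \<in> S \<and> b \<in> T \<inter> U}" using * by blast
  qed (use SU subspace_ofD(2)[OF U] in blast)
  then show "S \<squnion>\<^bsub>subspaces P\<^esub> (T \<sqinter>\<^bsub>subspaces P\<^esub> U) = (S \<squnion>\<^bsub>subspaces P\<^esub> T) \<sqinter>\<^bsub>subspaces P\<^esub> U"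
    using S T U by (auto simp: subspaces_join subspaces_meet subspace_of_Int subspace_of_sum)
qed

text \<open>The subspaces \<open>{{}, v}\<close> spanned by one vector are compact, and every
  subspace is the join of those it contains.\<close>

lemma subspaces_algebraic: "algebraic_lattice (subspaces P)"
proof -
  have line: "subspace_of P {{}, v}" if "v \<in> Fpow P" for v
    using that by (auto simp: subspace_of_def)
  have "compact_element (subspaces P) {{}, v}" if v: "v \<in> Fpow P" for v
    unfolding compact_element_def
  proof (intro conjI allI impI)
    fix \<A> assume A: "\<A> \<subseteq> carrier (subspaces P)" and "{{}, v} \<sqsubseteq>\<^bsub>subspaces P\<^esub> \<Squnion>\<^bsub>subspaces P\<^esub> \<A>"
    then have v_in: "v \<in> \<Squnion>\<^bsub>subspaces P\<^esub> \<A>" by simp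
    have A': "\<A> \<subseteq> Collect (subspace_of P)" using A by auto
    \<comment> \<open>The directed union of the joins of finite subfamilies. It is a subspace above
      every member of \<open>\<A>\<close>, hence above the supremum, so \<open>v\<close> already
      lies in a finite join.\<close>
    define U where "U = {w. \<exists>\<B>\<subseteq>\<A>. finite \<B> \<and> w \<in> \<Squnion>\<^bsub>subspaces P\<^esub> \<B>}"
    have sub: "\<B> \<subseteq> \<A> \<Longrightarrow> \<B> \<subseteq> Collect (subspace_of P)" for \<B>
      using A' by blast
    have "subspace_of P U"
      unfolding subspace_of_def
    proof (intro conjI ballI subsetI)
      show "{} \<in> U"
        unfolding U_def using subspace_ofD(1)[OF subspaces_Sup(1)[OF sub[of "{}"]]] by blast
      fix w assume "w \<in> U"
      then obtain \<B> where B: "\<B> \<subseteq> \<A>" "finite \<B>" "w \<in> \<Squnion>\<^bsub>subspaces P\<^esub> \<B>"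
        unfolding U_def by blast
      then show "w \<in> Fpow P"
        using subspace_ofD(3)[OF subspaces_Sup(1)[OF sub]] by blast
      fix w' assume "w' \<in> U"
      then obtain \<B>' where B': "\<B>' \<subseteq> \<A>" "finite \<B>'" "w' \<in> \<Squnion>\<^bsub>subspaces P\<^esub> \<B>'"
        unfolding U_def by blast
      have BB: "\<B> \<union> \<B>' \<subseteq> Collect (subspace_of P)" using B B' by (intro sub) blast
      have "\<Squnion>\<^bsub>subspaces P\<^esub> \<B> \<subseteq> \<Squnion>\<^bsub>subspaces P\<^esub> (\<B> \<union> \<B>')" "\<Squnion>\<^bsub>subspaces P\<^esub> \<B>' \<subseteq> \<Squnion>\<^bsub>subspaces P\<^esub> (\<B> \<union> \<B>')"
        using BB by (intro subspaces_Sup(3) subspaces_Sup(1,2); blast)+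
      then have "w \<triangle> w' \<in> \<Squnion>\<^bsub>subspaces P\<^esub> (\<B> \<union> \<B>')"
        using B(3) B'(3) by (intro subspace_ofD(2)[OF subspaces_Sup(1)[OF BB]]) auto
      then show "w \<triangle> w' \<in> U"
        using B B' unfolding U_def by (intro CollectI exI[of _ "\<B> \<union> \<B>'"]) auto
    qed
    moreover have "S \<subseteq> U" if "S \<in> \<A>" for S
      using that subspaces_Sup(2)[OF sub[of "{S}"], of S] unfolding U_def
      by (intro subsetI CollectI exI[of _ "{S}"]) auto
    ultimately have "\<Squnion>\<^bsub>subspaces P\<^esub> \<A> \<subseteq> U"
      by (intro subspaces_Sup(3)[OF A'])
    then obtain \<B> where B: "\<B> \<subseteq> \<A>" "finite \<B>" "v \<in> \<Squnion>\<^bsub>subspaces P\<^esub> \<B>"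
      using v_in unfolding U_def by blast
    moreover have "{} \<in> \<Squnion>\<^bsub>subspaces P\<^esub> \<B>"
      using subspace_ofD(1)[OF subspaces_Sup(1)[OF sub]] B(1) by blast
    ultimately show "\<exists>\<B>\<subseteq>\<A>. finite \<B> \<and> {{}, v} \<sqsubseteq>\<^bsub>subspaces P\<^esub> \<Squnion>\<^bsub>subspaces P\<^esub> \<B>"
      by auto
  qed (use line v in simp)
  moreover have "S = \<Squnion>\<^bsub>subspaces P\<^esub> ((\<lambda>v. {{}, v}) ` S)" if S: "subspace_of P S" for S
  proof -
    have L: "(\<lambda>v. {{}, v}) ` S \<subseteq> Collect (subspace_of P)"
      using line subspace_ofD(3)[OF S] by auto
    show ?thesis
      using subspaces_Sup(2)[OF L] subspaces_Sup(3)[OF L S] subspace_ofD(1)[OF S] by blast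
  qed
  ultimately have "\<exists>A\<subseteq>{c. compact_element (subspaces P) c}. S = \<Squnion>\<^bsub>subspaces P\<^esub> A"
    if "subspace_of P S" for S
    using that by (intro exI[of _ "(\<lambda>v. {{}, v}) ` S"]) (auto dest: subspace_ofD)
  then show ?thesis
    by (simp add: algebraic_lattice_def subspaces_complete)
qed

section \<open>Direct and inverse images of subspaces\<close>

lemma subspace_of_image:
  assumes "subspace_of P S" "f ` P \<subseteq> Q"
  shows "subspace_of Q (fpush f ` S)"
  unfolding subspace_of_def
proof (intro conjI ballI)
  show "fpush f ` S \<subseteq> Fpow Q"
    using fpush_Fpow[OF _ assms(2)] subspace_ofD(3)[OF assms(1)] by blast
  show "{} \<in> fpush f ` S"
    using subspace_ofD(1)[OF assms(1)] by (intro image_eqI[of _ _ "{}"]) simp_all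
  fix x y assume "x \<in> fpush f ` S" "y \<in> fpush f ` S"
  then obtain a b where ab: "x = fpush f a" "y = fpush f b" "a \<in> S" "b \<in> S" by blast
  then have "x \<triangle> y = fpush f (a \<triangle> b)" using subspace_ofD(4)[OF assms(1)] by (simp add: fpush_sdiff)
  then show "x \<triangle> y \<in> fpush f ` S" using subspace_ofD(2)[OF assms(1)] ab by simp
qed

lemma subspace_of_vimage:
  assumes "subspace_of Q T"
  shows "subspace_of P {v \<in> Fpow P. fpush f v \<in> T}"
  using subspace_ofD(1,2)[OF assms]
  by (auto simp: subspace_of_def sdiff_Fpow Fpow_def fpush_sdiff)

text \<open>If \<open>v\<close> has the same image as \<open>a \<in> S\<close>, then
  \<open>a \<triangle> v\<close> lies in the kernel and
  \<open>v = a \<triangle> (a \<triangle> v)\<close>. The kernel appears as the inverse image of the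
  zero subspace \<open>{{}}\<close>, the form in which the pullback of the bottom cluster produces
  it.\<close>

lemma fpush_vimage_image:
  assumes "subspace_of P S"
  shows "{v \<in> Fpow P. fpush f v \<in> fpush f ` S} =
    S \<squnion>\<^bsub>subspaces P\<^esub> {v \<in> Fpow P. fpush f v \<in> {{}}}"
  unfolding subspaces_join[OF assms subspace_of_vimage[OF subspace_of_zero]]
proof
  show "{v \<in> Fpow P. fpush f v \<in> fpush f ` S} \<subseteq>
      {a \<triangle> b | a b. a \<in> S \<and> b \<in> {v \<in> Fpow P. fpush f v \<in> {{}}}}"
  proof
    fix v assume "v \<in> {v \<in> Fpow P. fpush f v \<in> fpush f ` S}"
    then obtain a where v: "v \<in> Fpow P" and a: "a \<in> S" "fpush f v = fpush f a" by blast
    have a': "a \<in> Fpow P" using subspace_ofD(3)[OF assms a(1)] .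
    have "fpush f (a \<triangle> v) = {}" using v a' a(2) by (simp add: Fpow_def fpush_sdiff)
    moreover have "a \<triangle> v \<in> Fpow P" using a' v by (rule sdiff_Fpow)
    ultimately show "v \<in> {a \<triangle> b | a b. a \<in> S \<and> b \<in> {v \<in> Fpow P. fpush f v \<in> {{}}}}"
      using a(1) by (intro CollectI exI[of _ a] exI[of _ "a \<triangle> v"]) simp
  qed
  show "{a \<triangle> b | a b. a \<in> S \<and> b \<in> {v \<in> Fpow P. fpush f v \<in> {{}}}} \<subseteq>
      {v \<in> Fpow P. fpush f v \<in> fpush f ` S}"
  proof
    fix v assume "v \<in> {a \<triangle> b | a b. a \<in> S \<and> b \<in> {v \<in> Fpow P. fpush f v \<in> {{}}}}"
    then obtain a b where v: "v = a \<triangle> b" "a \<in> S" "b \<in> Fpow P" "fpush f b = {}" by blast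
    have a': "a \<in> Fpow P" using subspace_ofD(3)[OF assms v(2)] .
    have "fpush f v = fpush f a" using v a' by (simp add: Fpow_def fpush_sdiff)
    then show "v \<in> {v \<in> Fpow P. fpush f v \<in> fpush f ` S}" using v a' by (simp add: sdiff_Fpow)
  qed
qed

lemma fpush_image_vimage:
  assumes "subspace_of Q T" "f ` P \<subseteq> Q"
  shows "fpush f ` {v \<in> Fpow P. fpush f v \<in> T} = T \<sqinter>\<^bsub>subspaces Q\<^esub> fpush f ` Fpow P"
  unfolding subspaces_meet[OF assms(1) subspace_of_image[OF subspace_of_Fpow assms(2)]] by blast

section \<open>Structures and homomorphisms\<close>

lemma universe_subset: "universe \<W> \<Longrightarrow> A \<in> \<W> \<Longrightarrow> B \<subseteq> A \<Longrightarrow> B \<in> \<W>"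
  by (auto simp: universe_def grothendieck_universe_def)

text \<open>The disjoint union of the carriers. Carriers off the sorts of a structure are empty, so
  indexing by \<open>UNIV\<close> adds no points and saves a side condition on
  \<open>s\<close>.\<close>

definition pts :: "('s, 'f, 'u) struct \<Rightarrow> ('s \<times> 'u) set" where
  "pts M = (SIGMA s:UNIV. car M s)"

lemma mem_pts [simp]: "(s, x) \<in> pts M \<longleftrightarrow> x \<in> car M s"
  by (simp add: pts_def)

lemma tuples_iff:
  "vs \<in> tuples M \<Gamma> \<longleftrightarrow> length vs = length \<Gamma> \<and> (\<forall>i<length \<Gamma>. vs ! i \<in> car M (\<Gamma> ! i))"
  by (auto simp: tuples_def list_all2_conv_all_nth)

text \<open>Paired with its sorts, a tuple is a list of points; relations and subsets of
  \<open>pts M\<close> can then be applied to arguments of operations entry by entry.\<close>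

lemma tuples_iff_zip: "vs \<in> tuples M \<Gamma> \<longleftrightarrow> length vs = length \<Gamma> \<and> set (zip \<Gamma> vs) \<subseteq> pts M"
  unfolding tuples_iff by (fastforce simp: set_zip)

lemma map2_tuples:
  assumes "vs \<in> tuples M \<Gamma>" "\<And>s x. x \<in> car M s \<Longrightarrow> h s x \<in> car N s"
  shows "map2 h \<Gamma> vs \<in> tuples N \<Gamma>"
  using assms by (auto simp: tuples_iff)

lemma map2_tuples_cong:
  assumes "vs \<in> tuples M \<Gamma>" "\<And>s x. x \<in> car M s \<Longrightarrow> g s x = h s x"
  shows "map2 g \<Gamma> vs = map2 h \<Gamma> vs"
  by (rule nth_equalityI) (use assms in \<open>auto simp: tuples_iff\<close>)

lemma map2_map2:
  "length vs = length \<Gamma> \<Longrightarrow> map2 g \<Gamma> (map2 h \<Gamma> vs) = map2 (\<lambda>s x. g s (h s x)) \<Gamma> vs"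
  by (auto intro!: nth_equalityI)

lemma map2_tuples_id:
  assumes "vs \<in> tuples M \<Gamma>" "\<And>s x. x \<in> car M s \<Longrightarrow> h s x = x"
  shows "map2 h \<Gamma> vs = vs"
  using assms by (auto simp: tuples_iff intro!: nth_equalityI)

lemma tuples_length: "vs \<in> tuples M \<Gamma> \<Longrightarrow> length vs = length \<Gamma>"
  by (simp add: tuples_iff)

lemma tuples_mono: "vs \<in> tuples M \<Gamma> \<Longrightarrow> (\<And>s. car M s \<subseteq> car N s) \<Longrightarrow> vs \<in> tuples N \<Gamma>"
  by (auto simp: tuples_iff)

text \<open>Preimages are chosen entry by entry. Through this lemma, operations and axioms are
  checked on a quotient by computing in the structure above it.\<close>

lemma tuples_lift:
  assumes "\<And>s. car N s \<subseteq> e s ` car M s" "vs \<in> tuples N \<Gamma>"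
  obtains ws where "ws \<in> tuples M \<Gamma>" "map2 e \<Gamma> ws = vs"
proof
  let ?ws = "map2 (\<lambda>s. inv_into (car M s) (e s)) \<Gamma> vs"
  have r: "inv_into (car M s) (e s) x \<in> car M s" "e s (inv_into (car M s) (e s) x) = x"
    if "x \<in> car N s" for s x
    using that assms(1)[of s] by (auto intro: inv_into_into f_inv_into_f)
  show "?ws \<in> tuples M \<Gamma>" using assms(2) r(1) by (rule map2_tuples)
  show "map2 e \<Gamma> ?ws = vs"
    using map2_tuples_id[OF assms(2), of "\<lambda>s x. e s (inv_into (car M s) (e s) x)"] r(2)
    by (simp add: map2_map2 tuples_length[OF assms(2)])
qed

lemma structures_opn:
  "M \<in> structures \<W> \<Sigma> \<Longrightarrow> f \<in> ops \<Sigma> \<Longrightarrow> vs \<in> tuples M (arity \<Sigma> f) \<Longrightarrow> opn M f vs \<in> car M (res \<Sigma> f)"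
  by (auto simp: structures_def)

lemma structures_sort: "M \<in> structures \<W> \<Sigma> \<Longrightarrow> x \<in> car M s \<Longrightarrow> s \<in> sorts \<Sigma>"
  by (auto simp: structures_def)

lemma structures_car: "M \<in> structures \<W> \<Sigma> \<Longrightarrow> s \<in> sorts \<Sigma> \<Longrightarrow> car M s \<in> \<W>"
  by (auto simp: structures_def)

lemma homs_car: "h \<in> homs \<Sigma> M N \<Longrightarrow> x \<in> car M s \<Longrightarrow> h s x \<in> car N s"
  by (auto simp: homs_def)

lemma homs_opn:
  "h \<in> homs \<Sigma> M N \<Longrightarrow> f \<in> ops \<Sigma> \<Longrightarrow> vs \<in> tuples M (arity \<Sigma> f) \<Longrightarrow>
    h (res \<Sigma> f) (opn M f vs) = opn N f (map2 h (arity \<Sigma> f) vs)"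
  by (simp add: homs_def)

lemma homs_ext:
  assumes "h \<in> homs \<Sigma> M N" "k \<in> homs \<Sigma> M N'" "\<And>s x. x \<in> car M s \<Longrightarrow> h s x = k s x"
  shows "h = k"
proof
  fix s
  have "h s \<in> extensional (car M s)" "k s \<in> extensional (car M s)"
    using assms(1,2) by (auto simp: homs_def PiE_def)
  then show "h s = k s" using assms(3) by (rule extensionalityI)
qed

text \<open>Homomorphisms take the default value off the carriers, so a map given by a formula
  becomes one only after restriction.\<close>

lemma restrict_homs:
  assumes "M \<in> structures \<W> \<Sigma>" "\<And>s x. x \<in> car M s \<Longrightarrow> g s x \<in> car N s"
    and "\<And>f vs. f \<in> ops \<Sigma> \<Longrightarrow> vs \<in> tuples M (arity \<Sigma> f) \<Longrightarrow>
      g (res \<Sigma> f) (opn M f vs) = opn N f (map2 g (arity \<Sigma> f) vs)"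
  shows "(\<lambda>s. restrict (g s) (car M s)) \<in> homs \<Sigma> M N"
  unfolding homs_def
proof (intro CollectI conjI allI ballI)
  fix f vs assume f: "f \<in> ops \<Sigma>" and vs: "vs \<in> tuples M (arity \<Sigma> f)"
  have eq: "map2 (\<lambda>s. restrict (g s) (car M s)) (arity \<Sigma> f) vs = map2 g (arity \<Sigma> f) vs"
    using vs by (rule map2_tuples_cong) simp
  show "restrict (g (res \<Sigma> f)) (car M (res \<Sigma> f)) (opn M f vs) =
      opn N f (map2 (\<lambda>s. restrict (g s) (car M s)) (arity \<Sigma> f) vs)"
    unfolding eq
    using assms(3)[OF f vs] structures_opn[OF assms(1) f vs] by simp
qed (use assms(2) in auto)

lemma homs_id: "M \<in> structures \<W> \<Sigma> \<Longrightarrow> (\<lambda>s. restrict id (car M s)) \<in> homs \<Sigma> M M"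
  by (rule restrict_homs) (auto simp: map2_tuples_id)

lemma homs_comp:
  assumes "M \<in> structures \<W> \<Sigma>" "h \<in> homs \<Sigma> M N" "k \<in> homs \<Sigma> N P"
  shows "(\<lambda>s. compose (car M s) (k s) (h s)) \<in> homs \<Sigma> M P"
  unfolding compose_def
proof (rule restrict_homs[OF assms(1)])
  show "k s (h s x) \<in> car P s" if "x \<in> car M s" for s x
    using that assms(2,3) by (blast intro: homs_car)
  fix f vs assume f: "f \<in> ops \<Sigma>" and vs: "vs \<in> tuples M (arity \<Sigma> f)"
  have "map2 h (arity \<Sigma> f) vs \<in> tuples N (arity \<Sigma> f)"
    using vs homs_car[OF assms(2)] by (rule map2_tuples)
  then show "k (res \<Sigma> f) (h (res \<Sigma> f) (opn M f vs)) = opn P f (map2 (\<lambda>s x. k s (h s x)) (arity \<Sigma> f) vs)"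
    using f vs by (simp add: homs_opn[OF assms(2)] homs_opn[OF assms(3)] map2_map2 tuples_length)
qed

text \<open>Sending \<open>y\<close> to the value of \<open>g\<close> at a chosen preimage does not
  depend on the choice, by \<open>ker\<close>; compatibility with an operation is checked on a
  lifted argument tuple.\<close>

lemma homs_factor_surj:
  assumes M: "M \<in> structures \<W> \<Sigma>" and N: "N \<in> structures \<W> \<Sigma>"
    and e: "e \<in> homs \<Sigma> M N" "\<And>s. car N s \<subseteq> e s ` car M s" and g: "g \<in> homs \<Sigma> M P"
    and ker: "\<And>s x y. x \<in> car M s \<Longrightarrow> y \<in> car M s \<Longrightarrow> e s x = e s y \<Longrightarrow> g s x = g s y"
  obtains h where "h \<in> homs \<Sigma> N P" "\<And>s x. x \<in> car M s \<Longrightarrow> h s (e s x) = g s x"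
proof
  let ?h = "\<lambda>s y. g s (inv_into (car M s) (e s) y)"
  have h: "?h s (e s x) = g s x" if "x \<in> car M s" for s x
    using that by (intro ker) (auto intro: inv_into_into f_inv_into_f)
  show "(\<lambda>s. restrict (?h s) (car N s)) \<in> homs \<Sigma> N P"
  proof (rule restrict_homs[OF N])
    show "?h s y \<in> car P s" if y: "y \<in> car N s" for s y
    proof -
      obtain x where "x \<in> car M s" "y = e s x" using e(2) y by blast
      then show ?thesis using h homs_car[OF g] by simp
    qed
    fix f vs assume f: "f \<in> ops \<Sigma>" and "vs \<in> tuples N (arity \<Sigma> f)"
    then obtain ws where ws: "ws \<in> tuples M (arity \<Sigma> f)" "map2 e (arity \<Sigma> f) ws = vs"
      using tuples_lift[OF e(2)] by blast
    have "opn N f vs = e (res \<Sigma> f) (opn M f ws)"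
      using homs_opn[OF e(1) f ws(1)] ws(2) by simp
    then have "?h (res \<Sigma> f) (opn N f vs) = g (res \<Sigma> f) (opn M f ws)"
      using h structures_opn[OF M f ws(1)] by simp
    moreover have "map2 ?h (arity \<Sigma> f) vs = map2 g (arity \<Sigma> f) ws"
      using h map2_tuples_cong[OF ws(1), of "\<lambda>s x. ?h s (e s x)" g]
      by (simp add: ws(2)[symmetric] map2_map2 tuples_length[OF ws(1)])
    ultimately show "?h (res \<Sigma> f) (opn N f vs) = opn P f (map2 ?h (arity \<Sigma> f) vs)"
      using homs_opn[OF g f ws(1)] by simp
  qed
  show "restrict (?h s) (car N s) (e s x) = g s x" if "x \<in> car M s" for s x
    using that h homs_car[OF e(1)] by simp
qed

text \<open>The factor is \<open>g\<close> followed by the inverse of \<open>m\<close>. It commutes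
  with operations because both sides lie in \<open>car N\<close> and agree after applying the
  injective \<open>m\<close>.\<close>

lemma homs_factor_inj:
  assumes M: "M \<in> structures \<W> \<Sigma>" and N: "N \<in> structures \<W> \<Sigma>"
    and m: "m \<in> homs \<Sigma> N P" "\<And>s. inj_on (m s) (car N s)" and g: "g \<in> homs \<Sigma> M P"
    and im: "\<And>s. g s ` car M s \<subseteq> m s ` car N s"
  obtains h where "h \<in> homs \<Sigma> M N" "\<And>s x. x \<in> car M s \<Longrightarrow> m s (h s x) = g s x"
proof
  let ?h = "\<lambda>s x. inv_into (car N s) (m s) (g s x)"
  have h: "?h s x \<in> car N s" "m s (?h s x) = g s x" if "x \<in> car M s" for s x
  proof -
    have "g s x \<in> m s ` car N s" using that im by blast
    then show "?h s x \<in> car N s" "m s (?h s x) = g s x"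
      by (rule inv_into_into, rule f_inv_into_f)
  qed
  show "(\<lambda>s. restrict (?h s) (car M s)) \<in> homs \<Sigma> M N"
  proof (rule restrict_homs[OF M])
    show "?h s x \<in> car N s" if "x \<in> car M s" for s x using that by (rule h)
    fix f vs assume f: "f \<in> ops \<Sigma>" and vs: "vs \<in> tuples M (arity \<Sigma> f)"
    have hvs: "map2 ?h (arity \<Sigma> f) vs \<in> tuples N (arity \<Sigma> f)"
      using vs h(1) by (rule map2_tuples)
    have "map2 m (arity \<Sigma> f) (map2 ?h (arity \<Sigma> f) vs) = map2 g (arity \<Sigma> f) vs"
      using h(2) map2_tuples_cong[OF vs, of "\<lambda>s x. m s (?h s x)" g]
      by (simp add: map2_map2 tuples_length[OF vs])
    then have "m (res \<Sigma> f) (opn N f (map2 ?h (arity \<Sigma> f) vs)) = g (res \<Sigma> f) (opn M f vs)"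
      using homs_opn[OF m(1) f hvs] homs_opn[OF g f vs] by simp
    moreover have "opn N f (map2 ?h (arity \<Sigma> f) vs) \<in> car N (res \<Sigma> f)"
      using N f hvs by (rule structures_opn)
    ultimately show "?h (res \<Sigma> f) (opn M f vs) = opn N f (map2 ?h (arity \<Sigma> f) vs)"
      using inv_into_f_f[OF m(2), of "opn N f (map2 ?h (arity \<Sigma> f) vs)" "res \<Sigma> f"] by simp
  qed
  show "m s (restrict (?h s) (car M s) x) = g s x" if "x \<in> car M s" for s x
    using that h by simp
qed

section \<open>Substructures, images and quotients\<close>

lemma substructure_exists:
  fixes M :: "('s, 'f, 'u) struct"
  assumes W: "universe \<W>" and M: "M \<in> structures \<W> \<Sigma>" and B: "\<And>s. B s \<subseteq> car M s"
    and closed: "\<And>f vs. f \<in> ops \<Sigma> \<Longrightarrow> vs \<in> tuples M (arity \<Sigma> f) \<Longrightarrow>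
      set (zip (arity \<Sigma> f) vs) \<subseteq> Sigma UNIV B \<Longrightarrow> opn M f vs \<in> B (res \<Sigma> f)"
  obtains N i where "N \<in> structures \<W> \<Sigma>" "i \<in> homs \<Sigma> N M" "car N = B"
    "\<And>s x. x \<in> B s \<Longrightarrow> i s x = x"
proof
  \<comment> \<open>\<open>tuples\<close> looks only at carriers. The auxiliary record with carrier
    \<open>B\<close> names the domains of the restricted operations before \<open>N\<close> itself
    is available.\<close>
  define N :: "('s, 'f, 'u) struct" where
    "N = \<lparr>car = B, opn = \<lambda>f. if f \<in> ops \<Sigma> then
       restrict (opn M f) (tuples \<lparr>car = B, opn = opn M\<rparr> (arity \<Sigma> f)) else (\<lambda>_. undefined)\<rparr>"
  show carN: "car N = B" by (simp add: N_def)
  have tup: "tuples \<lparr>car = B, opn = opn M\<rparr> \<Gamma> = tuples N \<Gamma>" for \<Gamma>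
    by (simp add: tuples_def N_def)
  have opnN: "opn N f = restrict (opn M f) (tuples N (arity \<Sigma> f))" if "f \<in> ops \<Sigma>" for f
    using that unfolding tup[symmetric] by (simp add: N_def)
  have tM: "vs \<in> tuples M \<Gamma>" if "vs \<in> tuples N \<Gamma>" for vs \<Gamma>
    using that by (rule tuples_mono) (simp add: B carN)
  have cl: "opn M f vs \<in> B (res \<Sigma> f)" if "f \<in> ops \<Sigma>" "vs \<in> tuples N (arity \<Sigma> f)" for f vs
    using closed[OF that(1) tM[OF that(2)]] that(2) by (simp add: tuples_iff_zip pts_def carN)
  show N: "N \<in> structures \<W> \<Sigma>"
    unfolding structures_def
  proof (intro CollectI conjI ballI allI impI)
    show "car N s \<in> \<W>" if "s \<in> sorts \<Sigma>" for s
      using universe_subset[OF W structures_car[OF M that]] B carN by simp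
    show "car N s = {}" if "s \<notin> sorts \<Sigma>" for s
      using structures_sort[OF M] B[of s] that carN by auto
    show "opn N f \<in> tuples N (arity \<Sigma> f) \<rightarrow>\<^sub>E car N (res \<Sigma> f)" if "f \<in> ops \<Sigma>" for f
      using cl[OF that] by (simp add: opnN[OF that] carN)
    show "opn N f = (\<lambda>_. undefined)" if "f \<notin> ops \<Sigma>" for f
      using that by (simp add: N_def)
  qed
  show "(\<lambda>s. restrict (\<lambda>x. x) (car N s)) \<in> homs \<Sigma> N M"
    by (rule restrict_homs[OF N]) (use B in \<open>auto simp: carN opnN map2_tuples_id\<close>)
  show "restrict (\<lambda>x. x) (car N s) x = x" if "x \<in> B s" for s x
    using that by (simp add: carN)
qed

lemma homs_image_closed:
  assumes h: "h \<in> homs \<Sigma> M N" and M: "M \<in> structures \<W> \<Sigma>" and f: "f \<in> ops \<Sigma>"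
    and vs: "vs \<in> tuples N (arity \<Sigma> f)" "set (zip (arity \<Sigma> f) vs) \<subseteq> (SIGMA s:UNIV. h s ` car M s)"
  shows "opn N f vs \<in> h (res \<Sigma> f) ` car M (res \<Sigma> f)"
proof -
  \<comment> \<open>\<open>?I\<close> is not claimed to be a structure: it serves only to name the
    tuples with entries in the image.\<close>
  let ?I = "\<lparr>car = \<lambda>s. h s ` car M s, opn = opn N\<rparr>"
  have "vs \<in> tuples ?I (arity \<Sigma> f)"
    using vs by (simp add: tuples_iff_zip pts_def)
  then obtain ws where ws: "ws \<in> tuples M (arity \<Sigma> f)" "map2 h (arity \<Sigma> f) ws = vs"
    using tuples_lift[of ?I h M] by auto
  then show ?thesis using homs_opn[OF h f ws(1)] structures_opn[OF M f ws(1)] by (metis imageI)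
qed

text \<open>The image is realised on a subset of \<open>N\<close>, so \<open>m\<close> is an
  inclusion, \<open>e\<close> is \<open>h\<close> with smaller codomain, and the carriers remain in
  the universe.\<close>

lemma homs_image_factorization:
  assumes W: "universe \<W>" and M: "M \<in> structures \<W> \<Sigma>" and N: "N \<in> structures \<W> \<Sigma>"
    and h: "h \<in> homs \<Sigma> M N"
  obtains I e m where "I \<in> structures \<W> \<Sigma>" "e \<in> homs \<Sigma> M I" "m \<in> homs \<Sigma> I N"
    "\<And>s. e s ` car M s = car I s" "\<And>s. inj_on (m s) (car I s)"
    "\<And>s x. x \<in> car M s \<Longrightarrow> m s (e s x) = h s x"
proof -
  obtain I m where I: "I \<in> structures \<W> \<Sigma>" and m: "m \<in> homs \<Sigma> I N" and car: "car I = (\<lambda>s. h s ` car M s)"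
    and m_id: "\<And>s x. x \<in> h s ` car M s \<Longrightarrow> m s x = x"
    using substructure_exists[OF W N, of "\<lambda>s. h s ` car M s"]
      homs_image_closed[OF h M] homs_car[OF h] by blast
  have inj: "inj_on (m s) (car I s)" for s
    using m_id by (auto simp: car inj_on_def)
  obtain e where e: "e \<in> homs \<Sigma> M I" "\<And>s x. x \<in> car M s \<Longrightarrow> m s (e s x) = h s x"
    using homs_factor_inj[OF M I m inj h] m_id by (auto simp: car)
  have "e s x = h s x" if "x \<in> car M s" for s x
    using e(2)[OF that] m_id[of "e s x" s] homs_car[OF e(1) that] by (simp add: car)
  then have "e s ` car M s = car I s" for s by (auto simp: car)
  then show thesis using that I e m inj by blast
qed

lemma homs_intersection:
  assumes W: "universe \<W>" and M: "M \<in> structures \<W> \<Sigma>" and N: "N \<in> structures \<W> \<Sigma>"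
    and P: "P \<in> structures \<W> \<Sigma>" and f: "f \<in> homs \<Sigma> M P" and g: "g \<in> homs \<Sigma> N P"
  obtains Q i where "Q \<in> structures \<W> \<Sigma>" "i \<in> homs \<Sigma> Q P" "\<And>s. inj_on (i s) (car Q s)"
    "\<And>s. i s ` car Q s = f s ` car M s \<inter> g s ` car N s"
proof -
  obtain Q i where *: "Q \<in> structures \<W> \<Sigma>" "i \<in> homs \<Sigma> Q P" and car: "car Q = (\<lambda>s. f s ` car M s \<inter> g s ` car N s)"
    and i: "\<And>s x. x \<in> f s ` car M s \<inter> g s ` car N s \<Longrightarrow> i s x = x"
  proof (rule substructure_exists[OF W P, of "\<lambda>s. f s ` car M s \<inter> g s ` car N s"])
    show "f s ` car M s \<inter> g s ` car N s \<subseteq> car P s" for s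
      using homs_car[OF f] by blast
    show "opn P F vs \<in> f (res \<Sigma> F) ` car M (res \<Sigma> F) \<inter> g (res \<Sigma> F) ` car N (res \<Sigma> F)"
      if "F \<in> ops \<Sigma>" "vs \<in> tuples P (arity \<Sigma> F)"
        "set (zip (arity \<Sigma> F) vs) \<subseteq> (SIGMA s:UNIV. f s ` car M s \<inter> g s ` car N s)" for F vs
      using homs_image_closed[OF f M that(1,2)] homs_image_closed[OF g N that(1,2)] that(3) by blast
  qed blast
  show thesis
  proof (rule that[OF *])
    show "inj_on (i s) (car Q s)" for s using i by (auto simp: car inj_on_def)
    show "i s ` car Q s = f s ` car M s \<inter> g s ` car N s" for s
      using i by (simp add: car)
  qed
qed

text \<open>Carriers must consist of elements of \<open>'u\<close>, so a class is represented by a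
  chosen element and not by the set of its members. The quotient then lives on subsets of the
  carriers of \<open>M\<close>, and closure of \<open>\<W>\<close> under subsets keeps it inside the
  universe.\<close>

lemma quotient_exists:
  fixes M :: "('s, 'f, 'u) struct"
  assumes W: "universe \<W>" and M: "M \<in> structures \<W> \<Sigma>" and E: "equiv (pts M) E"
    and sort: "\<And>s t x y. ((s, x), (t, y)) \<in> E \<Longrightarrow> s = t"
    and compat: "\<And>f vs ws. f \<in> ops \<Sigma> \<Longrightarrow> vs \<in> tuples M (arity \<Sigma> f) \<Longrightarrow> ws \<in> tuples M (arity \<Sigma> f) \<Longrightarrow>
      (zip (arity \<Sigma> f) vs, zip (arity \<Sigma> f) ws) \<in> listrel E \<Longrightarrow>
      ((res \<Sigma> f, opn M f vs), (res \<Sigma> f, opn M f ws)) \<in> E"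
  obtains Q q where "Q \<in> structures \<W> \<Sigma>" "q \<in> homs \<Sigma> M Q" "\<And>s. q s ` car M s = car Q s"
    "\<And>s x y. x \<in> car M s \<Longrightarrow> y \<in> car M s \<Longrightarrow> q s x = q s y \<longleftrightarrow> ((s, x), (s, y)) \<in> E"
proof
  define r where "r s x = (SOME y. ((s, x), (s, y)) \<in> E)" for s x
  have r: "((s, x), (s, r s x)) \<in> E" if "x \<in> car M s" for s x
    unfolding r_def by (rule someI[of _ x]) (use E that in \<open>auto simp: equiv_def refl_on_def\<close>)
  have r_car: "r s x \<in> car M s" if "x \<in> car M s" for s x
    using r[OF that] equiv_type[OF E] by auto
  have r_eq: "r s x = r s y \<longleftrightarrow> ((s, x), (s, y)) \<in> E" if "x \<in> car M s" "y \<in> car M s" for s x y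
  proof
    assume "r s x = r s y"
    then show "((s, x), (s, y)) \<in> E"
      using r[OF that(1)] r[OF that(2)] E by (metis equiv_def symD transD)
  next
    assume "((s, x), (s, y)) \<in> E"
    \<comment> \<open>Equivalent elements give \<open>SOME\<close> the same predicate, so they
      receive the same representative.\<close>
    then have "((s, x), (s, z)) \<in> E \<longleftrightarrow> ((s, y), (s, z)) \<in> E" for z
      using E by (metis equiv_def symD transD)
    then show "r s x = r s y" unfolding r_def by simp
  qed
  define Q :: "('s, 'f, 'u) struct" where
    "Q = \<lparr>car = \<lambda>s. r s ` car M s, opn = \<lambda>f. if f \<in> ops \<Sigma> then
       restrict (\<lambda>vs. r (res \<Sigma> f) (opn M f vs))
         (tuples \<lparr>car = \<lambda>s. r s ` car M s, opn = opn M\<rparr> (arity \<Sigma> f)) else (\<lambda>_. undefined)\<rparr>"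
  have carQ: "car Q s = r s ` car M s" for s by (simp add: Q_def)
  have tup: "tuples \<lparr>car = \<lambda>s. r s ` car M s, opn = opn M\<rparr> \<Gamma> = tuples Q \<Gamma>" for \<Gamma>
    by (simp add: tuples_def Q_def)
  have opnQ: "opn Q f = restrict (\<lambda>vs. r (res \<Sigma> f) (opn M f vs)) (tuples Q (arity \<Sigma> f))"
    if "f \<in> ops \<Sigma>" for f
    using that unfolding tup[symmetric] by (simp add: Q_def)
  have tM: "vs \<in> tuples M \<Gamma>" if "vs \<in> tuples Q \<Gamma>" for vs \<Gamma>
    using that by (rule tuples_mono) (use r_car carQ in auto)
  show "Q \<in> structures \<W> \<Sigma>"
    unfolding structures_def
  proof (intro CollectI conjI ballI allI impI)
    show "car Q s \<in> \<W>" if "s \<in> sorts \<Sigma>" for s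
    proof -
      have "r s ` car M s \<subseteq> car M s" using r_car by blast
      then show ?thesis using universe_subset[OF W structures_car[OF M that]] by (simp add: carQ)
    qed
    show "car Q s = {}" if "s \<notin> sorts \<Sigma>" for s
      using structures_sort[OF M] that by (auto simp: carQ)
    show "opn Q f \<in> tuples Q (arity \<Sigma> f) \<rightarrow>\<^sub>E car Q (res \<Sigma> f)" if "f \<in> ops \<Sigma>" for f
      using structures_opn[OF M that tM] by (auto simp: opnQ[OF that] carQ)
    show "opn Q f = (\<lambda>_. undefined)" if "f \<notin> ops \<Sigma>" for f
      using that by (simp add: Q_def)
  qed
  show "(\<lambda>s. restrict (r s) (car M s)) \<in> homs \<Sigma> M Q"
  proof (rule restrict_homs[OF M])
    fix f vs assume f: "f \<in> ops \<Sigma>" and vs: "vs \<in> tuples M (arity \<Sigma> f)"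
    have rQ: "map2 r (arity \<Sigma> f) vs \<in> tuples Q (arity \<Sigma> f)"
      using vs by (rule map2_tuples) (simp add: carQ)
    have "(zip (arity \<Sigma> f) vs, zip (arity \<Sigma> f) (map2 r (arity \<Sigma> f) vs)) \<in> listrel E"
      using vs r by (auto simp: listrel_iff_nth tuples_iff)
    then have "((res \<Sigma> f, opn M f vs), (res \<Sigma> f, opn M f (map2 r (arity \<Sigma> f) vs))) \<in> E"
      by (rule compat[OF f vs tM[OF rQ]])
    then show "r (res \<Sigma> f) (opn M f vs) = opn Q f (map2 r (arity \<Sigma> f) vs)"
      using rQ r_eq structures_opn[OF M f vs] structures_opn[OF M f tM[OF rQ]] by (simp add: opnQ[OF f])
  qed (simp add: carQ)
  show "restrict (r s) (car M s) ` car M s = car Q s" for s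
    by (simp add: carQ)
  show "restrict (r s) (car M s) x = restrict (r s) (car M s) y \<longleftrightarrow> ((s, x), (s, y)) \<in> E"
    if "x \<in> car M s" "y \<in> car M s" for s x y
    using that r_eq by simp
qed

text \<open>As a relation on the disjoint union, the kernels in all sorts are one relation, and a
  single transitive closure forms the join of two of them.\<close>

definition kernel_pairs ::
  "('s, 'f, 'u) struct \<Rightarrow> ('s \<Rightarrow> 'u \<Rightarrow> 'u) \<Rightarrow> (('s \<times> 'u) \<times> 's \<times> 'u) set" where
  "kernel_pairs M h = {((s, x), (t, y)). s = t \<and> x \<in> car M s \<and> y \<in> car M s \<and> h s x = h s y}"

text \<open>
  As the operations are finitary, the equivalence generated by two congruences is a congruence:
  the arguments of an operation can be changed one at a time.
\<close>

lemma kernel_join_exists: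
  assumes W: "universe \<W>" and M: "M \<in> structures \<W> \<Sigma>"
    and f: "f \<in> homs \<Sigma> M N" and g: "g \<in> homs \<Sigma> M P"
  obtains Q q where "Q \<in> structures \<W> \<Sigma>" "q \<in> homs \<Sigma> M Q" "\<And>s. q s ` car M s = car Q s"
    "\<And>s x y. x \<in> car M s \<Longrightarrow> y \<in> car M s \<Longrightarrow>
      q s x = q s y \<longleftrightarrow> ((s, x), (s, y)) \<in> (kernel_pairs M f \<union> kernel_pairs M g)\<^sup>+"
proof -
  define R where "R = kernel_pairs M f \<union> kernel_pairs M g"
  have R: "R \<subseteq> pts M \<times> pts M" and symR: "sym R" and reflR: "Id_on (pts M) \<subseteq> R"
    by (auto simp: R_def kernel_pairs_def sym_def)
  \<comment> \<open>\<open>R\<close> contains the diagonal of \<open>pts M\<close>, so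
    \<open>R\<^sup>+\<close> is reflexive exactly there; \<open>R\<^sup>*\<close> would also relate
    pairs outside \<open>pts M\<close> to themselves.\<close>
  have "equiv (pts M) (R\<^sup>+)"
  proof (rule equivI)
    show "R\<^sup>+ \<subseteq> pts M \<times> pts M" using R by (rule trancl_subset_Sigma)
    show "refl_on (pts M) (R\<^sup>+)" using reflR by (auto simp: refl_on_def)
    show "sym (R\<^sup>+)" using symR by (rule sym_trancl)
  qed simp
  moreover have "fst p = fst p'" if "(p, p') \<in> R\<^sup>+" for p p'
    using that by (induction rule: trancl_induct) (auto simp: R_def kernel_pairs_def)
  then have "s = t" if "((s, x), (t, y)) \<in> R\<^sup>+" for s t x y
    using that by fastforce
  moreover have "((res \<Sigma> F, opn M F vs), (res \<Sigma> F, opn M F ws)) \<in> R\<^sup>+"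
    if F: "F \<in> ops \<Sigma>" and vs: "vs \<in> tuples M (arity \<Sigma> F)" and ws: "ws \<in> tuples M (arity \<Sigma> F)"
      and rel: "(zip (arity \<Sigma> F) vs, zip (arity \<Sigma> F) ws) \<in> listrel (R\<^sup>+)" for F vs ws
  proof -
    have "listrel (R\<^sup>+) \<subseteq> listrel (R\<^sup>*)"
      by (rule listrel_mono) (auto intro: trancl_into_rtrancl)
    then have "(zip (arity \<Sigma> F) vs, zip (arity \<Sigma> F) ws) \<in> (listrel1 R)\<^sup>*"
      using rel unfolding listrel_rtrancl_eq_rtrancl_listrel1[symmetric] by blast
    then have "map fst (zip (arity \<Sigma> F) ws) = arity \<Sigma> F \<and>
      map snd (zip (arity \<Sigma> F) ws) \<in> tuples M (arity \<Sigma> F) \<and>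
      ((res \<Sigma> F, opn M F vs), (res \<Sigma> F, opn M F (map snd (zip (arity \<Sigma> F) ws)))) \<in> R\<^sup>+"
    proof (induction rule: rtrancl_induct)
      case base
      have "(res \<Sigma> F, opn M F vs) \<in> pts M" using structures_opn[OF M F vs] by simp
      then have "((res \<Sigma> F, opn M F vs), (res \<Sigma> F, opn M F vs)) \<in> R" using reflR by blast
      then show ?case using vs by (auto simp: tuples_length)
    next
      case (step ps ps')
      obtain us p p' us' where ps: "ps = us @ p # us'" "ps' = us @ p' # us'" "(p, p') \<in> R"
        using step(2) by (rule listrel1E)
      then have fst: "map fst ps' = arity \<Sigma> F"
        using step(3) by (auto simp: R_def kernel_pairs_def)
      have zip: "zip (arity \<Sigma> F) (map snd ps) = ps" "zip (arity \<Sigma> F) (map snd ps') = ps'"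
        using step(3) fst by (metis zip_map_fst_snd)+
      have tup: "map snd ps' \<in> tuples M (arity \<Sigma> F)"
        using step(3) ps R unfolding tuples_iff_zip zip
        by (auto simp: fst[symmetric] simp del: mem_pts)
      \<comment> \<open>A single change belongs to the kernel of \<open>f\<close> or of
        \<open>g\<close>, and that homomorphism cannot distinguish the two argument lists, so it
        identifies the two results.\<close>
      have "((res \<Sigma> F, opn M F (map snd ps)), (res \<Sigma> F, opn M F (map snd ps'))) \<in> kernel_pairs M k"
        if k: "k \<in> homs \<Sigma> M K" and p: "(p, p') \<in> kernel_pairs M k" for k K
      proof -
        have "map2 k (arity \<Sigma> F) (map snd ps) = map2 k (arity \<Sigma> F) (map snd ps')"
          unfolding zip using p by (auto simp: ps kernel_pairs_def)
        then have "k (res \<Sigma> F) (opn M F (map snd ps)) = k (res \<Sigma> F) (opn M F (map snd ps'))"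
          using homs_opn[OF k F] step(3) tup by simp
        then show ?thesis
          using structures_opn[OF M F] step(3) tup by (simp add: kernel_pairs_def)
      qed
      then have "((res \<Sigma> F, opn M F (map snd ps)), (res \<Sigma> F, opn M F (map snd ps'))) \<in> R"
        using ps(3) f g unfolding R_def by blast
      then show ?case using step(3) fst tup by (auto intro: trancl_into_trancl)
    qed
    then show ?thesis using ws by (simp add: tuples_length)
  qed
  ultimately show thesis
    using that by (rule quotient_exists[OF W M]) (auto simp: R_def)
qed

section \<open>Preservation and reflection of axioms\<close>

lemma interp_hom:
  assumes M: "M \<in> structures \<W> \<Sigma>" and h: "h \<in> homs \<Sigma> M N" and vs: "vs \<in> tuples M \<Gamma>"
    and t: "has_sort \<Sigma> \<Gamma> t \<sigma>"
  shows "interp M vs t \<in> car M \<sigma> \<and> interp N (map2 h \<Gamma> vs) t = h \<sigma> (interp M vs t)"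
  using t
proof (induction rule: has_sort.induct)
  case (1 i)
  then show ?case using vs by (simp add: tuples_iff)
next
  case (2 f ts)
  let ?us = "map (interp M vs) ts"
  have us: "?us \<in> tuples M (arity \<Sigma> f)"
    using 2 by (simp add: tuples_iff)
  have "map (interp N (map2 h \<Gamma> vs)) ts = map2 h (arity \<Sigma> f) ?us"
    using 2 by (auto intro!: nth_equalityI)
  then show ?case
    using homs_opn[OF h 2(1) us] structures_opn[OF M 2(1) us] by simp
qed

text \<open>Homomorphisms commute with the evaluation of terms. For reflection, both sides of the
  equation have the same sort, so injectivity on a single carrier applies to their values.\<close>

lemma holds_hom:
  assumes "M \<in> structures \<W> \<Sigma>" "h \<in> homs \<Sigma> M N" "vs \<in> tuples M \<Gamma>" "wf_equation \<Sigma> \<Gamma> e"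
  shows "holds M vs e \<Longrightarrow> holds N (map2 h \<Gamma> vs) e"
    and "(\<And>s. inj_on (h s) (car M s)) \<Longrightarrow> holds N (map2 h \<Gamma> vs) e \<Longrightarrow> holds M vs e"
proof -
  obtain t u \<sigma> where e: "e = (t, u)" "has_sort \<Sigma> \<Gamma> t \<sigma>" "has_sort \<Sigma> \<Gamma> u \<sigma>"
    using assms(4) by (auto simp: wf_equation_def)
  note i = interp_hom[OF assms(1-3) e(2)] interp_hom[OF assms(1-3) e(3)]
  show "holds M vs e \<Longrightarrow> holds N (map2 h \<Gamma> vs) e"
    using i by (simp add: holds_def e(1))
  show "(\<And>s. inj_on (h s) (car M s)) \<Longrightarrow> holds N (map2 h \<Gamma> vs) e \<Longrightarrow> holds M vs e"
    using i by (auto simp: holds_def e(1) dest: inj_onD)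
qed

lemma sat_equational_sub:
  assumes "M \<in> structures \<W> \<Sigma>" "h \<in> homs \<Sigma> M N" "\<And>s. inj_on (h s) (car M s)"
    and "wf_equation \<Sigma> (ectx a) (eqn a)" "sat_equational N a"
  shows "sat_equational M a"
  unfolding sat_equational_def
proof
  fix vs assume vs: "vs \<in> tuples M (ectx a)"
  then have "map2 h (ectx a) vs \<in> tuples N (ectx a)"
    using homs_car[OF assms(2)] by (rule map2_tuples)
  then show "holds M vs (eqn a)"
    using holds_hom(2)[OF assms(1,2) vs assms(4,3)] assms(5) by (simp add: sat_equational_def)
qed

lemma sat_equational_quotient:
  assumes "M \<in> structures \<W> \<Sigma>" "h \<in> homs \<Sigma> M N" "\<And>s. car N s \<subseteq> h s ` car M s"
    and "wf_equation \<Sigma> (ectx a) (eqn a)" "sat_equational M a"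
  shows "sat_equational N a"
  unfolding sat_equational_def
proof
  fix vs assume "vs \<in> tuples N (ectx a)"
  then obtain ws where ws: "ws \<in> tuples M (ectx a)" "map2 h (ectx a) ws = vs"
    using tuples_lift[OF assms(3)] by blast
  then show "holds N vs (eqn a)"
    using holds_hom(1)[OF assms(1,2) ws(1) assms(4)] assms(5) by (simp add: sat_equational_def)
qed

text \<open>A disjunct that holds at the image tuple in \<open>N\<close> is reflected equation by
  equation. The axioms assert no existence of elements, so nothing has to be found inside
  \<open>M\<close>.\<close>

lemma sat_disjunctive_sub:
  assumes "M \<in> structures \<W> \<Sigma>" "h \<in> homs \<Sigma> M N" "\<And>s. inj_on (h s) (car M s)"
    and "\<And>i e. i \<in> index a \<Longrightarrow> e \<in> set (disjunct a i) \<Longrightarrow> wf_equation \<Sigma> (dctx a) e" "sat_disjunctive N a"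
  shows "sat_disjunctive M a"
  unfolding sat_disjunctive_def
proof
  fix vs assume vs: "vs \<in> tuples M (dctx a)"
  then have "map2 h (dctx a) vs \<in> tuples N (dctx a)"
    using homs_car[OF assms(2)] by (rule map2_tuples)
  then obtain i where "i \<in> index a" "\<forall>e\<in>set (disjunct a i). holds N (map2 h (dctx a) vs) e"
    using assms(5) unfolding sat_disjunctive_def by blast
  then show "\<exists>i\<in>index a. \<forall>e\<in>set (disjunct a i). holds M vs e"
    using holds_hom(2)[OF assms(1,2) vs assms(4,3)] by blast
qed

text \<open>The disjunct is chosen at one lift of the tuple and its equations are pushed forward.
  Another lift might select another disjunct, but one is enough.\<close>

lemma sat_disjunctive_quotient:
  assumes "M \<in> structures \<W> \<Sigma>" "h \<in> homs \<Sigma> M N" "\<And>s. car N s \<subseteq> h s ` car M s"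
    and "\<And>i e. i \<in> index a \<Longrightarrow> e \<in> set (disjunct a i) \<Longrightarrow> wf_equation \<Sigma> (dctx a) e" "sat_disjunctive M a"
  shows "sat_disjunctive N a"
  unfolding sat_disjunctive_def
proof
  fix vs assume "vs \<in> tuples N (dctx a)"
  then obtain ws where ws: "ws \<in> tuples M (dctx a)" "map2 h (dctx a) ws = vs"
    using tuples_lift[OF assms(3)] by blast
  then obtain i where "i \<in> index a" "\<forall>e\<in>set (disjunct a i). holds M ws e"
    using assms(5) unfolding sat_disjunctive_def by blast
  then show "\<exists>i\<in>index a. \<forall>e\<in>set (disjunct a i). holds N vs e"
    using holds_hom(1)[OF assms(1,2) ws(1) assms(4)] ws(2) by blast
qed

section \<open>Categories of models\<close>

lemma set_sized_lepoll: "set_sized \<W> B \<Longrightarrow> A \<lesssim> B \<Longrightarrow> set_sized \<W> A"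
  unfolding set_sized_def using lepoll_trans by blast

lemma set_sized_subset: "set_sized \<W> B \<Longrightarrow> A \<subseteq> B \<Longrightarrow> set_sized \<W> A"
  by (blast intro: set_sized_lepoll subset_imp_lepoll)

lemma set_sized_image: "set_sized \<W> A \<Longrightarrow> set_sized \<W> (f ` A)"
  by (blast intro: set_sized_lepoll image_lepoll)

lemma lepoll_Pow: "A \<lesssim> B \<Longrightarrow> Pow A \<lesssim> Pow B"
  unfolding lepoll_def by (blast intro: inj_on_image_Pow image_Pow_mono)

lemma set_sized_Pow:
  assumes "universe \<W>" "set_sized \<W> A"
  shows "set_sized \<W> (Pow A)"
proof (cases "\<W> = UNIV")
  case False
  then obtain B B' where "B \<in> \<W>" "A \<lesssim> B" "B' \<in> \<W>" "Pow B \<lesssim> B'"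
    using assms unfolding universe_def grothendieck_universe_def set_sized_def by metis
  then show ?thesis
    unfolding set_sized_def using lepoll_Pow lepoll_trans by blast
qed (simp add: set_sized_def)

lemma grothendieck_universe_UN:
  "grothendieck_universe \<W> \<Longrightarrow> A \<in> \<W> \<Longrightarrow> (\<And>a. a \<in> A \<Longrightarrow> X a \<in> \<W>) \<Longrightarrow> (\<Union>a\<in>A. X a) \<in> \<W>"
  by (simp add: grothendieck_universe_def)

text \<open>A universe is closed under unions indexed by its members, so a binary union needs a
  member with two elements. Taking power sets twice supplies it: \<open>C\<close> is nonempty
  because \<open>Pow A\<close> is, and \<open>j\<close> sends \<open>{}\<close> and
  \<open>{c}\<close> to distinct elements of \<open>D\<close>.\<close>

lemma universe_Un:
  assumes "universe \<W>" "A \<in> \<W>" "B \<in> \<W>"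
  shows "A \<union> B \<in> \<W>"
proof (cases "\<W> = UNIV")
  case False
  then have W: "grothendieck_universe \<W>" using assms(1) by (simp add: universe_def)
  then obtain C D where "C \<in> \<W>" "Pow A \<lesssim> C" and D: "D \<in> \<W>" "Pow C \<lesssim> D"
    using assms(2) unfolding grothendieck_universe_def by metis
  then obtain c where c: "c \<in> C" by (auto simp: lepoll_def)
  obtain j where j: "inj_on j (Pow C)" "j ` Pow C \<subseteq> D" using D(2) by (auto simp: lepoll_def)
  have ne: "j {} \<noteq> j {c}" using inj_onD[OF j(1), of "{}" "{c}"] c by auto
  have "j {} \<in> D" "j {c} \<in> D" using j(2) c by auto
  then have "A \<union> B = (\<Union>d\<in>D. if d = j {} then A else B)"
    using ne by (auto split: if_splits)
  also have "\<dots> \<in> \<W>"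
    using assms(2,3) by (intro grothendieck_universe_UN W D(1)) simp
  finally show ?thesis .
qed simp

lemma kuratowski_pair_inject: "{{a}, {a, b}} = {{c}, {c, d}} \<Longrightarrow> a = c \<and> b = d"
  unfolding doubleton_eq_iff by auto

text \<open>Products are not among the closure properties of a universe. Kuratowski pairs embed
  \<open>A' \<times> B'\<close> into an iterated power set of a union, which is covered by
  them.\<close>

lemma set_sized_Times:
  assumes W: "universe \<W>" and A: "set_sized \<W> A" and B: "set_sized \<W> B"
  shows "set_sized \<W> (A \<times> B)"
proof (cases "\<W> = UNIV")
  case False
  then obtain A' B' where *: "A' \<in> \<W>" "A \<lesssim> A'" "B' \<in> \<W>" "B \<lesssim> B'"
    using A B unfolding set_sized_def by blast
  have "inj_on (\<lambda>(a, b). {{a}, {a, b}}) (A' \<times> B')"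
    by (intro inj_onI) (clarify, drule kuratowski_pair_inject, simp)
  moreover have "(\<lambda>(a, b). {{a}, {a, b}}) ` (A' \<times> B') \<subseteq> Pow (Pow (A' \<union> B'))"
    by auto
  ultimately have "A' \<times> B' \<lesssim> Pow (Pow (A' \<union> B'))"
    unfolding lepoll_def by blast
  moreover have "set_sized \<W> (Pow (Pow (A' \<union> B')))"
    using universe_Un[OF W *(1,3)] by (intro set_sized_Pow W) (auto simp: set_sized_def)
  ultimately have "set_sized \<W> (A' \<times> B')" by (rule set_sized_lepoll[rotated])
  then show ?thesis
    by (rule set_sized_lepoll) (rule times_lepoll_mono[OF *(2,4)])
qed (simp add: set_sized_def)

text \<open>The index set need not belong to \<open>\<W>\<close>; it only injects into a member
  \<open>B\<close>. The family is reindexed along \<open>B\<close>, with the empty set off the image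
  of \<open>I\<close>, before the union is formed.\<close>

lemma set_sized_Sigma:
  assumes W: "universe \<W>" and I: "set_sized \<W> I" and X: "\<And>i. i \<in> I \<Longrightarrow> X i \<in> \<W>"
  shows "set_sized \<W> (Sigma I X)"
proof (cases "\<W> = UNIV")
  case False
  then have G: "grothendieck_universe \<W>" using W by (simp add: universe_def)
  obtain B j where B: "B \<in> \<W>" and j: "inj_on j I" "j ` I \<subseteq> B"
    using I False unfolding set_sized_def lepoll_def by blast
  have "{} \<in> \<W>" using universe_subset[OF W B] by simp
  then have "(\<Union>b\<in>B. if b \<in> j ` I then X (inv_into I j b) else {}) \<in> \<W>"
    using X inv_into_into[of _ j I] by (intro grothendieck_universe_UN G B) simp
  moreover have "(\<Union>i\<in>I. X i) \<subseteq> (\<Union>b\<in>B. if b \<in> j ` I then X (inv_into I j b) else {})"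
    using j by (force simp: inv_into_f_f)
  ultimately have "(\<Union>i\<in>I. X i) \<in> \<W>" by (rule universe_subset[OF W])
  then have "set_sized \<W> (\<Union>i\<in>I. X i)" by (auto simp: set_sized_def)
  then have "set_sized \<W> (I \<times> (\<Union>i\<in>I. X i))" by (rule set_sized_Times[OF W I])
  then show ?thesis by (rule set_sized_subset) auto
qed (simp add: set_sized_def)

lemma set_sized_pts:
  assumes "universe \<W>" "wf_signature \<W> \<Sigma>" "M \<in> structures \<W> \<Sigma>"
  shows "set_sized \<W> (pts M)"
proof -
  have "set_sized \<W> (Sigma (sorts \<Sigma>) (car M))"
    using assms structures_car by (intro set_sized_Sigma) (auto simp: wf_signature_def)
  then show ?thesis
    by (rule set_sized_subset) (use structures_sort[OF assms(3)] in \<open>auto simp: pts_def\<close>)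
qed

definition on_pts :: "('s \<Rightarrow> 'u \<Rightarrow> 'v) \<Rightarrow> 's \<times> 'u \<Rightarrow> 's \<times> 'v" where
  "on_pts h = (\<lambda>(s, x). (s, h s x))"

lemma on_pts_apply [simp]: "on_pts h (s, x) = (s, h s x)"
  by (simp add: on_pts_def)

lemma on_pts_image_subset: "h \<in> homs \<Sigma> M N \<Longrightarrow> on_pts h ` pts M \<subseteq> pts N"
  by (auto simp: on_pts_def pts_def intro: homs_car)

text \<open>Being extensional, a homomorphism is determined by its graph on points, which is a
  subset of \<open>pts M \<times> pts N\<close>.\<close>

lemma set_sized_homs:
  assumes "universe \<W>" "wf_signature \<W> \<Sigma>" "M \<in> structures \<W> \<Sigma>" "N \<in> structures \<W> \<Sigma>"
  shows "set_sized \<W> (homs \<Sigma> M N)"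
proof -
  let ?graph = "\<lambda>h. (\<lambda>p. (p, on_pts h p)) ` pts M"
  have "inj_on ?graph (homs \<Sigma> M N)"
  proof
    fix h k assume hk: "h \<in> homs \<Sigma> M N" "k \<in> homs \<Sigma> M N" and eq: "?graph h = ?graph k"
    show "h = k"
    proof (rule homs_ext[OF hk])
      fix s x assume "x \<in> car M s"
      then have "((s, x), s, h s x) \<in> ?graph h" by (intro image_eqI[of _ _ "(s, x)"]) simp_all
      then show "h s x = k s x" unfolding eq by auto
    qed
  qed
  moreover have "?graph ` homs \<Sigma> M N \<subseteq> Pow (pts M \<times> pts N)"
    using on_pts_image_subset by blast
  ultimately have "homs \<Sigma> M N \<lesssim> Pow (pts M \<times> pts N)"
    unfolding lepoll_def by blast
  moreover have "set_sized \<W> (Pow (pts M \<times> pts N))"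
    using assms by (intro set_sized_Pow set_sized_Times set_sized_pts)
  ultimately show ?thesis by (rule set_sized_lepoll[rotated])
qed

section \<open>Full subcategories closed under subalgebras and quotients\<close>

lemma full_subcat_Obj [simp]: "Obj (full_subcat \<Sigma> \<M>) = \<M>"
  by (simp add: full_subcat_def)

lemma full_subcat_Arr [simp]:
  "(M, h, N) \<in> Arr (full_subcat \<Sigma> \<M>) \<longleftrightarrow> M \<in> \<M> \<and> N \<in> \<M> \<and> h \<in> homs \<Sigma> M N"
  by (simp add: full_subcat_def)

lemma full_subcat_Dom [simp]: "Dom (full_subcat \<Sigma> \<M>) (M, h, N) = M"
  by (simp add: full_subcat_def)

lemma full_subcat_Cod [simp]: "Cod (full_subcat \<Sigma> \<M>) (M, h, N) = N"
  by (simp add: full_subcat_def)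

lemma full_subcat_Ident [simp]: "Ident (full_subcat \<Sigma> \<M>) M = (M, \<lambda>s. restrict id (car M s), M)"
  by (simp add: full_subcat_def)

lemma full_subcat_Comp [simp]:
  "Comp (full_subcat \<Sigma> \<M>) (M', k, P) (M, h, N) = (M, \<lambda>s. compose (car M s) (k s) (h s), P)"
  by (simp add: full_subcat_def)

lemma full_subcat_Hom [simp]:
  "(M, h, N) \<in> Hom (full_subcat \<Sigma> \<M>) X Y \<longleftrightarrow> M = X \<and> N = Y \<and> X \<in> \<M> \<and> Y \<in> \<M> \<and> h \<in> homs \<Sigma> X Y"
  by (auto simp: Hom_def)

lemma full_subcat_ArrE:
  assumes "f \<in> Arr (full_subcat \<Sigma> \<M>)"
  obtains M h N where "f = (M, h, N)" "M \<in> \<M>" "N \<in> \<M>" "h \<in> homs \<Sigma> M N"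
  using assms by (cases f) auto

lemma full_subcat_HomE:
  assumes "f \<in> Hom (full_subcat \<Sigma> \<M>) X Y"
  obtains h where "f = (X, h, Y)" "X \<in> \<M>" "Y \<in> \<M>" "h \<in> homs \<Sigma> X Y"
  using assms by (cases f) auto

text \<open>The two closure properties are all that is used of the axioms, so the theory with and
  the theory without disjunctive axioms are treated at once. They are stated for arbitrary
  injections and surjections, which includes closure under isomorphic copies in the
  universe.\<close>

locale model_class =
  fixes \<W> :: "'u set set" and \<Sigma> :: "('s, 'f) signature" and \<M> :: "('s, 'f, 'u) struct set"
  assumes universe: "universe \<W>" and signature: "wf_signature \<W> \<Sigma>"
    and structs: "\<M> \<subseteq> structures \<W> \<Sigma>"
    and sub_closed: "\<And>M N h. N \<in> \<M> \<Longrightarrow> M \<in> structures \<W> \<Sigma> \<Longrightarrow> h \<in> homs \<Sigma> M N \<Longrightarrow>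
      (\<And>s. inj_on (h s) (car M s)) \<Longrightarrow> M \<in> \<M>"
    and quotient_closed: "\<And>M N h. M \<in> \<M> \<Longrightarrow> N \<in> structures \<W> \<Sigma> \<Longrightarrow> h \<in> homs \<Sigma> M N \<Longrightarrow>
      (\<And>s. h s ` car M s = car N s) \<Longrightarrow> N \<in> \<M>"
begin

abbreviation C where "C \<equiv> full_subcat \<Sigma> \<M>"
abbreviation surjs where "surjs \<equiv> sortwise_surj \<Sigma> C"
abbreviation injs where "injs \<equiv> sortwise_inj \<Sigma> C"

lemma struct [intro]: "M \<in> \<M> \<Longrightarrow> M \<in> structures \<W> \<Sigma>"
  using structs by blast

lemma comp_homs:
  assumes "M \<in> \<M>" "h \<in> homs \<Sigma> M N" "k \<in> homs \<Sigma> N P"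
  shows "(\<lambda>s. compose (car M s) (k s) (h s)) \<in> homs \<Sigma> M P"
  using homs_comp struct assms by blast

lemma comp_eq_iff:
  assumes "M \<in> \<M>" "h \<in> homs \<Sigma> M N" "k \<in> homs \<Sigma> N P" "g \<in> homs \<Sigma> M P'"
  shows "(\<lambda>s. compose (car M s) (k s) (h s)) = g \<longleftrightarrow> (\<forall>s. \<forall>x\<in>car M s. k s (h s x) = g s x)"
proof
  assume "\<forall>s. \<forall>x\<in>car M s. k s (h s x) = g s x"
  then show "(\<lambda>s. compose (car M s) (k s) (h s)) = g"
    by (intro homs_ext[OF comp_homs[OF assms(1-3)] assms(4)]) (simp add: compose_eq)
next
  assume "(\<lambda>s. compose (car M s) (k s) (h s)) = g"
  then have "compose (car M s) (k s) (h s) x = g s x" for s x by metis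
  then show "\<forall>s. \<forall>x\<in>car M s. k s (h s x) = g s x" by (metis compose_eq)
qed

lemma comp_eq_comp_iff:
  assumes "M \<in> \<M>" "h \<in> homs \<Sigma> M N" "k \<in> homs \<Sigma> N P" "h' \<in> homs \<Sigma> M N'" "k' \<in> homs \<Sigma> N' P'"
  shows "(\<lambda>s. compose (car M s) (k s) (h s)) = (\<lambda>s. compose (car M s) (k' s) (h' s)) \<longleftrightarrow>
    (\<forall>s. \<forall>x\<in>car M s. k s (h s x) = k' s (h' s x))"
  using comp_eq_iff[OF assms(1-3) comp_homs[OF assms(1,4,5)]] by (simp add: compose_eq)

lemma id_homs: "M \<in> \<M> \<Longrightarrow> (\<lambda>s. restrict id (car M s)) \<in> homs \<Sigma> M M"
  using homs_id struct by blast

lemma comp_eq_id_iff: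
  assumes "M \<in> \<M>" "h \<in> homs \<Sigma> M N" "k \<in> homs \<Sigma> N M"
  shows "(\<lambda>s. compose (car M s) (k s) (h s)) = (\<lambda>s. restrict id (car M s)) \<longleftrightarrow>
    (\<forall>s. \<forall>x\<in>car M s. k s (h s x) = x)"
  using comp_eq_iff[OF assms id_homs[OF assms(1)]] by simp

lemma category: "category \<W> C"
  unfolding category_def
proof (intro conjI ballI impI)
  fix X Y assume "X \<in> Obj C" "Y \<in> Obj C"
  then have "set_sized \<W> (homs \<Sigma> X Y)"
    using set_sized_homs universe signature struct by simp blast
  then have "set_sized \<W> ((\<lambda>h. (X, h, Y)) ` homs \<Sigma> X Y)" by (rule set_sized_image)
  then show "set_sized \<W> (Hom C X Y)"
    by (rule set_sized_subset) (auto elim: full_subcat_HomE)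
next
  fix f g h assume "f \<in> Arr C" "g \<in> Arr C" "h \<in> Arr C"
    and "Dom C g = Cod C f \<and> Dom C h = Cod C g"
  then obtain K L M N f' g' h' where *: "f = (K, f', L)" "g = (L, g', M)" "h = (M, h', N)" "K \<in> \<M>" "L \<in> \<M>"
    and homs: "f' \<in> homs \<Sigma> K L" "g' \<in> homs \<Sigma> L M" "h' \<in> homs \<Sigma> M N"
    by (auto elim!: full_subcat_ArrE)
  have "(\<lambda>s. compose (car K s) (h' s) (compose (car K s) (g' s) (f' s))) =
      (\<lambda>s. compose (car K s) (compose (car L s) (h' s) (g' s)) (f' s))"
    using homs comp_homs * homs_car[OF homs(1)]
    by (subst comp_eq_comp_iff[of K _ M _ N _ L _ N]) (auto simp: compose_eq)
  then show "Comp C h (Comp C g f) = Comp C (Comp C h g) f"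
    by (simp add: *)
next
  fix f assume "f \<in> Arr C"
  then obtain M h N where "f = (M, h, N)" "M \<in> \<M>" "N \<in> \<M>" "h \<in> homs \<Sigma> M N"
    by (rule full_subcat_ArrE)
  then show "Comp C f (Ident C (Dom C f)) = f" "Comp C (Ident C (Cod C f)) f = f"
    using comp_eq_iff[OF _ id_homs] comp_eq_iff[OF _ _ id_homs] by (simp_all add: homs_car)
qed (auto elim!: full_subcat_ArrE simp: comp_homs id_homs)

text \<open>Off the sorts both carriers are empty, so the condition may be quantified over all of
  \<open>'s\<close>; later arguments then need no membership in
  \<open>sorts \<Sigma>\<close>.\<close>

lemma surjs_iff:
  "(M, h, N) \<in> surjs \<longleftrightarrow> M \<in> \<M> \<and> N \<in> \<M> \<and> h \<in> homs \<Sigma> M N \<and> (\<forall>s. h s ` car M s = car N s)"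
proof -
  have "h s ` car M s = car N s" if "M \<in> \<M>" "N \<in> \<M>" "s \<notin> sorts \<Sigma>" for s
    using that struct structures_sort[of M \<W> \<Sigma> _ s] structures_sort[of N \<W> \<Sigma> _ s] by blast
  then show ?thesis by (auto simp: sortwise_surj_def)
qed

lemma injs_iff:
  "(M, h, N) \<in> injs \<longleftrightarrow> M \<in> \<M> \<and> N \<in> \<M> \<and> h \<in> homs \<Sigma> M N \<and> (\<forall>s. inj_on (h s) (car M s))"
proof -
  have "inj_on (h s) (car M s)" if "M \<in> \<M>" "s \<notin> sorts \<Sigma>" for s
    using that struct structures_sort[of M \<W> \<Sigma> _ s] by (auto simp: inj_on_def)
  then show ?thesis by (auto simp: sortwise_inj_def)
qed

lemma surjsE:
  assumes "f \<in> surjs"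
  obtains M h N where "f = (M, h, N)" "M \<in> \<M>" "N \<in> \<M>" "h \<in> homs \<Sigma> M N" "\<And>s. h s ` car M s = car N s"
proof -
  obtain M h N where "f = (M, h, N)" by (cases f)
  then show thesis using that[of M h N] assms surjs_iff[of M h N] by simp
qed

lemma injsE:
  assumes "f \<in> injs"
  obtains M h N where "f = (M, h, N)" "M \<in> \<M>" "N \<in> \<M>" "h \<in> homs \<Sigma> M N" "\<And>s. inj_on (h s) (car M s)"
proof -
  obtain M h N where "f = (M, h, N)" by (cases f)
  then show thesis using that[of M h N] assms injs_iff[of M h N] by simp
qed

text \<open>The class \<open>\<M>\<close> enters only through the two objects, which is why the
  inclusion of one class into another reflects isomorphisms.\<close>

lemma iso_arr_iff:
  "iso_arr C (M, h, N) \<longleftrightarrow> M \<in> \<M> \<and> N \<in> \<M> \<and> h \<in> homs \<Sigma> M N \<and>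
    (\<exists>k\<in>homs \<Sigma> N M. (\<forall>s. \<forall>x\<in>car M s. k s (h s x) = x) \<and> (\<forall>s. \<forall>y\<in>car N s. h s (k s y) = y))"
proof
  assume iso: "iso_arr C (M, h, N)"
  then have h: "M \<in> \<M>" "N \<in> \<M>" "h \<in> homs \<Sigma> M N" by (simp_all add: iso_arr_def)
  obtain g where g: "g \<in> Hom C N M" "Comp C g (M, h, N) = Ident C M" "Comp C (M, h, N) g = Ident C N"
    using iso by (auto simp: iso_arr_def)
  from g(1) obtain k where k: "g = (N, k, M)" "k \<in> homs \<Sigma> N M" by (rule full_subcat_HomE)
  show "M \<in> \<M> \<and> N \<in> \<M> \<and> h \<in> homs \<Sigma> M N \<and>
    (\<exists>k\<in>homs \<Sigma> N M. (\<forall>s. \<forall>x\<in>car M s. k s (h s x) = x) \<and> (\<forall>s. \<forall>y\<in>car N s. h s (k s y) = y))"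
    using g(2,3) h k by (intro conjI bexI[of _ k]) (simp_all add: comp_eq_id_iff)
next
  assume "M \<in> \<M> \<and> N \<in> \<M> \<and> h \<in> homs \<Sigma> M N \<and>
    (\<exists>k\<in>homs \<Sigma> N M. (\<forall>s. \<forall>x\<in>car M s. k s (h s x) = x) \<and> (\<forall>s. \<forall>y\<in>car N s. h s (k s y) = y))"
  then obtain k where h: "M \<in> \<M>" "N \<in> \<M>" "h \<in> homs \<Sigma> M N" and k: "k \<in> homs \<Sigma> N M"
    "\<forall>s. \<forall>x\<in>car M s. k s (h s x) = x" "\<forall>s. \<forall>y\<in>car N s. h s (k s y) = y"
    by blast
  then show "iso_arr C (M, h, N)"
    unfolding iso_arr_def by (intro conjI bexI[of _ "(N, k, M)"]) (simp_all add: comp_eq_id_iff)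
qed

lemma iso_arr_surjs_injs:
  assumes "iso_arr C f"
  shows "f \<in> surjs" "f \<in> injs"
proof -
  obtain M h N where f: "f = (M, h, N)" by (cases f)
  then obtain k where h: "M \<in> \<M>" "N \<in> \<M>" "h \<in> homs \<Sigma> M N" and k: "k \<in> homs \<Sigma> N M"
      "\<forall>s. \<forall>x\<in>car M s. k s (h s x) = x" "\<forall>s. \<forall>y\<in>car N s. h s (k s y) = y"
    using assms by (auto simp: iso_arr_iff)
  have "h s ` car M s = car N s" for s
  proof
    show "h s ` car M s \<subseteq> car N s" using homs_car[OF h(3)] by blast
    show "car N s \<subseteq> h s ` car M s"
    proof
      fix y assume "y \<in> car N s"
      then show "y \<in> h s ` car M s" using homs_car[OF k(1)] k(3) by (intro image_eqI[of _ _ "k s y"]) simp_all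
    qed
  qed
  then show "f \<in> surjs" using f h by (simp add: surjs_iff)
  have "inj_on (h s) (car M s)" for s using k(2) by (auto intro: inj_on_inverseI)
  then show "f \<in> injs" using f h by (simp add: injs_iff)
qed

lemma factorization:
  assumes "M \<in> \<M>" "N \<in> \<M>" "h \<in> homs \<Sigma> M N"
  obtains I e m where "(M, e, I) \<in> surjs" "(I, m, N) \<in> injs"
    "\<And>s x. x \<in> car M s \<Longrightarrow> m s (e s x) = h s x"
proof -
  obtain I e m where "I \<in> structures \<W> \<Sigma>" "e \<in> homs \<Sigma> M I" "m \<in> homs \<Sigma> I N"
    "\<And>s. e s ` car M s = car I s" "\<And>s. inj_on (m s) (car I s)"
    and me: "\<And>s x. x \<in> car M s \<Longrightarrow> m s (e s x) = h s x"
    using homs_image_factorization[OF universe struct struct assms(3)] assms by metis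
  moreover from this have "I \<in> \<M>" using sub_closed assms(2) by blast
  ultimately have "(M, e, I) \<in> surjs" "(I, m, N) \<in> injs"
    using assms by (auto simp: surjs_iff injs_iff)
  then show thesis using me that by blast
qed

lemma factor_comp:
  assumes "M \<in> \<M>" "h \<in> homs \<Sigma> M N" "e \<in> homs \<Sigma> M I" "m \<in> homs \<Sigma> I N"
    "\<And>s x. x \<in> car M s \<Longrightarrow> m s (e s x) = h s x"
  shows "(M, h, N) = Comp C (I, m, N) (M, e, I)"
  using comp_eq_iff[OF assms(1,3,4,2)] assms(5) by simp

lemma surjs_epi: "e \<in> surjs \<Longrightarrow> epi_arr C e"
  by (auto simp: epi_arr_def comp_eq_comp_iff elim!: surjsE full_subcat_ArrE intro!: homs_ext)
    (metis imageE)

lemma injs_mono: "m \<in> injs \<Longrightarrow> mono_arr C m"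
  by (auto simp: mono_arr_def comp_eq_comp_iff elim!: injsE full_subcat_ArrE intro!: homs_ext)
    (meson homs_car inj_onD)

lemma surjs_comp:
  assumes "f \<in> surjs" "g \<in> surjs" "Dom C g = Cod C f"
  shows "Comp C g f \<in> surjs"
proof -
  obtain M h N where f: "f = (M, h, N)" using assms(1) by (rule surjsE)
  obtain k P where g: "g = (N, k, P)" using assms(2,3) f by (auto elim: surjsE)
  have *: "M \<in> \<M>" "P \<in> \<M>" "h \<in> homs \<Sigma> M N" "k \<in> homs \<Sigma> N P"
      "\<And>s. h s ` car M s = car N s" "\<And>s. k s ` car N s = car P s"
    using assms(1,2) by (simp_all add: f g surjs_iff)
  have "compose (car M s) (k s) (h s) ` car M s = k s ` h s ` car M s" for s
    by (auto simp: compose_eq image_iff)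
  then show ?thesis using * by (simp add: f g surjs_iff comp_homs)
qed

lemma injs_comp:
  assumes "f \<in> injs" "g \<in> injs" "Dom C g = Cod C f"
  shows "Comp C g f \<in> injs"
proof -
  obtain M h N where f: "f = (M, h, N)" using assms(1) by (rule injsE)
  obtain k P where g: "g = (N, k, P)" using assms(2,3) f by (auto elim: injsE)
  have *: "M \<in> \<M>" "P \<in> \<M>" "h \<in> homs \<Sigma> M N" "k \<in> homs \<Sigma> N P"
      "\<And>s. inj_on (h s) (car M s)" "\<And>s. inj_on (k s) (car N s)"
    using assms(1,2) by (simp_all add: f g injs_iff)
  have "inj_on (compose (car M s) (k s) (h s)) (car M s)" for s
    using *(5,6)[of s] homs_car[OF *(3)] by (simp add: inj_on_def compose_eq)
  then show ?thesis using * by (simp add: f g injs_iff comp_homs)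
qed

text \<open>\<open>m\<close> is injective and \<open>m a = b e\<close>, so \<open>a\<close> is
  constant on the fibres of \<open>e\<close> and descends along it. The lower triangle follows
  because \<open>e\<close> is surjective.\<close>

lemma diagonal:
  assumes "(K, e, L) \<in> surjs" "(M, m, N) \<in> injs" and a: "a \<in> homs \<Sigma> K M" and b: "b \<in> homs \<Sigma> L N"
    and comm: "\<And>s x. x \<in> car K s \<Longrightarrow> m s (a s x) = b s (e s x)"
  obtains d where "d \<in> homs \<Sigma> L M" "\<And>s x. x \<in> car K s \<Longrightarrow> d s (e s x) = a s x"
    "\<And>s y. y \<in> car L s \<Longrightarrow> m s (d s y) = b s y"
proof -
  have e: "K \<in> structures \<W> \<Sigma>" "L \<in> structures \<W> \<Sigma>" "e \<in> homs \<Sigma> K L" "\<And>s. e s ` car K s = car L s"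
    and m: "m \<in> homs \<Sigma> M N" "\<And>s. inj_on (m s) (car M s)"
    using assms(1,2) by (auto simp: surjs_iff injs_iff)
  have "a s x = a s y" if "x \<in> car K s" "y \<in> car K s" "e s x = e s y" for s x y
    using comm[OF that(1)] comm[OF that(2)] that m(2) homs_car[OF a] by (metis inj_onD)
  then obtain d where d: "d \<in> homs \<Sigma> L M" "\<And>s x. x \<in> car K s \<Longrightarrow> d s (e s x) = a s x"
    using homs_factor_surj[OF e(1-3) _ a] e(4) by (metis order_refl)
  have "m s (d s y) = b s y" if "y \<in> car L s" for s y
    using that d(2) comm e(4) by (metis imageE)
  then show thesis using that d by blast
qed

lemma proper_factorization_system: "proper_factorization_system C surjs injs"
  unfolding proper_factorization_system_def factorization_system_def
proof (intro conjI ballI impI subsetI)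
  fix f assume "f \<in> Arr C"
  then obtain M h N where f: "f = (M, h, N)" "M \<in> \<M>" "N \<in> \<M>" "h \<in> homs \<Sigma> M N"
    by (rule full_subcat_ArrE)
  obtain I e m where em: "(M, e, I) \<in> surjs" "(I, m, N) \<in> injs"
    "\<And>s x. x \<in> car M s \<Longrightarrow> m s (e s x) = h s x"
    by (rule factorization[OF f(2-4)]) (assumption | rule that)+
  then have "f = Comp C (I, m, N) (M, e, I)"
    unfolding f(1) by (intro factor_comp f(2,4)) (simp_all add: surjs_iff injs_iff)
  then show "\<exists>e\<in>surjs. \<exists>m\<in>injs. Dom C m = Cod C e \<and> f = Comp C m e"
    using em by (intro bexI[of _ "(M, e, I)"] bexI[of _ "(I, m, N)"]) auto
next
  fix e m a b assume em: "e \<in> surjs" "m \<in> injs"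
    and ab: "a \<in> Hom C (Dom C e) (Dom C m)" "b \<in> Hom C (Cod C e) (Cod C m)" "Comp C m a = Comp C b e"
  obtain K L e' where e: "e = (K, e', L)" using em(1) by (rule surjsE)
  obtain M N m' where m: "m = (M, m', N)" using em(2) by (rule injsE)
  obtain a' where a: "a = (K, a', M)" "a' \<in> homs \<Sigma> K M" using ab(1) by (auto simp: e m elim: full_subcat_HomE)
  obtain b' where b: "b = (L, b', N)" "b' \<in> homs \<Sigma> L N" using ab(2) by (auto simp: e m elim: full_subcat_HomE)
  have e': "K \<in> \<M>" "L \<in> \<M>" "e' \<in> homs \<Sigma> K L" "\<And>s. e' s ` car K s = car L s"
    and m': "M \<in> \<M>" "N \<in> \<M>" "m' \<in> homs \<Sigma> M N"
    using em by (auto simp: e m surjs_iff injs_iff)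
  have comm: "m' s (a' s x) = b' s (e' s x)" if "x \<in> car K s" for s x
    using ab(3) that a b e' m' by (simp add: e m comp_eq_comp_iff)
  obtain d where d: "d \<in> homs \<Sigma> L M" "\<And>s x. x \<in> car K s \<Longrightarrow> d s (e' s x) = a' s x"
    "\<And>s y. y \<in> car L s \<Longrightarrow> m' s (d s y) = b' s y"
    by (rule diagonal[OF em(1)[unfolded e] em(2)[unfolded m] a(2) b(2) comm]) (assumption | rule that)+
  show "\<exists>!d. d \<in> Hom C (Cod C e) (Dom C m) \<and> Comp C d e = a \<and> Comp C m d = b"
  proof (rule ex1I[of _ "(L, d, M)"])
    show "(L, d, M) \<in> Hom C (Cod C e) (Dom C m) \<and> Comp C (L, d, M) e = a \<and> Comp C m (L, d, M) = b"
      using d a b e' m' by (simp add: e m comp_eq_iff)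
    fix c assume "c \<in> Hom C (Cod C e) (Dom C m) \<and> Comp C c e = a \<and> Comp C m c = b"
    then obtain c' where c: "c = (L, c', M)" "c' \<in> homs \<Sigma> L M" "\<And>s x. x \<in> car K s \<Longrightarrow> c' s (e' s x) = a' s x"
      using a e' by (auto simp: e m comp_eq_iff elim!: full_subcat_HomE)
    have "c' = d"
      using c(2) d(1) by (rule homs_ext) (metis c(3) d(2) e'(4) imageE)
    then show "c = (L, d, M)" using c(1) by simp
  qed
qed (use iso_arr_surjs_injs surjs_comp injs_comp surjs_epi injs_mono in
  \<open>auto simp: sortwise_surj_def sortwise_inj_def\<close>)

end

section \<open>Pullbacks and pushouts\<close>

lemma ex1_eq: "\<exists>!x. Q x \<Longrightarrow> Q a \<Longrightarrow> Q b \<Longrightarrow> a = b"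
  by blast

context model_class begin

section \<open>Pullbacks of injections\<close>

text \<open>The conditions say that \<open>P\<close> is the intersection of the two subobjects of
  \<open>Y\<close>. They concern elements only and are necessary as well, by
  \<open>pullbackD\<close>; so they can be read off in one class of models and used in
  another.\<close>

lemma pullbackI:
  assumes f: "(X, f, Y) \<in> injs" and g: "(Z, g, Y) \<in> injs"
    and P: "P \<in> \<M>" "p \<in> homs \<Sigma> P X" "q \<in> homs \<Sigma> P Z"
    and comm: "\<And>s x. x \<in> car P s \<Longrightarrow> f s (p s x) = g s (q s x)"
    and inj: "\<And>s. inj_on (p s) (car P s)"
    and im: "\<And>s. f s ` car X s \<inter> g s ` car Z s \<subseteq> (\<lambda>x. f s (p s x)) ` car P s"
  shows "pullback_square C (X, f, Y) (Z, g, Y) (P, p, X) (P, q, Z)"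
  unfolding pullback_square_def
proof (intro conjI ballI impI)
  have f': "X \<in> \<M>" "Y \<in> \<M>" "f \<in> homs \<Sigma> X Y" "\<And>s. inj_on (f s) (car X s)"
    and g': "Z \<in> \<M>" "g \<in> homs \<Sigma> Z Y" "\<And>s. inj_on (g s) (car Z s)"
    using f g by (simp_all add: injs_iff)
  show "(X, f, Y) \<in> Arr C" "(Z, g, Y) \<in> Arr C" "(P, p, X) \<in> Arr C" "(P, q, Z) \<in> Arr C"
    using f' g' P by simp_all
  show "Comp C (X, f, Y) (P, p, X) = Comp C (Z, g, Y) (P, q, Z)"
    using f' g' P comm by (simp add: comp_eq_comp_iff)
  fix a b
  assume "a \<in> Arr C" "b \<in> Arr C" and "Cod C a = Dom C (X, f, Y) \<and>
    Cod C b = Dom C (Z, g, Y) \<and> Dom C a = Dom C b \<and> Comp C (X, f, Y) a = Comp C (Z, g, Y) b"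
  then obtain W a' b' where a: "a = (W, a', X)" "W \<in> \<M>" "a' \<in> homs \<Sigma> W X"
    and b: "b = (W, b', Z)" "b' \<in> homs \<Sigma> W Z"
    and ab: "\<And>s x. x \<in> car W s \<Longrightarrow> f s (a' s x) = g s (b' s x)"
    using f' g' by (auto elim!: full_subcat_ArrE simp: comp_eq_comp_iff)
  have im': "a' s ` car W s \<subseteq> p s ` car P s" for s
  proof
    fix y assume "y \<in> a' s ` car W s"
    then obtain x where x: "x \<in> car W s" "y = a' s x" by blast
    have "a' s x \<in> car X s" "b' s x \<in> car Z s"
      using homs_car[OF a(3) x(1)] homs_car[OF b(2) x(1)] by simp_all
    then have "f s (a' s x) \<in> f s ` car X s \<inter> g s ` car Z s" using ab[OF x(1)] by (metis IntI imageI)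
    then obtain w where w: "w \<in> car P s" "f s (a' s x) = f s (p s w)" using im[of s] by blast
    then have "a' s x = p s w"
      using inj_onD[OF f'(4) w(2)] \<open>a' s x \<in> car X s\<close> homs_car[OF P(2) w(1)] by simp
    then show "y \<in> p s ` car P s" using x w by blast
  qed
  obtain u where u: "u \<in> homs \<Sigma> W P" "\<And>s x. x \<in> car W s \<Longrightarrow> p s (u s x) = a' s x"
    by (rule homs_factor_inj[OF struct[OF a(2)] struct[OF P(1)] P(2) inj a(3) im']) (assumption | rule that)+
  \<comment> \<open>The second projection needs no condition of its own: its value is determined
    through the injective \<open>g\<close>.\<close>
  have qu: "q s (u s x) = b' s x" if x: "x \<in> car W s" for s x
  proof (rule inj_onD[OF g'(3)])
    show "g s (q s (u s x)) = g s (b' s x)"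
      using comm[OF homs_car[OF u(1) x]] u(2)[OF x] ab[OF x] by simp
  qed (use x u(1) P(3) b(2) in \<open>auto intro: homs_car\<close>)
  show "\<exists>!u. u \<in> Hom C (Dom C a) (Dom C (P, p, X)) \<and> Comp C (P, p, X) u = a \<and> Comp C (P, q, Z) u = b"
  proof (rule ex1I[of _ "(W, u, P)"])
    show "(W, u, P) \<in> Hom C (Dom C a) (Dom C (P, p, X)) \<and>
        Comp C (P, p, X) (W, u, P) = a \<and> Comp C (P, q, Z) (W, u, P) = b"
      using u qu a b P by (simp add: comp_eq_iff)
    fix v assume "v \<in> Hom C (Dom C a) (Dom C (P, p, X)) \<and> Comp C (P, p, X) v = a \<and> Comp C (P, q, Z) v = b"
    then obtain v' where v: "v = (W, v', P)" "v' \<in> homs \<Sigma> W P" "\<And>s x. x \<in> car W s \<Longrightarrow> p s (v' s x) = a' s x"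
      using a P by (auto simp: comp_eq_iff elim!: full_subcat_HomE)
    have "v' = u"
      using v(2) u(1)
    proof (rule homs_ext)
      fix s x assume x: "x \<in> car W s"
      have "p s (v' s x) = p s (u s x)" using v(3)[OF x] u(2)[OF x] by simp
      then show "v' s x = u s x"
        using homs_car[OF v(2) x] homs_car[OF u(1) x] by (rule inj_onD[OF inj])
    qed
    then show "v = (W, u, P)" using v(1) by simp
  qed
qed simp_all

lemma pullback_exists:
  assumes f: "(X, f, Y) \<in> injs" and g: "(Z, g, Y) \<in> injs"
  obtains P p q where "P \<in> \<M>" "p \<in> homs \<Sigma> P X" "q \<in> homs \<Sigma> P Z"
    "\<And>s x. x \<in> car P s \<Longrightarrow> f s (p s x) = g s (q s x)" "\<And>s. inj_on (p s) (car P s)"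
    "\<And>s. f s ` car X s \<inter> g s ` car Z s \<subseteq> (\<lambda>x. f s (p s x)) ` car P s"
proof -
  have f': "X \<in> structures \<W> \<Sigma>" "Y \<in> structures \<W> \<Sigma>" "f \<in> homs \<Sigma> X Y" "\<And>s. inj_on (f s) (car X s)"
    and g': "Z \<in> structures \<W> \<Sigma>" "g \<in> homs \<Sigma> Z Y" "\<And>s. inj_on (g s) (car Z s)"
    using f g by (auto simp: injs_iff)
  obtain P i where P: "P \<in> structures \<W> \<Sigma>" "i \<in> homs \<Sigma> P Y" "\<And>s. inj_on (i s) (car P s)"
    "\<And>s. i s ` car P s = f s ` car X s \<inter> g s ` car Z s"
    by (rule homs_intersection[OF universe f'(1) g'(1) f'(2) f'(3) g'(2)]) (assumption | rule that)+
  obtain p where p: "p \<in> homs \<Sigma> P X" "\<And>s x. x \<in> car P s \<Longrightarrow> f s (p s x) = i s x"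
    using homs_factor_inj[OF P(1) f'(1,3,4) P(2)] P(4) by blast
  obtain q where q: "q \<in> homs \<Sigma> P Z" "\<And>s x. x \<in> car P s \<Longrightarrow> g s (q s x) = i s x"
    using homs_factor_inj[OF P(1) g'(1-3) P(2)] P(4) by blast
  show thesis
  proof (rule that[OF _ p(1) q(1)])
    show "P \<in> \<M>" using sub_closed[OF _ P(1-3)] f by (simp add: injs_iff)
    show "f s (p s x) = g s (q s x)" if "x \<in> car P s" for s x
      using p(2)[OF that] q(2)[OF that] by simp
    show "inj_on (p s) (car P s)" for s
      using P(3)[of s] p(2) by (metis inj_onI inj_onD)
    show "f s ` car X s \<inter> g s ` car Z s \<subseteq> (\<lambda>x. f s (p s x)) ` car P s" for s
      using P(4)[of s] p(2) by (simp cong: image_cong)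
  qed
qed

lemma pullback_factor:
  assumes f: "(X, f, Y) \<in> injs" and g: "(Z, g, Y) \<in> injs"
    and pb: "pullback_square C (X, f, Y) (Z, g, Y) (P, p, X) (P, q, Z)"
    and W: "W \<in> \<M>" "a \<in> homs \<Sigma> W X" "b \<in> homs \<Sigma> W Z"
    and ab: "\<And>s x. x \<in> car W s \<Longrightarrow> f s (a s x) = g s (b s x)"
  obtains u where "u \<in> homs \<Sigma> W P" "\<And>s x. x \<in> car W s \<Longrightarrow> p s (u s x) = a s x"
    "\<And>s x. x \<in> car W s \<Longrightarrow> q s (u s x) = b s x"
proof -
  have f': "X \<in> \<M>" "Y \<in> \<M>" "f \<in> homs \<Sigma> X Y" and g': "Z \<in> \<M>" "g \<in> homs \<Sigma> Z Y"
    using f g by (simp_all add: injs_iff)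
  have P: "P \<in> \<M>" "p \<in> homs \<Sigma> P X" "q \<in> homs \<Sigma> P Z"
    using pb by (simp_all add: pullback_square_def)
  have "\<exists>!u. u \<in> Hom C W P \<and> Comp C (P, p, X) u = (W, a, X) \<and> Comp C (P, q, Z) u = (W, b, Z)"
    using pb W ab f' g' unfolding pullback_square_def
    by (elim conjE) (drule bspec[of _ _ "(W, a, X)"], simp, drule bspec[of _ _ "(W, b, Z)"], simp,
      simp add: comp_eq_comp_iff)
  then obtain k where k: "k \<in> Hom C W P" "Comp C (P, p, X) k = (W, a, X)" "Comp C (P, q, Z) k = (W, b, Z)"
    by (elim ex1E conjE)
  obtain u where u: "k = (W, u, P)" "u \<in> homs \<Sigma> W P" using k(1) by (rule full_subcat_HomE)
  show thesis
    using that[OF u(2)] k(2,3) u W P by (simp add: comp_eq_iff)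
qed

text \<open>Both \<open>u\<close> and \<open>v\<close> mediate the cone formed by composing the
  projections with \<open>u\<close>.\<close>

lemma pullback_unique:
  assumes f: "(X, f, Y) \<in> injs" and g: "(Z, g, Y) \<in> injs"
    and pb: "pullback_square C (X, f, Y) (Z, g, Y) (P, p, X) (P, q, Z)"
    and W: "W \<in> \<M>" and uv: "u \<in> homs \<Sigma> W P" "v \<in> homs \<Sigma> W P"
    and eq: "\<And>s x. x \<in> car W s \<Longrightarrow> p s (u s x) = p s (v s x)"
      "\<And>s x. x \<in> car W s \<Longrightarrow> q s (u s x) = q s (v s x)"
  shows "u = v"
proof -
  have f': "X \<in> \<M>" "Y \<in> \<M>" "f \<in> homs \<Sigma> X Y" and g': "Z \<in> \<M>" "g \<in> homs \<Sigma> Z Y"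
    using f g by (simp_all add: injs_iff)
  have P: "P \<in> \<M>" "p \<in> homs \<Sigma> P X" "q \<in> homs \<Sigma> P Z"
    using pb by (simp_all add: pullback_square_def)
  have comm: "f s (p s x) = g s (q s x)" if "x \<in> car P s" for s x
    using pb f' g' P that by (simp add: pullback_square_def comp_eq_comp_iff)
  let ?a = "\<lambda>s. compose (car W s) (p s) (u s)" and ?b = "\<lambda>s. compose (car W s) (q s) (u s)"
  have ab: "?a \<in> homs \<Sigma> W X" "?b \<in> homs \<Sigma> W Z" using W uv(1) P by (blast intro: comp_homs)+
  have "f s (?a s x) = g s (?b s x)" if "x \<in> car W s" for s x
    using comm[OF homs_car[OF uv(1) that]] that by (simp add: compose_eq)
  then have ex1: "\<exists>!k. k \<in> Hom C W P \<and> Comp C (P, p, X) k = (W, ?a, X) \<and> Comp C (P, q, Z) k = (W, ?b, Z)"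
    using pb W ab f' g' unfolding pullback_square_def
    by (elim conjE) (drule bspec[of _ _ "(W, ?a, X)"], simp, drule bspec[of _ _ "(W, ?b, Z)"], simp,
      simp add: comp_eq_comp_iff)
  have "(\<lambda>s. compose (car W s) (p s) (v s)) = ?a" "(\<lambda>s. compose (car W s) (q s) (v s)) = ?b"
    using comp_eq_comp_iff[OF W uv(2) P(2) uv(1) P(2)] comp_eq_comp_iff[OF W uv(2) P(3) uv(1) P(3)] eq
    by simp_all
  then have "(W, u, P) = (W, v, P)"
    by (intro ex1_eq[OF ex1]) (simp_all add: W P uv)
  then show ?thesis by simp
qed

text \<open>An arbitrary pullback is compared with the explicit one, with \<open>u\<close> from
  \<open>P'\<close> to \<open>P\<close> and \<open>v\<close> back. The identity
  \<open>u v = id\<close> suffices: \<open>p\<close> is injective since \<open>p' v = p\<close> with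
  \<open>p'\<close> and \<open>v\<close> injective, and the image of \<open>P'\<close> in
  \<open>Y\<close> lies in that of \<open>P\<close> because \<open>p u = p'\<close>.\<close>

lemma pullbackD:
  assumes f: "(X, f, Y) \<in> injs" and g: "(Z, g, Y) \<in> injs"
    and pb: "pullback_square C (X, f, Y) (Z, g, Y) (P, p, X) (P, q, Z)"
  shows "inj_on (p s) (car P s)"
    and "f s ` car X s \<inter> g s ` car Z s \<subseteq> (\<lambda>x. f s (p s x)) ` car P s"
proof -
  have f': "X \<in> \<M>" "Y \<in> \<M>" "f \<in> homs \<Sigma> X Y" and g': "Z \<in> \<M>" "g \<in> homs \<Sigma> Z Y"
    using f g by (simp_all add: injs_iff)
  have P: "P \<in> \<M>" "p \<in> homs \<Sigma> P X" "q \<in> homs \<Sigma> P Z"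
    using pb by (simp_all add: pullback_square_def)
  have comm: "\<And>s x. x \<in> car P s \<Longrightarrow> f s (p s x) = g s (q s x)"
    using pb f' g' P by (simp add: pullback_square_def comp_eq_comp_iff)
  obtain P' p' q' where P': "P' \<in> \<M>" "p' \<in> homs \<Sigma> P' X" "q' \<in> homs \<Sigma> P' Z"
    and comm': "\<And>s x. x \<in> car P' s \<Longrightarrow> f s (p' s x) = g s (q' s x)"
    and inj': "\<And>s. inj_on (p' s) (car P' s)"
    and im': "\<And>s. f s ` car X s \<inter> g s ` car Z s \<subseteq> (\<lambda>x. f s (p' s x)) ` car P' s"
    by (rule pullback_exists[OF f g]) (assumption | rule that)+
  have pb': "pullback_square C (X, f, Y) (Z, g, Y) (P', p', X) (P', q', Z)"
    using f g P' comm' inj' im' by (rule pullbackI)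
  obtain u where u: "u \<in> homs \<Sigma> P' P" and pu: "\<And>s x. x \<in> car P' s \<Longrightarrow> p s (u s x) = p' s x"
    and qu: "\<And>s x. x \<in> car P' s \<Longrightarrow> q s (u s x) = q' s x"
    using pullback_factor[OF f g pb P'] comm' by metis
  obtain v where v: "v \<in> homs \<Sigma> P P'" and pv: "\<And>s x. x \<in> car P s \<Longrightarrow> p' s (v s x) = p s x"
    and qv: "\<And>s x. x \<in> car P s \<Longrightarrow> q' s (v s x) = q s x"
    using pullback_factor[OF f g pb' P] comm by metis
  let ?uv = "\<lambda>s. compose (car P s) (u s) (v s)"
  have "?uv = (\<lambda>s. restrict id (car P s))"
    using comp_homs[OF P(1) v u] id_homs[OF P(1)]
    by (rule pullback_unique[OF f g pb P(1)])
      (use homs_car[OF v] in \<open>simp_all add: compose_eq pu qu pv qv\<close>)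
  then have uv_id: "u s (v s x) = x" if "x \<in> car P s" for s x
    using that comp_eq_id_iff[OF P(1) v u] by simp
  show "inj_on (p s) (car P s)"
  proof (rule inj_onI)
    fix x y assume xy: "x \<in> car P s" "y \<in> car P s" "p s x = p s y"
    then have "v s x = v s y"
      using inj_onD[OF inj'[of s], of "v s x" "v s y"] pv homs_car[OF v] by simp
    then show "x = y" using uv_id xy by metis
  qed
  have "(\<lambda>x. f s (p' s x)) ` car P' s = (\<lambda>x. f s (p s x)) ` u s ` car P' s"
    unfolding image_image using pu by (auto intro!: image_cong)
  also have "\<dots> \<subseteq> (\<lambda>x. f s (p s x)) ` car P s"
    using homs_car[OF u] by (intro image_mono) blast
  finally show "f s ` car X s \<inter> g s ` car Z s \<subseteq> (\<lambda>x. f s (p s x)) ` car P s"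
    using im' by blast
qed

section \<open>Pushouts of surjections\<close>

text \<open>Here \<open>P\<close> is the quotient of \<open>Y\<close> by the join of the two
  kernels. Again the conditions do not mention \<open>\<M>\<close> beyond membership of the objects,
  and \<open>pushoutD\<close> shows them to be necessary.\<close>

lemma pushoutI:
  assumes f: "(Y, f, X) \<in> surjs" and g: "(Y, g, Z) \<in> surjs"
    and P: "P \<in> \<M>" "p \<in> homs \<Sigma> X P" "q \<in> homs \<Sigma> Z P"
    and comm: "\<And>s x. x \<in> car Y s \<Longrightarrow> p s (f s x) = q s (g s x)"
    and surj: "\<And>s. p s ` car X s = car P s"
    and ker: "\<And>s x y. x \<in> car Y s \<Longrightarrow> y \<in> car Y s \<Longrightarrow> p s (f s x) = p s (f s y) \<Longrightarrow>
      ((s, x), (s, y)) \<in> (kernel_pairs Y f \<union> kernel_pairs Y g)\<^sup>+"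
  shows "pushout_square C (Y, f, X) (Y, g, Z) (X, p, P) (Z, q, P)"
  unfolding pushout_square_def
proof (intro conjI ballI impI)
  have f': "X \<in> \<M>" "Y \<in> \<M>" "f \<in> homs \<Sigma> Y X" "\<And>s. f s ` car Y s = car X s"
    and g': "Z \<in> \<M>" "g \<in> homs \<Sigma> Y Z" "\<And>s. g s ` car Y s = car Z s"
    using f g by (simp_all add: surjs_iff)
  show "(Y, f, X) \<in> Arr C" "(Y, g, Z) \<in> Arr C" "(X, p, P) \<in> Arr C" "(Z, q, P) \<in> Arr C"
    using f' g' P by simp_all
  show "Comp C (X, p, P) (Y, f, X) = Comp C (Z, q, P) (Y, g, Z)"
    using f' g' P comm by (simp add: comp_eq_comp_iff)
  fix a b
  assume "a \<in> Arr C" "b \<in> Arr C" and "Dom C a = Cod C (Y, f, X) \<and>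
    Dom C b = Cod C (Y, g, Z) \<and> Cod C a = Cod C b \<and> Comp C a (Y, f, X) = Comp C b (Y, g, Z)"
  then obtain W a' b' where a: "a = (X, a', W)" "W \<in> \<M>" "a' \<in> homs \<Sigma> X W"
    and b: "b = (Z, b', W)" "b' \<in> homs \<Sigma> Z W"
    and ab: "\<And>s x. x \<in> car Y s \<Longrightarrow> a' s (f s x) = b' s (g s x)"
    using f' g' by (auto elim!: full_subcat_ArrE simp: comp_eq_comp_iff)
  have ker': "a' s x = a' s y" if xy: "x \<in> car X s" "y \<in> car X s" "p s x = p s y" for s x y
  proof -
    obtain x' y' where *: "x' \<in> car Y s" "x = f s x'" "y' \<in> car Y s" "y = f s y'"
      using xy f'(4)[of s] by blast
    \<comment> \<open>Along a pair in the kernel of \<open>f\<close> the value of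
      \<open>a' f\<close> is unchanged; along a pair in the kernel of \<open>g\<close> so is that of
      \<open>b' g\<close>, and the two composites agree.\<close>
    have "a' (fst v) (f (fst v) (snd v)) = a' (fst w) (f (fst w) (snd w))"
      if "(v, w) \<in> (kernel_pairs Y f \<union> kernel_pairs Y g)\<^sup>+" for v w
      using that
    proof (induction rule: trancl_induct)
      case (base w)
      then show ?case using ab by (fastforce simp: kernel_pairs_def)
    next
      case (step w w')
      then show ?case using ab by (fastforce simp: kernel_pairs_def)
    qed
    then show ?thesis using ker[OF *(1,3)] xy(3) * by fastforce
  qed
  obtain u where u: "u \<in> homs \<Sigma> P W" "\<And>s x. x \<in> car X s \<Longrightarrow> u s (p s x) = a' s x"
    using homs_factor_surj[OF struct[OF f'(1)] struct[OF P(1)] P(2) _ a(3) ker'] surj by (metis order_refl)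
  have uq: "u s (q s z) = b' s z" if z: "z \<in> car Z s" for s z
  proof -
    obtain x where x: "x \<in> car Y s" "z = g s x" using z g'(3)[of s] by blast
    then show ?thesis using comm[OF x(1)] u(2)[OF homs_car[OF f'(3) x(1)]] ab[OF x(1)] by simp
  qed
  show "\<exists>!u. u \<in> Hom C (Cod C (X, p, P)) (Cod C a) \<and> Comp C u (X, p, P) = a \<and> Comp C u (Z, q, P) = b"
  proof (rule ex1I[of _ "(P, u, W)"])
    show "(P, u, W) \<in> Hom C (Cod C (X, p, P)) (Cod C a) \<and>
        Comp C (P, u, W) (X, p, P) = a \<and> Comp C (P, u, W) (Z, q, P) = b"
      using u uq a b P f' g' by (simp add: comp_eq_iff)
    fix v assume "v \<in> Hom C (Cod C (X, p, P)) (Cod C a) \<and> Comp C v (X, p, P) = a \<and> Comp C v (Z, q, P) = b"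
    then obtain v' where v: "v = (P, v', W)" "v' \<in> homs \<Sigma> P W" "\<And>s x. x \<in> car X s \<Longrightarrow> v' s (p s x) = a' s x"
      using a P f' by (auto simp: comp_eq_iff elim!: full_subcat_HomE)
    have "v' = u"
      using v(2) u(1)
    proof (rule homs_ext)
      fix s y assume "y \<in> car P s"
      then obtain x where "x \<in> car X s" "y = p s x" using surj[of s] by blast
      then show "v' s y = u s y" using v(3) u(2) by simp
    qed
    then show "v = (P, u, W)" using v(1) by simp
  qed
qed simp_all

text \<open>The quotient map \<open>k\<close> identifies whatever \<open>f\<close> or
  \<open>g\<close> identifies, so it factors through both; the factors are the two injections of the
  pushout.\<close>

lemma pushout_exists:
  assumes f: "(Y, f, X) \<in> surjs" and g: "(Y, g, Z) \<in> surjs"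
  obtains P p q where "P \<in> \<M>" "p \<in> homs \<Sigma> X P" "q \<in> homs \<Sigma> Z P"
    "\<And>s x. x \<in> car Y s \<Longrightarrow> p s (f s x) = q s (g s x)" "\<And>s. p s ` car X s = car P s"
    "\<And>s x y. x \<in> car Y s \<Longrightarrow> y \<in> car Y s \<Longrightarrow> p s (f s x) = p s (f s y) \<Longrightarrow>
      ((s, x), (s, y)) \<in> (kernel_pairs Y f \<union> kernel_pairs Y g)\<^sup>+"
proof -
  have f': "X \<in> structures \<W> \<Sigma>" "Y \<in> structures \<W> \<Sigma>" "f \<in> homs \<Sigma> Y X" "\<And>s. f s ` car Y s = car X s"
    and g': "Z \<in> structures \<W> \<Sigma>" "g \<in> homs \<Sigma> Y Z" "\<And>s. g s ` car Y s = car Z s"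
    using f g by (auto simp: surjs_iff)
  obtain P k where P: "P \<in> structures \<W> \<Sigma>" "k \<in> homs \<Sigma> Y P" "\<And>s. k s ` car Y s = car P s"
    and k: "\<And>s x y. x \<in> car Y s \<Longrightarrow> y \<in> car Y s \<Longrightarrow>
      k s x = k s y \<longleftrightarrow> ((s, x), (s, y)) \<in> (kernel_pairs Y f \<union> kernel_pairs Y g)\<^sup>+"
    by (rule kernel_join_exists[OF universe f'(2,3) g'(2)]) (assumption | rule that)+
  have kf: "k s x = k s y" if "x \<in> car Y s" "y \<in> car Y s" "f s x = f s y" for s x y
    using that k by (auto simp: kernel_pairs_def)
  have kg: "k s x = k s y" if "x \<in> car Y s" "y \<in> car Y s" "g s x = g s y" for s x y
    using that k by (auto simp: kernel_pairs_def)
  obtain p where p: "p \<in> homs \<Sigma> X P" "\<And>s x. x \<in> car Y s \<Longrightarrow> p s (f s x) = k s x"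
    using homs_factor_surj[OF f'(2,1,3) _ P(2) kf] f'(4) by (metis order_refl)
  obtain q where q: "q \<in> homs \<Sigma> Z P" "\<And>s x. x \<in> car Y s \<Longrightarrow> q s (g s x) = k s x"
    using homs_factor_surj[OF f'(2) g'(1,2) _ P(2) kg] g'(3) by (metis order_refl)
  show thesis
  proof (rule that[OF _ p(1) q(1)])
    show "P \<in> \<M>" using quotient_closed[OF _ P(1-3)] f by (simp add: surjs_iff)
    show "p s (f s x) = q s (g s x)" if "x \<in> car Y s" for s x
      using p(2)[OF that] q(2)[OF that] by simp
    have "p s ` f s ` car Y s = k s ` car Y s" for s
      unfolding image_image using p(2) by (auto intro!: image_cong)
    then show "p s ` car X s = car P s" for s
      using P(3) f'(4) by simp
    show "((s, x), (s, y)) \<in> (kernel_pairs Y f \<union> kernel_pairs Y g)\<^sup>+"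
      if "x \<in> car Y s" "y \<in> car Y s" "p s (f s x) = p s (f s y)" for s x y
      using that p(2) k by simp
  qed
qed

lemma pushout_factor:
  assumes f: "(Y, f, X) \<in> surjs" and g: "(Y, g, Z) \<in> surjs"
    and po: "pushout_square C (Y, f, X) (Y, g, Z) (X, p, P) (Z, q, P)"
    and W: "W \<in> \<M>" "a \<in> homs \<Sigma> X W" "b \<in> homs \<Sigma> Z W"
    and ab: "\<And>s x. x \<in> car Y s \<Longrightarrow> a s (f s x) = b s (g s x)"
  obtains u where "u \<in> homs \<Sigma> P W" "\<And>s x. x \<in> car X s \<Longrightarrow> u s (p s x) = a s x"
    "\<And>s x. x \<in> car Z s \<Longrightarrow> u s (q s x) = b s x"
proof -
  have f': "X \<in> \<M>" "Y \<in> \<M>" "f \<in> homs \<Sigma> Y X" and g': "Z \<in> \<M>" "g \<in> homs \<Sigma> Y Z"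
    using f g by (simp_all add: surjs_iff)
  have P: "P \<in> \<M>" "p \<in> homs \<Sigma> X P" "q \<in> homs \<Sigma> Z P"
    using po by (simp_all add: pushout_square_def)
  have "\<exists>!u. u \<in> Hom C P W \<and> Comp C u (X, p, P) = (X, a, W) \<and> Comp C u (Z, q, P) = (Z, b, W)"
    using po W ab f' g' unfolding pushout_square_def
    by (elim conjE) (drule bspec[of _ _ "(X, a, W)"], simp, drule bspec[of _ _ "(Z, b, W)"], simp,
      simp add: comp_eq_comp_iff)
  then obtain k where k: "k \<in> Hom C P W" "Comp C k (X, p, P) = (X, a, W)" "Comp C k (Z, q, P) = (Z, b, W)"
    by (elim ex1E conjE)
  obtain u where u: "k = (P, u, W)" "u \<in> homs \<Sigma> P W" using k(1) by (rule full_subcat_HomE)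
  show thesis
    using that[OF u(2)] k(2,3) u W P f' g' by (simp add: comp_eq_iff)
qed

lemma pushout_unique:
  assumes f: "(Y, f, X) \<in> surjs" and g: "(Y, g, Z) \<in> surjs"
    and po: "pushout_square C (Y, f, X) (Y, g, Z) (X, p, P) (Z, q, P)"
    and W: "W \<in> \<M>" and uv: "u \<in> homs \<Sigma> P W" "v \<in> homs \<Sigma> P W"
    and eq: "\<And>s x. x \<in> car X s \<Longrightarrow> u s (p s x) = v s (p s x)"
      "\<And>s x. x \<in> car Z s \<Longrightarrow> u s (q s x) = v s (q s x)"
  shows "u = v"
proof -
  have f': "X \<in> \<M>" "Y \<in> \<M>" "f \<in> homs \<Sigma> Y X" and g': "Z \<in> \<M>" "g \<in> homs \<Sigma> Y Z"
    using f g by (simp_all add: surjs_iff)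
  have P: "P \<in> \<M>" "p \<in> homs \<Sigma> X P" "q \<in> homs \<Sigma> Z P"
    using po by (simp_all add: pushout_square_def)
  have comm: "p s (f s x) = q s (g s x)" if "x \<in> car Y s" for s x
    using po f' g' P that by (simp add: pushout_square_def comp_eq_comp_iff)
  let ?a = "\<lambda>s. compose (car X s) (u s) (p s)" and ?b = "\<lambda>s. compose (car Z s) (u s) (q s)"
  have ab: "?a \<in> homs \<Sigma> X W" "?b \<in> homs \<Sigma> Z W" using f'(1) g'(1) uv(1) P by (blast intro: comp_homs)+
  have "?a s (f s x) = ?b s (g s x)" if "x \<in> car Y s" for s x
    using comm[OF that] homs_car[OF f'(3) that] homs_car[OF g'(2) that] by (simp add: compose_eq)
  then have ex1: "\<exists>!k. k \<in> Hom C P W \<and> Comp C k (X, p, P) = (X, ?a, W) \<and> Comp C k (Z, q, P) = (Z, ?b, W)"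
    using po W ab f' g' unfolding pushout_square_def
    by (elim conjE) (drule bspec[of _ _ "(X, ?a, W)"], simp, drule bspec[of _ _ "(Z, ?b, W)"], simp,
      simp add: comp_eq_comp_iff)
  have "(\<lambda>s. compose (car X s) (v s) (p s)) = ?a" "(\<lambda>s. compose (car Z s) (v s) (q s)) = ?b"
    using comp_eq_comp_iff[OF f'(1) P(2) uv(2) P(2) uv(1)] comp_eq_comp_iff[OF g'(1) P(3) uv(2) P(3) uv(1)] eq
    by simp_all
  then have "(P, u, W) = (P, v, W)"
    by (intro ex1_eq[OF ex1]) (simp_all add: W P uv)
  then show ?thesis by simp
qed

text \<open>In the comparison with the explicit pushout, \<open>v u = id\<close> on \<open>P\<close>
  turns a preimage of \<open>u y\<close> under \<open>p'\<close> into one of \<open>y\<close> under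
  \<open>p\<close>. Applying \<open>u\<close> to an equation between values of \<open>p\<close>
  gives one between values of \<open>p'\<close>, whose kernel is known.\<close>

lemma pushoutD:
  assumes f: "(Y, f, X) \<in> surjs" and g: "(Y, g, Z) \<in> surjs"
    and po: "pushout_square C (Y, f, X) (Y, g, Z) (X, p, P) (Z, q, P)"
  shows "p s ` car X s = car P s"
    and "x \<in> car Y s \<Longrightarrow> y \<in> car Y s \<Longrightarrow> p s (f s x) = p s (f s y) \<Longrightarrow>
      ((s, x), (s, y)) \<in> (kernel_pairs Y f \<union> kernel_pairs Y g)\<^sup>+"
proof -
  have f': "X \<in> \<M>" "Y \<in> \<M>" "f \<in> homs \<Sigma> Y X" and g': "Z \<in> \<M>" "g \<in> homs \<Sigma> Y Z"
    using f g by (simp_all add: surjs_iff)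
  have P: "P \<in> \<M>" "p \<in> homs \<Sigma> X P" "q \<in> homs \<Sigma> Z P"
    using po by (simp_all add: pushout_square_def)
  have comm: "\<And>s x. x \<in> car Y s \<Longrightarrow> p s (f s x) = q s (g s x)"
    using po f' g' P by (simp add: pushout_square_def comp_eq_comp_iff)
  obtain P' p' q' where P': "P' \<in> \<M>" "p' \<in> homs \<Sigma> X P'" "q' \<in> homs \<Sigma> Z P'"
    and comm': "\<And>s x. x \<in> car Y s \<Longrightarrow> p' s (f s x) = q' s (g s x)"
    and surj': "\<And>s. p' s ` car X s = car P' s"
    and ker': "\<And>s x y. x \<in> car Y s \<Longrightarrow> y \<in> car Y s \<Longrightarrow> p' s (f s x) = p' s (f s y) \<Longrightarrow>
      ((s, x), (s, y)) \<in> (kernel_pairs Y f \<union> kernel_pairs Y g)\<^sup>+"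
    by (rule pushout_exists[OF f g]) (assumption | rule that)+
  have po': "pushout_square C (Y, f, X) (Y, g, Z) (X, p', P') (Z, q', P')"
    using f g P' comm' surj' ker' by (rule pushoutI)
  obtain u where u: "u \<in> homs \<Sigma> P P'" and up: "\<And>s x. x \<in> car X s \<Longrightarrow> u s (p s x) = p' s x"
    and uq: "\<And>s x. x \<in> car Z s \<Longrightarrow> u s (q s x) = q' s x"
    using pushout_factor[OF f g po P'] comm' by metis
  obtain v where v: "v \<in> homs \<Sigma> P' P" and vp: "\<And>s x. x \<in> car X s \<Longrightarrow> v s (p' s x) = p s x"
    and vq: "\<And>s x. x \<in> car Z s \<Longrightarrow> v s (q' s x) = q s x"
    using pushout_factor[OF f g po' P] comm by metis
  let ?vu = "\<lambda>s. compose (car P s) (v s) (u s)"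
  have "?vu = (\<lambda>s. restrict id (car P s))"
    using comp_homs[OF P(1) u v] id_homs[OF P(1)]
    by (rule pushout_unique[OF f g po P(1)])
      (use homs_car[OF P(2)] homs_car[OF P(3)] in \<open>simp_all add: compose_eq up uq vp vq\<close>)
  then have vu_id: "v s (u s x) = x" if "x \<in> car P s" for s x
    using that comp_eq_id_iff[OF P(1) u v] by simp
  show "p s ` car X s = car P s"
  proof
    show "p s ` car X s \<subseteq> car P s" using homs_car[OF P(2)] by blast
    show "car P s \<subseteq> p s ` car X s"
    proof
      fix y assume y: "y \<in> car P s"
      then have "u s y \<in> p' s ` car X s" using homs_car[OF u] surj'[of s] by simp
      then obtain x where "x \<in> car X s" "u s y = p' s x" by blast
      then show "y \<in> p s ` car X s" using vu_id[OF y] vp[of x s] by (intro image_eqI[of _ _ x]) simp_all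
    qed
  qed
  show "((s, x), (s, y)) \<in> (kernel_pairs Y f \<union> kernel_pairs Y g)\<^sup>+"
    if "x \<in> car Y s" "y \<in> car Y s" "p s (f s x) = p s (f s y)"
    using ker' that up homs_car[OF f'(3)] by metis
qed

lemma transfer_category: "transfer_category \<W> C surjs injs"
  unfolding transfer_category_def
proof (intro conjI ballI impI category proper_factorization_system)
  fix f g assume fg: "f \<in> injs" "g \<in> injs" "Cod C f = Cod C g"
  obtain X Y f' where f: "f = (X, f', Y)" using fg(1) by (rule injsE)
  obtain Z g' where g: "g = (Z, g', Y)" using fg(2,3) f by (auto elim: injsE)
  note fg' = fg(1,2)[unfolded f g]
  obtain P p q where "P \<in> \<M>" "p \<in> homs \<Sigma> P X" "q \<in> homs \<Sigma> P Z"
    "\<And>s x. x \<in> car P s \<Longrightarrow> f' s (p s x) = g' s (q s x)" "\<And>s. inj_on (p s) (car P s)"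
    "\<And>s. f' s ` car X s \<inter> g' s ` car Z s \<subseteq> (\<lambda>x. f' s (p s x)) ` car P s"
    by (rule pullback_exists[OF fg']) (assumption | rule that)+
  then have "pullback_square C f g (P, p, X) (P, q, Z)"
    unfolding f g by (rule pullbackI[OF fg'])
  then show "\<exists>p q. pullback_square C f g p q" by blast
next
  fix f g assume fg: "f \<in> surjs" "g \<in> surjs" "Dom C f = Dom C g"
  obtain Y X f' where f: "f = (Y, f', X)" using fg(1) by (rule surjsE)
  obtain Z g' where g: "g = (Y, g', Z)" using fg(2,3) f by (auto elim: surjsE)
  note fg' = fg(1,2)[unfolded f g]
  obtain P p q where "P \<in> \<M>" "p \<in> homs \<Sigma> X P" "q \<in> homs \<Sigma> Z P"
    "\<And>s x. x \<in> car Y s \<Longrightarrow> p s (f' s x) = q s (g' s x)" "\<And>s. p s ` car X s = car P s"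
    "\<And>s x y. x \<in> car Y s \<Longrightarrow> y \<in> car Y s \<Longrightarrow> p s (f' s x) = p s (f' s y) \<Longrightarrow>
      ((s, x), (s, y)) \<in> (kernel_pairs Y f' \<union> kernel_pairs Y g')\<^sup>+"
    by (rule pushout_exists[OF fg']) (assumption | rule that)+
  then have "pushout_square C f g (X, p, P) (Z, q, P)"
    unfolding f g by (rule pushoutI[OF fg'])
  then show "\<exists>p q. pushout_square C f g p q" by blast
qed

end

section \<open>The inclusion of a class of models into a larger one\<close>

lemma full_inclusion:
  "\<M> \<subseteq> \<M>' \<Longrightarrow> full (full_subcat \<Sigma> \<M>) (full_subcat \<Sigma> \<M>') (\<lambda>X. X) (\<lambda>f. f)"
  by (auto simp: full_def elim!: full_subcat_HomE)

text \<open>A square of the smaller category is reduced to its conditions on elements by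
  \<open>M.pullbackD\<close> or \<open>M.pushoutD\<close>, and these give its universal property in
  the larger category by \<open>N.pullbackI\<close> or \<open>N.pushoutI\<close>.\<close>

lemma transfer_inclusion:
  assumes "model_class \<W> \<Sigma> \<M>" "model_class \<W> \<Sigma> \<M>'" and sub: "\<M> \<subseteq> \<M>'"
  shows "transfer_functor \<W>
    (full_subcat \<Sigma> \<M>) (sortwise_surj \<Sigma> (full_subcat \<Sigma> \<M>)) (sortwise_inj \<Sigma> (full_subcat \<Sigma> \<M>))
    (full_subcat \<Sigma> \<M>') (sortwise_surj \<Sigma> (full_subcat \<Sigma> \<M>')) (sortwise_inj \<Sigma> (full_subcat \<Sigma> \<M>'))
    (\<lambda>X. X) (\<lambda>f. f)"
proof -
  interpret M: model_class \<W> \<Sigma> \<M> by fact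
  interpret N: model_class \<W> \<Sigma> \<M>' by fact
  have surjs: "M.surjs \<subseteq> N.surjs" and injs: "M.injs \<subseteq> N.injs"
    using sub by (auto simp: sortwise_surj_def sortwise_inj_def)
  show ?thesis
    unfolding transfer_functor_def
  proof (intro conjI ballI impI allI M.transfer_category N.transfer_category)
    show "is_functor M.C N.C (\<lambda>X. X) (\<lambda>f. f)"
      using sub by (auto simp: is_functor_def elim!: full_subcat_ArrE)
    show "conservative M.C N.C (\<lambda>f. f)"
      by (auto simp: conservative_def M.iso_arr_iff N.iso_arr_iff elim!: full_subcat_ArrE)
    show "(\<lambda>f. f) ` M.surjs \<subseteq> N.surjs" "(\<lambda>f. f) ` M.injs \<subseteq> N.injs"
      using surjs injs by simp_all
    fix f g p q
    {
      assume fg: "f \<in> M.injs" "g \<in> M.injs" and pb: "pullback_square M.C f g p q"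
      obtain X Y f' where f: "f = (X, f', Y)" using fg(1) by (rule M.injsE)
      obtain Z g' where g: "g = (Z, g', Y)" using fg(2) pb f by (auto simp: pullback_square_def elim!: M.injsE)
      obtain P p' q' where p: "p = (P, p', X)" and q: "q = (P, q', Z)"
        using pb f g by (auto simp: pullback_square_def elim!: full_subcat_ArrE)
      note pb = pb[unfolded f g p q] and fg = fg[unfolded f g]
      have f': "X \<in> \<M>" "f' \<in> homs \<Sigma> X Y" "g' \<in> homs \<Sigma> Z Y" using fg by (simp_all add: M.injs_iff)
      have P: "P \<in> \<M>" "p' \<in> homs \<Sigma> P X" "q' \<in> homs \<Sigma> P Z" using pb by (simp_all add: pullback_square_def)
      show "pullback_square N.C f g p q"
        unfolding f g p q
      proof (rule N.pullbackI)
        show "f' s (p' s x) = g' s (q' s x)" if "x \<in> car P s" for s x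
          using pb P f' that by (simp add: pullback_square_def M.comp_eq_comp_iff)
      qed (use fg injs P sub M.pullbackD[OF fg pb] in \<open>(assumption | blast)\<close>)+
    next
      assume fg: "f \<in> M.surjs" "g \<in> M.surjs" and po: "pushout_square M.C f g p q"
      obtain Y X f' where f: "f = (Y, f', X)" using fg(1) by (rule M.surjsE)
      obtain Z g' where g: "g = (Y, g', Z)" using fg(2) po f by (auto simp: pushout_square_def elim!: M.surjsE)
      obtain P p' q' where p: "p = (X, p', P)" and q: "q = (Z, q', P)"
        using po f g by (auto simp: pushout_square_def elim!: full_subcat_ArrE)
      note po = po[unfolded f g p q] and fg = fg[unfolded f g]
      have f': "Y \<in> \<M>" "f' \<in> homs \<Sigma> Y X" "g' \<in> homs \<Sigma> Y Z" using fg by (simp_all add: M.surjs_iff)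
      have P: "P \<in> \<M>" "p' \<in> homs \<Sigma> X P" "q' \<in> homs \<Sigma> Z P" using po by (simp_all add: pushout_square_def)
      show "pushout_square N.C f g p q"
        unfolding f g p q
      proof (rule N.pushoutI)
        show "p' s (f' s x) = q' s (g' s x)" if "x \<in> car Y s" for s x
          using po P f' that by (simp add: pushout_square_def M.comp_eq_comp_iff)
      qed (use fg surjs P sub M.pushoutD[OF fg po] in \<open>(assumption | blast)\<close>)+
    }
  qed
qed

section \<open>The form of subspaces\<close>

text \<open>The operations of \<open>M\<close> do not enter, only its points. The intersection with
  \<open>Fpow (pts M)\<close> in \<open>pull\<close> is needed because
  \<open>fpush (on_pts h)\<close> is a total function, defined also on sets that are not vectors
  over \<open>M\<close>.\<close>

definition vector_form ::
  "(('s, 'f, 'u) struct, ('s, 'f, 'u) arrow, ('s \<times> 'u) set set) form" where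
  "vector_form = \<lparr>Fib = (\<lambda>M. subspaces (pts M)),
     push = (\<lambda>(M, h, N) S. fpush (on_pts h) ` S),
     pull = (\<lambda>(M, h, N) T. {v \<in> Fpow (pts M). fpush (on_pts h) v \<in> T})\<rparr>"

lemma vector_form_sel [simp]:
  "Fib vector_form M = subspaces (pts M)"
  "push vector_form (M, h, N) S = fpush (on_pts h) ` S"
  "pull vector_form (M, h, N) T = {v \<in> Fpow (pts M). fpush (on_pts h) v \<in> T}"
  by (simp_all add: vector_form_def)

lemma fpush_total_comp:
  assumes "h \<in> homs \<Sigma> M N" "v \<in> Fpow (pts M)"
  shows "fpush (on_pts (\<lambda>s. compose (car M s) (k s) (h s))) v = fpush (on_pts k) (fpush (on_pts h) v)"
proof -
  have "fpush (on_pts (\<lambda>s. compose (car M s) (k s) (h s))) v = fpush (on_pts k \<circ> on_pts h) v"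
    using assms(2) by (intro fpush_cong) (auto simp: Fpow_def on_pts_def pts_def compose_eq)
  then show ?thesis using assms(2) by (simp add: fpush_comp Fpow_def)
qed

lemma fpush_total_id:
  "v \<in> Fpow (pts M) \<Longrightarrow> fpush (on_pts (\<lambda>s. restrict id (car M s))) v = v"
  by (rule fpush_id) (auto simp: Fpow_def on_pts_def pts_def)

lemma on_pts_Fpow:
  "h \<in> homs \<Sigma> M N \<Longrightarrow> v \<in> Fpow (pts M) \<Longrightarrow> fpush (on_pts h) v \<in> Fpow (pts N)"
  by (rule fpush_Fpow[OF _ on_pts_image_subset])

text \<open>Singletons recover a set from its finite subsets, so image clusters are ordered as the
  images themselves.\<close>

lemma Fpow_subset_iff: "Fpow A \<subseteq> Fpow B \<longleftrightarrow> A \<subseteq> B"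
  unfolding Fpow_def by blast

lemma on_pts_image_subset_iff:
  "on_pts h ` pts M \<subseteq> on_pts k ` pts N \<longleftrightarrow> (\<forall>s. h s ` car M s \<subseteq> k s ` car N s)"
  by (auto simp: on_pts_def pts_def image_iff subset_iff)

section \<open>Congruences as subspaces\<close>

definition zeros :: "('s \<Rightarrow> 'u \<Rightarrow> 'u) \<Rightarrow> ('s, 'f, 'u) struct \<Rightarrow> ('s \<times> 'u) set set" where
  "zeros h M = {v \<in> Fpow (pts M). fpush (on_pts h) v = {}}"

text \<open>\<open>{(s, x)} \<triangle> {(s, y)}\<close> is the difference of two basis vectors,
  zero if \<open>x = y\<close>. Testing these vectors recovers the congruence from its
  subspace.\<close>

lemma pair_mem_zeros_iff:
  assumes "x \<in> car M s" "y \<in> car M s"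
  shows "{(s, x)} \<triangle> {(s, y)} \<in> zeros h M \<longleftrightarrow> h s x = h s y"
proof -
  have "{(s, x)} \<triangle> {(s, y)} \<in> Fpow (pts M)"
    using assms by (auto simp: Fpow_def)
  moreover have "fpush (on_pts h) ({(s, x)} \<triangle> {(s, y)}) = {(s, h s x)} \<triangle> {(s, h s y)}"
    by (simp add: fpush_sdiff)
  moreover have "{(s, h s x)} \<triangle> {(s, h s y)} = {} \<longleftrightarrow> h s x = h s y"
    by (auto simp: set_eq_iff)
  ultimately show ?thesis by (simp add: zeros_def)
qed

lemma zeros_subspace: "subspace_of (pts M) (zeros h M)"
  using subspace_of_vimage[OF subspace_of_zero, of "pts M" "on_pts h"] by (simp add: zeros_def)

text \<open>The kernel of the linear map is spanned by the differences of identified points, by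
  \<open>fpush_kernel_induct\<close>; a subspace containing these contains it all.\<close>

lemma zeros_subsetI:
  assumes S: "subspace_of (pts M) S"
    and pairs: "\<And>s x y. x \<in> car M s \<Longrightarrow> y \<in> car M s \<Longrightarrow> h s x = h s y \<Longrightarrow> {(s, x)} \<triangle> {(s, y)} \<in> S"
  shows "zeros h M \<subseteq> S"
proof
  fix v assume "v \<in> zeros h M"
  then have "finite v" "fpush (on_pts h) v = {}" "v \<subseteq> pts M" by (auto simp: zeros_def Fpow_def)
  then show "v \<in> S"
  proof (rule fpush_kernel_induct)
    show "{} \<in> S" using S by (rule subspace_ofD)
    fix p q w assume "p \<in> pts M" "q \<in> pts M" "on_pts h p = on_pts h q" and w: "w \<in> S"
    \<comment> \<open>Equality of the values of \<open>on_pts h\<close> includes equality of the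
      sorts, so \<open>p\<close> and \<open>q\<close> form a pair as in
      \<open>pairs\<close>.\<close>
    then have "{p} \<triangle> {q} \<in> S" using pairs by (cases p, cases q) simp
    then show "{p} \<triangle> {q} \<triangle> w \<in> S" using S w by (blast intro: subspace_ofD(2))
  qed
qed

text \<open>Passing from congruences to subspaces preserves and reflects inclusion: differences of
  points test one direction and span in the other. Factoring through a quotient is decided by
  this.\<close>

lemma zeros_mono_iff:
  "zeros h M \<subseteq> zeros g M \<longleftrightarrow>
    (\<forall>s. \<forall>x\<in>car M s. \<forall>y\<in>car M s. h s x = h s y \<longrightarrow> g s x = g s y)"
proof
  assume sub: "zeros h M \<subseteq> zeros g M"
  show "\<forall>s. \<forall>x\<in>car M s. \<forall>y\<in>car M s. h s x = h s y \<longrightarrow> g s x = g s y"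
  proof (intro allI ballI impI)
    fix s x y assume xy: "x \<in> car M s" "y \<in> car M s" and "h s x = h s y"
    then have "{(s, x)} \<triangle> {(s, y)} \<in> zeros h M" by (simp only: pair_mem_zeros_iff)
    then have "{(s, x)} \<triangle> {(s, y)} \<in> zeros g M" using sub by (rule rev_subsetD)
    then show "g s x = g s y" using xy by (simp only: pair_mem_zeros_iff)
  qed
next
  assume le: "\<forall>s. \<forall>x\<in>car M s. \<forall>y\<in>car M s. h s x = h s y \<longrightarrow> g s x = g s y"
  show "zeros h M \<subseteq> zeros g M"
  proof (rule zeros_subsetI[OF zeros_subspace])
    fix s x y assume xy: "x \<in> car M s" "y \<in> car M s" and "h s x = h s y"
    then have "g s x = g s y" using le by blast
    then show "{(s, x)} \<triangle> {(s, y)} \<in> zeros g M" using xy by (simp only: pair_mem_zeros_iff)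
  qed
qed

text \<open>A chain in the two kernels from \<open>v\<close> to \<open>w\<close> writes
  \<open>{v} \<triangle> {w}\<close> as a telescoping sum of vectors in \<open>zeros f M\<close> and
  \<open>zeros g M\<close>, so the join of congruences corresponds to the sum of subspaces.\<close>

lemma zeros_join:
  assumes q: "\<And>s x y. x \<in> car M s \<Longrightarrow> y \<in> car M s \<Longrightarrow>
      q s x = q s y \<longleftrightarrow> ((s, x), (s, y)) \<in> (kernel_pairs M f \<union> kernel_pairs M g)\<^sup>+"
  shows "zeros q M = zeros f M \<squnion>\<^bsub>subspaces (pts M)\<^esub> zeros g M"
proof
  note S = zeros_subspace[of M f] zeros_subspace[of M g]
  have J: "subspace_of (pts M) (zeros f M \<squnion>\<^bsub>subspaces (pts M)\<^esub> zeros g M)"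
    unfolding subspaces_join[OF S] by (rule subspace_of_sum[OF S])
  have fg: "zeros f M \<subseteq> zeros q M" "zeros g M \<subseteq> zeros q M"
    unfolding zeros_mono_iff using q by (auto simp: kernel_pairs_def)
  show "zeros f M \<squnion>\<^bsub>subspaces (pts M)\<^esub> zeros g M \<subseteq> zeros q M"
    unfolding subspaces_join[OF S] using fg subspace_ofD(2)[OF zeros_subspace[of M q]] by blast
  have 0: "{} \<in> zeros f M" "{} \<in> zeros g M" using S by (auto intro: subspace_ofD)
  have left: "v \<in> zeros f M \<squnion>\<^bsub>subspaces (pts M)\<^esub> zeros g M" if "v \<in> zeros f M" for v
    unfolding subspaces_join[OF S] using that 0(2)
    by (intro CollectI exI[of _ v] exI[of _ "{}"]) simp
  have right: "v \<in> zeros f M \<squnion>\<^bsub>subspaces (pts M)\<^esub> zeros g M" if "v \<in> zeros g M" for v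
    unfolding subspaces_join[OF S] using that 0(1)
    by (intro CollectI exI[of _ "{}"] exI[of _ v]) simp
  have link: "{v} \<triangle> {w} \<in> zeros f M \<squnion>\<^bsub>subspaces (pts M)\<^esub> zeros g M"
    if "(v, w) \<in> kernel_pairs M f \<union> kernel_pairs M g" for v w
    using that by (auto simp: kernel_pairs_def pair_mem_zeros_iff intro: left right)
  have "{v} \<triangle> {w} \<in> zeros f M \<squnion>\<^bsub>subspaces (pts M)\<^esub> zeros g M"
    if "(v, w) \<in> (kernel_pairs M f \<union> kernel_pairs M g)\<^sup>+" for v w
    using that
  proof (induction rule: trancl_induct)
    case (step u w)
    have "{v} \<triangle> {w} = ({v} \<triangle> {u}) \<triangle> ({u} \<triangle> {w})" by (simp add: sdiff_assoc)
    then show ?case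
      using subspace_ofD(2)[OF J step.IH link[OF step.hyps(2)]] by simp
  qed (rule link)
  then show "zeros q M \<subseteq> zeros f M \<squnion>\<^bsub>subspaces (pts M)\<^esub> zeros g M"
    by (intro zeros_subsetI J) (simp add: q)
qed

section \<open>The noetherian form on a class of models\<close>

context model_class begin

lemma Img_vector_form: "Img C vector_form (M, h, N) = Fpow (on_pts h ` pts M)"
  by (simp add: Img_def subspaces_top fpush_image_Fpow)

lemma Ker_vector_form: "Ker C vector_form (M, h, N) = zeros h M"
  by (simp add: Ker_def subspaces_bottom zeros_def)

lemma orean_form: "orean_form \<W> C vector_form"
  unfolding orean_form_def
proof (intro conjI ballI impI category)
  fix X assume "X \<in> Obj C"
  then have X: "X \<in> structures \<W> \<Sigma>" by auto
  show "bounded_lattice (Fib vector_form X)" by (simp add: subspaces_bounded)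
  have "set_sized \<W> (Pow (Pow (pts X)))"
    using universe signature X by (intro set_sized_Pow set_sized_pts)
  then show "set_sized \<W> (carrier (Fib vector_form X))"
    by (rule set_sized_subset) (auto simp: subspaces_def subspace_of_def Fpow_def)
next
  fix f assume "f \<in> Arr C"
  then obtain M h N where f: "f = (M, h, N)" and h: "h \<in> homs \<Sigma> M N" by (rule full_subcat_ArrE)
  have sub: "on_pts h ` pts M \<subseteq> pts N" using h by (rule on_pts_image_subset)
  note po = partial_order.axioms(1)[OF subspaces_partial_order]
  show "push vector_form f \<in> carrier (Fib vector_form (Dom C f)) \<rightarrow> carrier (Fib vector_form (Cod C f))"
    using subspace_of_image[OF _ sub] by (auto simp: f)
  show "pull vector_form f \<in> carrier (Fib vector_form (Cod C f)) \<rightarrow> carrier (Fib vector_form (Dom C f))"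
    using subspace_of_vimage by (auto simp: f)
  show "isotone (Fib vector_form (Dom C f)) (Fib vector_form (Cod C f)) (push vector_form f)"
    "isotone (Fib vector_form (Cod C f)) (Fib vector_form (Dom C f)) (pull vector_form f)"
    by (auto simp: f isotone_def po)
  fix S T assume "S \<in> carrier (Fib vector_form (Dom C f))"
  then show "push vector_form f S \<sqsubseteq>\<^bsub>Fib vector_form (Cod C f)\<^esub> T \<longleftrightarrow>
      S \<sqsubseteq>\<^bsub>Fib vector_form (Dom C f)\<^esub> pull vector_form f T"
    by (auto simp: f dest: subspace_ofD(3))
next
  fix f g assume "f \<in> Arr C" "g \<in> Arr C" "Dom C g = Cod C f"
  then obtain M N P h k where f: "f = (M, h, N)" and g: "g = (N, k, P)"
    and h: "h \<in> homs \<Sigma> M N" by (auto elim!: full_subcat_ArrE)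
  show "push vector_form (Comp C g f) S = push vector_form g (push vector_form f S)"
    if "S \<in> carrier (Fib vector_form (Dom C f))" for S
    using that by (auto simp: f g image_image fpush_total_comp[OF h subspace_ofD(3)] intro!: image_cong)
  show "pull vector_form (Comp C g f) T = pull vector_form f (pull vector_form g T)" for T
    using on_pts_Fpow[OF h] by (auto simp: f g fpush_total_comp[OF h])
next
  fix X S assume "X \<in> Obj C" "S \<in> carrier (Fib vector_form X)"
  then have S: "subspace_of (pts X) S" by simp
  note id = fpush_total_id[OF subspace_ofD(3)[OF S]]
  show "push vector_form (Ident C X) S = S"
    using id by simp
  show "pull vector_form (Ident C X) S = S"
    using id subspace_ofD(3)[OF S] by (auto simp: fpush_total_id)
qed

text \<open>Inclusion of image clusters is inclusion of images sort by sort, which is what factoring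
  through an injection requires; uniqueness holds because \<open>m\<close> is a
  monomorphism.\<close>

lemma injs_embedding:
  assumes "(M, m, N) \<in> injs"
  shows "is_embedding C vector_form N (Img C vector_form (M, m, N)) (M, m, N)"
proof -
  have m: "M \<in> \<M>" "N \<in> \<M>" "m \<in> homs \<Sigma> M N" "\<And>s. inj_on (m s) (car M s)"
    using assms by (simp_all add: injs_iff)
  have arr: "(M, m, N) \<in> Arr C" using m by simp
  show ?thesis
    unfolding is_embedding_def
  proof (intro conjI ballI impI arr)
    show "conormal C vector_form N (Img C vector_form (M, m, N))"
      unfolding conormal_def using arr by (intro bexI[of _ "(M, m, N)"]) simp_all
    fix f assume "f \<in> Arr C"
      and le: "Cod C f = N \<and> Img C vector_form f \<sqsubseteq>\<^bsub>Fib vector_form N\<^esub> Img C vector_form (M, m, N)"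
    then obtain K g where f: "f = (K, g, N)" and g: "K \<in> \<M>" "g \<in> homs \<Sigma> K N"
      by (auto elim!: full_subcat_ArrE)
    have "g s ` car K s \<subseteq> m s ` car M s" for s
      using le by (simp add: f Img_vector_form Fpow_subset_iff on_pts_image_subset_iff)
    then obtain h where h: "h \<in> homs \<Sigma> K M" "\<And>s x. x \<in> car K s \<Longrightarrow> m s (h s x) = g s x"
      using homs_factor_inj[OF struct[OF g(1)] struct[OF m(1)] m(3,4) g(2)] by blast
    show "\<exists>!h. h \<in> Hom C (Dom C f) (Dom C (M, m, N)) \<and> f = Comp C (M, m, N) h"
    proof (rule ex1I[of _ "(K, h, M)"])
      have eq: "f = Comp C (M, m, N) (K, h, M)"
        unfolding f using g h m by (intro factor_comp)
      then show "(K, h, M) \<in> Hom C (Dom C f) (Dom C (M, m, N)) \<and> f = Comp C (M, m, N) (K, h, M)"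
        using g h m f by simp
      fix k assume k: "k \<in> Hom C (Dom C f) (Dom C (M, m, N)) \<and> f = Comp C (M, m, N) k"
      then have "Comp C (M, m, N) k = Comp C (M, m, N) (K, h, M)" using eq by simp
      moreover have "k \<in> Arr C" "Cod C k = M" "Dom C k = K" using k by (auto simp: f Hom_def)
      ultimately show "k = (K, h, M)"
        using injs_mono[OF assms] g h m unfolding mono_arr_def by simp
    qed
  qed simp_all
qed

lemma surjs_quotient:
  assumes "(M, e, N) \<in> surjs"
  shows "is_quotient C vector_form M (Ker C vector_form (M, e, N)) (M, e, N)"
proof -
  have e: "M \<in> \<M>" "N \<in> \<M>" "e \<in> homs \<Sigma> M N" "\<And>s. e s ` car M s = car N s"
    using assms by (simp_all add: surjs_iff)
  have arr: "(M, e, N) \<in> Arr C" using e by simp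
  show ?thesis
    unfolding is_quotient_def
  proof (intro conjI ballI impI arr)
    show "normal C vector_form M (Ker C vector_form (M, e, N))"
      unfolding normal_def using arr by (intro bexI[of _ "(M, e, N)"]) simp_all
    fix f assume "f \<in> Arr C"
      and le: "Dom C f = M \<and> Ker C vector_form (M, e, N) \<sqsubseteq>\<^bsub>Fib vector_form M\<^esub> Ker C vector_form f"
    then obtain P g where f: "f = (M, g, P)" and g: "P \<in> \<M>" "g \<in> homs \<Sigma> M P"
      by (auto elim!: full_subcat_ArrE)
    have "zeros e M \<subseteq> zeros g M" using le by (simp add: f Ker_vector_form)
    then have ker: "g s x = g s y" if "x \<in> car M s" "y \<in> car M s" "e s x = e s y" for s x y
      using that unfolding zeros_mono_iff by blast
    obtain h where h: "h \<in> homs \<Sigma> N P" "\<And>s x. x \<in> car M s \<Longrightarrow> h s (e s x) = g s x"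
      using homs_factor_surj[OF struct[OF e(1)] struct[OF e(2)] e(3) _ g(2) ker] e(4) by (metis order_refl)
    show "\<exists>!h. h \<in> Hom C (Cod C (M, e, N)) (Cod C f) \<and> f = Comp C h (M, e, N)"
    proof (rule ex1I[of _ "(N, h, P)"])
      have eq: "f = Comp C (N, h, P) (M, e, N)"
        unfolding f using g h e by (intro factor_comp)
      then show "(N, h, P) \<in> Hom C (Cod C (M, e, N)) (Cod C f) \<and> f = Comp C (N, h, P) (M, e, N)"
        using g h e f by simp
      fix k assume k: "k \<in> Hom C (Cod C (M, e, N)) (Cod C f) \<and> f = Comp C k (M, e, N)"
      then have "Comp C k (M, e, N) = Comp C (N, h, P) (M, e, N)" using eq by simp
      moreover have "k \<in> Arr C" "Dom C k = N" "Cod C k = P" using k by (auto simp: f Hom_def)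
      ultimately show "k = (N, h, P)"
        using surjs_epi[OF assms] g h e unfolding epi_arr_def by simp
    qed
  qed simp_all
qed

text \<open>Since \<open>e\<close> is surjective, \<open>m\<close> has the whole image of
  \<open>h\<close>; since \<open>m\<close> is injective, \<open>e\<close> has the whole kernel of
  \<open>h\<close>. So the two factors are an embedding and a quotient of the right
  clusters.\<close>

lemma factorization_form:
  assumes "M \<in> \<M>" "N \<in> \<M>" "h \<in> homs \<Sigma> M N"
  obtains I e m where "(M, e, I) \<in> surjs" "(I, m, N) \<in> injs"
    "(M, h, N) = Comp C (I, m, N) (M, e, I)"
    "Img C vector_form (I, m, N) = Img C vector_form (M, h, N)"
    "Ker C vector_form (M, e, I) = Ker C vector_form (M, h, N)"
proof -
  obtain I e m where e: "(M, e, I) \<in> surjs" and m: "(I, m, N) \<in> injs"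
    and me: "\<And>s x. x \<in> car M s \<Longrightarrow> m s (e s x) = h s x"
    by (rule factorization[OF assms]) (assumption | rule that)+
  have e': "e \<in> homs \<Sigma> M I" "\<And>s. e s ` car M s = car I s"
    and m': "m \<in> homs \<Sigma> I N" "\<And>s. inj_on (m s) (car I s)"
    using e m by (simp_all add: surjs_iff injs_iff)
  show thesis
  proof (rule that[OF e m])
    show "(M, h, N) = Comp C (I, m, N) (M, e, I)"
      using assms e' m' me by (intro factor_comp)
    have "m s ` car I s = h s ` car M s" for s
      using me by (auto simp: e'(2)[symmetric] image_image)
    then show "Img C vector_form (I, m, N) = Img C vector_form (M, h, N)"
      unfolding Img_vector_form
      by (intro arg_cong[of _ _ Fpow] antisym) (simp_all add: on_pts_image_subset_iff)
    have "e s x = e s y \<longleftrightarrow> h s x = h s y" if "x \<in> car M s" "y \<in> car M s" for s x y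
      using that me inj_onD[OF m'(2)] homs_car[OF e'(1)] by metis
    then show "Ker C vector_form (M, e, I) = Ker C vector_form (M, h, N)"
      unfolding Ker_vector_form by (intro antisym) (simp_all add: zeros_mono_iff)
  qed
qed

text \<open>For the converse, factor an embedding as \<open>h = m e\<close>. As \<open>m\<close> has
  the same image, \<open>m = h k\<close> for some \<open>k\<close>, and then
  \<open>h (k e) = h\<close> forces \<open>k e = id\<close> by uniqueness. So \<open>e\<close> is
  injective, and hence \<open>h\<close> is.\<close>

lemma embeddings_eq: "embeddings C vector_form = injs"
proof
  show "injs \<subseteq> embeddings C vector_form"
  proof
    fix f assume f: "f \<in> injs"
    then obtain M m N where "f = (M, m, N)" "N \<in> \<M>" by (rule injsE)
    then show "f \<in> embeddings C vector_form"
      using injs_embedding[of M m N] f unfolding embeddings_def by auto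
  qed
  show "embeddings C vector_form \<subseteq> injs"
  proof
    fix f assume "f \<in> embeddings C vector_form"
    then obtain X S where emb: "is_embedding C vector_form X S f" by (auto simp: embeddings_def)
    then have "f \<in> Arr C" "Cod C f = X" by (simp_all add: is_embedding_def)
    then obtain M h where f: "f = (M, h, X)" and h: "M \<in> \<M>" "X \<in> \<M>" "h \<in> homs \<Sigma> M X"
      by (auto elim!: full_subcat_ArrE)
    obtain I e m where e: "(M, e, I) \<in> surjs" and m: "(I, m, X) \<in> injs"
      and me: "(M, h, X) = Comp C (I, m, X) (M, e, I)"
      and im: "Img C vector_form (I, m, X) = Img C vector_form (M, h, X)"
      by (rule factorization_form[OF h]) (assumption | rule that)+
    have e': "e \<in> homs \<Sigma> M I" and m': "I \<in> \<M>" "m \<in> homs \<Sigma> I X"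
      using e m by (simp_all add: surjs_iff injs_iff)
    have "(I, m, X) \<in> Arr C" "Cod C (I, m, X) = X \<and> Img C vector_form (I, m, X) \<sqsubseteq>\<^bsub>Fib vector_form X\<^esub> S"
      using m' h emb im by (simp_all add: is_embedding_def f)
    then obtain k where k: "k \<in> Hom C I M" "(I, m, X) = Comp C (M, h, X) k"
      using emb unfolding is_embedding_def f by (metis ex1_implies_ex full_subcat_Dom)
    obtain k' where k': "k = (I, k', M)" "k' \<in> homs \<Sigma> I M" using k(1) by (rule full_subcat_HomE)
    have hk: "h s (k' s y) = m s y" if "y \<in> car I s" for s y
      using k(2) that k' m' h comp_eq_iff[OF m'(1) k'(2) h(3) m'(2)] by simp
    have me': "m s (e s x) = h s x" if "x \<in> car M s" for s x
      using me that comp_eq_iff[OF h(1) e' m'(2) h(3)] by simp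
    \<comment> \<open>The universal property of the embedding, applied to the embedding itself: the
      identity and \<open>k e\<close> are both mediating.\<close>
    have ex1: "\<exists>!u. u \<in> Hom C M M \<and> (M, h, X) = Comp C (M, h, X) u"
    proof -
      have "(M, h, X) \<in> Arr C" "Cod C (M, h, X) = X \<and> Img C vector_form (M, h, X) \<sqsubseteq>\<^bsub>Fib vector_form X\<^esub> S"
        using h emb by (simp_all add: is_embedding_def f)
      then show ?thesis using emb unfolding is_embedding_def f by (metis full_subcat_Dom)
    qed
    have ke: "(\<lambda>s. compose (car M s) (k' s) (e s)) \<in> homs \<Sigma> M M"
      using h(1) e' k'(2) by (rule comp_homs)
    have "(M, \<lambda>s. compose (car M s) (k' s) (e s), M) = (M, \<lambda>s. restrict id (car M s), M)"
    proof (rule ex1_eq[OF ex1])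
      show "(M, \<lambda>s. compose (car M s) (k' s) (e s), M) \<in> Hom C M M \<and>
          (M, h, X) = Comp C (M, h, X) (M, \<lambda>s. compose (car M s) (k' s) (e s), M)"
        using h ke hk me' homs_car[OF e'] by (intro conjI factor_comp) (simp_all add: compose_eq)
      show "(M, \<lambda>s. restrict id (car M s), M) \<in> Hom C M M \<and>
          (M, h, X) = Comp C (M, h, X) (M, \<lambda>s. restrict id (car M s), M)"
        using h id_homs[OF h(1)] by (intro conjI factor_comp) simp_all
    qed
    then have ke_id: "k' s (e s x) = x" if "x \<in> car M s" for s x
      using that comp_eq_id_iff[OF h(1) e' k'(2)] by simp
    have "inj_on (h s) (car M s)" for s
    proof (rule inj_onI)
      fix x y assume xy: "x \<in> car M s" "y \<in> car M s" "h s x = h s y"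
      then have "m s (e s x) = m s (e s y)" using me' by simp
      moreover have "inj_on (m s) (car I s)" using m by (simp add: injs_iff)
      ultimately have "e s x = e s y" using homs_car[OF e'] xy(1,2) by (simp add: inj_on_def)
      then show "x = y" using ke_id xy by metis
    qed
    then show "f \<in> injs" using h by (simp add: f injs_iff)
  qed
qed

text \<open>Dually, for a quotient \<open>h = m e\<close> the map \<open>e\<close> has the same
  kernel, so \<open>e = k h\<close>; then \<open>(m k) h = h\<close> forces \<open>m k = id\<close>.
  Given \<open>y\<close>, a preimage of \<open>k y\<close> under \<open>e\<close> is a preimage of
  \<open>y\<close> under \<open>h\<close>.\<close>

lemma quotients_eq: "quotients C vector_form = surjs"
proof
  show "surjs \<subseteq> quotients C vector_form"
  proof
    fix f assume f: "f \<in> surjs"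
    then obtain M e N where "f = (M, e, N)" "M \<in> \<M>" by (rule surjsE)
    then show "f \<in> quotients C vector_form"
      using surjs_quotient[of M e N] f unfolding quotients_def by auto
  qed
  show "quotients C vector_form \<subseteq> surjs"
  proof
    fix f assume "f \<in> quotients C vector_form"
    then obtain X K where quo: "is_quotient C vector_form X K f" by (auto simp: quotients_def)
    then have "f \<in> Arr C" "Dom C f = X" by (simp_all add: is_quotient_def)
    then obtain N h where f: "f = (X, h, N)" and h: "X \<in> \<M>" "N \<in> \<M>" "h \<in> homs \<Sigma> X N"
      by (auto elim!: full_subcat_ArrE)
    obtain I e m where e: "(X, e, I) \<in> surjs" and m: "(I, m, N) \<in> injs"
      and me: "(X, h, N) = Comp C (I, m, N) (X, e, I)"
      and ker: "Ker C vector_form (X, e, I) = Ker C vector_form (X, h, N)"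
      by (rule factorization_form[OF h]) (assumption | rule that)+
    have e': "e \<in> homs \<Sigma> X I" and m': "I \<in> \<M>" "m \<in> homs \<Sigma> I N"
      using e m by (simp_all add: surjs_iff injs_iff)
    have "(X, e, I) \<in> Arr C" "Dom C (X, e, I) = X \<and> K \<sqsubseteq>\<^bsub>Fib vector_form X\<^esub> Ker C vector_form (X, e, I)"
      using e' m' h quo ker by (simp_all add: is_quotient_def f)
    then obtain k where k: "k \<in> Hom C N I" "(X, e, I) = Comp C k (X, h, N)"
      using quo unfolding is_quotient_def f by (metis ex1_implies_ex full_subcat_Cod)
    obtain k' where k': "k = (N, k', I)" "k' \<in> homs \<Sigma> N I" using k(1) by (rule full_subcat_HomE)
    have kh: "k' s (h s x) = e s x" if "x \<in> car X s" for s x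
      using k(2) that k' comp_eq_iff[OF h(1,3) k'(2) e'] by simp
    have me': "m s (e s x) = h s x" if "x \<in> car X s" for s x
      using me that comp_eq_iff[OF h(1) e' m'(2) h(3)] by simp
    have ex1: "\<exists>!u. u \<in> Hom C N N \<and> (X, h, N) = Comp C u (X, h, N)"
    proof -
      have "(X, h, N) \<in> Arr C" "Dom C (X, h, N) = X \<and> K \<sqsubseteq>\<^bsub>Fib vector_form X\<^esub> Ker C vector_form (X, h, N)"
        using h quo by (simp_all add: is_quotient_def f)
      then show ?thesis using quo unfolding is_quotient_def f by (metis full_subcat_Cod)
    qed
    have mk: "(\<lambda>s. compose (car N s) (m s) (k' s)) \<in> homs \<Sigma> N N"
      using h(2) k'(2) m'(2) by (rule comp_homs)
    have "(N, \<lambda>s. compose (car N s) (m s) (k' s), N) = (N, \<lambda>s. restrict id (car N s), N)"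
    proof (rule ex1_eq[OF ex1])
      show "(N, \<lambda>s. compose (car N s) (m s) (k' s), N) \<in> Hom C N N \<and>
          (X, h, N) = Comp C (N, \<lambda>s. compose (car N s) (m s) (k' s), N) (X, h, N)"
        using h mk kh me' homs_car[OF h(3)] by (intro conjI factor_comp) (simp_all add: compose_eq)
      show "(N, \<lambda>s. restrict id (car N s), N) \<in> Hom C N N \<and>
          (X, h, N) = Comp C (N, \<lambda>s. restrict id (car N s), N) (X, h, N)"
        using h id_homs[OF h(2)] homs_car[OF h(3)] by (intro conjI factor_comp) simp_all
    qed
    then have mk_id: "m s (k' s y) = y" if "y \<in> car N s" for s y
      using that comp_eq_id_iff[OF h(2) k'(2) m'(2)] by simp
    have "h s ` car X s = car N s" for s
    proof
      show "h s ` car X s \<subseteq> car N s" using homs_car[OF h(3)] by blast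
      show "car N s \<subseteq> h s ` car X s"
      proof
        fix y assume y: "y \<in> car N s"
        then have "k' s y \<in> e s ` car X s" using homs_car[OF k'(2)] e by (simp add: surjs_iff)
        then obtain x where "x \<in> car X s" "k' s y = e s x" by blast
        then show "y \<in> h s ` car X s"
          using mk_id[OF y] me' by (intro image_eqI[of _ _ x]) simp_all
      qed
    qed
    then show "f \<in> surjs" using h by (simp add: f surjs_iff)
  qed
qed

lemma normal_join:
  assumes "normal C vector_form X S" "normal C vector_form X T"
  shows "normal C vector_form X (S \<squnion>\<^bsub>Fib vector_form X\<^esub> T)"
proof -
  obtain N f where f: "X \<in> \<M>" "N \<in> \<M>" "f \<in> homs \<Sigma> X N" "S = zeros f X"
    using assms(1) by (auto simp: normal_def Ker_vector_form elim!: full_subcat_ArrE)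
  obtain P g where g: "g \<in> homs \<Sigma> X P" "T = zeros g X"
    using assms(2) by (auto simp: normal_def Ker_vector_form elim!: full_subcat_ArrE)
  obtain Q q where Q: "Q \<in> structures \<W> \<Sigma>" "q \<in> homs \<Sigma> X Q" "\<And>s. q s ` car X s = car Q s"
    and q: "\<And>s x y. x \<in> car X s \<Longrightarrow> y \<in> car X s \<Longrightarrow>
      q s x = q s y \<longleftrightarrow> ((s, x), (s, y)) \<in> (kernel_pairs X f \<union> kernel_pairs X g)\<^sup>+"
    by (rule kernel_join_exists[OF universe struct[OF f(1)] f(3) g(1)]) (assumption | rule that)+
  have "Q \<in> \<M>" using f(1) Q by (rule quotient_closed)
  moreover have "zeros q X = S \<squnion>\<^bsub>Fib vector_form X\<^esub> T"
    using zeros_join[OF q] f g by simp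
  ultimately show ?thesis
    unfolding normal_def using f(1) Q(2) by (intro bexI[of _ "(X, q, Q)"]) (simp_all add: Ker_vector_form)
qed

text \<open>A finite set contained in both images is a finite subset of their intersection, and the
  intersection of two images is again the image of a model.\<close>

lemma conormal_meet:
  assumes "conormal C vector_form X S" "conormal C vector_form X T"
  shows "conormal C vector_form X (S \<sqinter>\<^bsub>Fib vector_form X\<^esub> T)"
proof -
  obtain M f where f: "X \<in> \<M>" "M \<in> \<M>" "f \<in> homs \<Sigma> M X" "S = Fpow (on_pts f ` pts M)"
    using assms(1) by (auto simp: conormal_def Img_vector_form elim!: full_subcat_ArrE)
  obtain N g where g: "N \<in> \<M>" "g \<in> homs \<Sigma> N X" "T = Fpow (on_pts g ` pts N)"
    using assms(2) by (auto simp: conormal_def Img_vector_form elim!: full_subcat_ArrE)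
  obtain Q i where Q: "Q \<in> structures \<W> \<Sigma>" "i \<in> homs \<Sigma> Q X" "\<And>s. inj_on (i s) (car Q s)"
    and i: "\<And>s. i s ` car Q s = f s ` car M s \<inter> g s ` car N s"
    by (rule homs_intersection[OF universe struct[OF f(2)] struct[OF g(1)] struct[OF f(1)] f(3) g(2)])
      (assumption | rule that)+
  have "Q \<in> \<M>" using f(1) Q by (rule sub_closed)
  have on_pts_image: "on_pts h ` pts K = (SIGMA s:UNIV. h s ` car K s)"
    for h :: "'s \<Rightarrow> 'u \<Rightarrow> 'u" and K :: "('s, 'f, 'u) struct"
    by (auto simp: on_pts_def pts_def)
  have "subspace_of (pts X) S" "subspace_of (pts X) T"
    using subspace_of_image[OF subspace_of_Fpow on_pts_image_subset[OF f(3)]]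
      subspace_of_image[OF subspace_of_Fpow on_pts_image_subset[OF g(2)]] f(4) g(3)
    by (simp_all add: fpush_image_Fpow)
  then have "S \<sqinter>\<^bsub>Fib vector_form X\<^esub> T = S \<inter> T" by (simp add: subspaces_meet)
  also have "\<dots> = Fpow (on_pts i ` pts Q)"
    unfolding f(4) g(3) on_pts_image i by (auto simp: Fpow_def)
  finally have "Img C vector_form (Q, i, X) = S \<sqinter>\<^bsub>Fib vector_form X\<^esub> T"
    by (simp add: Img_vector_form)
  then show ?thesis
    unfolding conormal_def using f(1) Q(2) \<open>Q \<in> \<M>\<close> by (intro bexI[of _ "(Q, i, X)"]) simp_all
qed

lemma noetherian_form: "noetherian_form \<W> C vector_form"
  unfolding noetherian_form_def
proof (intro conjI ballI impI allI orean_form)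
  fix f assume "f \<in> Arr C"
  then obtain M h N where f: "f = (M, h, N)" and h: "M \<in> \<M>" "N \<in> \<M>" "h \<in> homs \<Sigma> M N"
    by (rule full_subcat_ArrE)
  show "pull vector_form f (push vector_form f S) = S \<squnion>\<^bsub>Fib vector_form (Dom C f)\<^esub> Ker C vector_form f"
    if "S \<in> carrier (Fib vector_form (Dom C f))" for S
    using that fpush_vimage_image[of "pts M" S "on_pts h"] by (simp add: f Ker_vector_form zeros_def)
  show "push vector_form f (pull vector_form f T) = T \<sqinter>\<^bsub>Fib vector_form (Cod C f)\<^esub> Img C vector_form f"
    if "T \<in> carrier (Fib vector_form (Cod C f))" for T
    using that fpush_image_vimage[OF _ on_pts_image_subset[OF h(3)], of T]
    by (simp add: f Img_vector_form fpush_image_Fpow)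
  obtain I e m where *: "(M, e, I) \<in> surjs" "(I, m, N) \<in> injs"
    "(M, h, N) = Comp C (I, m, N) (M, e, I)"
    "Img C vector_form (I, m, N) = Img C vector_form (M, h, N)"
    "Ker C vector_form (M, e, I) = Ker C vector_form (M, h, N)"
    by (rule factorization_form[OF h]) (assumption | rule that)+
  then show "\<exists>e m. is_quotient C vector_form (Dom C f) (Ker C vector_form f) e \<and>
      is_embedding C vector_form (Cod C f) (Img C vector_form f) m \<and> Dom C m = Cod C e \<and> f = Comp C m e"
    using surjs_quotient[OF *(1)] injs_embedding[OF *(2)]
    by (intro exI[of _ "(M, e, I)"] exI[of _ "(I, m, N)"]) (simp add: f)
qed (blast intro: normal_join conormal_meet)+

end

section \<open>Models of the two theories\<close>

lemma model_class_Mod: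
  fixes A :: "('s, 'f, 'i) disjunctive_axiom set"
  assumes "universe \<W>" "algebraic_theory \<W> \<Sigma> T\<^sub>0" "disjunctive_axioms \<W> \<Sigma> A"
  shows "model_class \<W> \<Sigma> {M \<in> structures \<W> \<Sigma>.
    (\<forall>a\<in>T\<^sub>0. sat_equational M a) \<and> (\<forall>a\<in>A. sat_disjunctive M a)}"
proof -
  have wf: "\<And>a. a \<in> T\<^sub>0 \<Longrightarrow> wf_equation \<Sigma> (ectx a) (eqn a)"
      "\<And>a i e. a \<in> A \<Longrightarrow> i \<in> index a \<Longrightarrow> e \<in> set (disjunct a i) \<Longrightarrow> wf_equation \<Sigma> (dctx a) e"
    using assms by (auto simp: algebraic_theory_def disjunctive_axioms_def)
  show ?thesis
  proof
    show "universe \<W>" "wf_signature \<W> \<Sigma>" using assms by (simp_all add: algebraic_theory_def)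
  next
    fix M N h
    assume N: "N \<in> {M \<in> structures \<W> \<Sigma>. (\<forall>a\<in>T\<^sub>0. sat_equational M a) \<and> (\<forall>a\<in>A. sat_disjunctive M a)}"
      and M: "M \<in> structures \<W> \<Sigma>" "h \<in> homs \<Sigma> M N" "\<And>s. inj_on (h s) (car M s)"
    have "sat_equational M a" if "a \<in> T\<^sub>0" for a
      using sat_equational_sub[OF M wf(1)[OF that]] N that by blast
    moreover have "sat_disjunctive M a" if "a \<in> A" for a
      by (rule sat_disjunctive_sub[OF M]) (use wf(2)[OF that] N that in blast)+
    ultimately show "M \<in> {M \<in> structures \<W> \<Sigma>. (\<forall>a\<in>T\<^sub>0. sat_equational M a) \<and> (\<forall>a\<in>A. sat_disjunctive M a)}"
      using M(1) by blast
  next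
    fix M N h
    assume M: "M \<in> {M \<in> structures \<W> \<Sigma>. (\<forall>a\<in>T\<^sub>0. sat_equational M a) \<and> (\<forall>a\<in>A. sat_disjunctive M a)}"
      and N: "N \<in> structures \<W> \<Sigma>" and h: "h \<in> homs \<Sigma> M N" "\<And>s. h s ` car M s = car N s"
    have M': "M \<in> structures \<W> \<Sigma>" and surj: "\<And>s. car N s \<subseteq> h s ` car M s" using M h(2) by simp_all
    have "sat_equational N a" if "a \<in> T\<^sub>0" for a
      using sat_equational_quotient[OF M' h(1) surj wf(1)[OF that]] M that by blast
    moreover have "sat_disjunctive N a" if "a \<in> A" for a
      by (rule sat_disjunctive_quotient[OF M' h(1) surj]) (use wf(2)[OF that] M that in blast)+
    ultimately show "N \<in> {M \<in> structures \<W> \<Sigma>. (\<forall>a\<in>T\<^sub>0. sat_equational M a) \<and> (\<forall>a\<in>A. sat_disjunctive M a)}"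
      using N by blast
  qed blast
qed

theorem theorem3p31:
  fixes \<W> :: "'u set set"
    and \<Sigma> :: "('s, 'f) signature"
    and T\<^sub>0 :: "('s, 'f) equational_axiom set"
    and A :: "('s, 'f, 'i) disjunctive_axiom set"
  assumes "universe \<W>"
    and "algebraic_theory \<W> \<Sigma> T\<^sub>0"
    and "disjunctive_axioms \<W> \<Sigma> A"
  defines "C \<equiv> Mod \<W> \<Sigma> T\<^sub>0 A"
    and "C\<^sub>0 \<equiv> Mod\<^sub>0 \<W> \<Sigma> T\<^sub>0"
  shows
    "(\<exists>F :: (('s, 'f, 'u) struct, ('s, 'f, 'u) arrow, ('s \<times> 'u) set set) form.
        noetherian_form \<W> C F \<and>
        quotients C F = sortwise_surj \<Sigma> C \<and>
        embeddings C F = sortwise_inj \<Sigma> C \<and>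
        (\<forall>X\<in>Obj C. complete_lattice (Fib F X) \<and> algebraic_lattice (Fib F X) \<and>
           modular_lattice (Fib F X))) \<and>
     full C C\<^sub>0 (\<lambda>X. X) (\<lambda>f. f) \<and>
     transfer_functor \<W> C (sortwise_surj \<Sigma> C) (sortwise_inj \<Sigma> C)
       C\<^sub>0 (sortwise_surj \<Sigma> C\<^sub>0) (sortwise_inj \<Sigma> C\<^sub>0) (\<lambda>X. X) (\<lambda>f. f)"
proof -
  let ?M = "{M \<in> structures \<W> \<Sigma>. (\<forall>a\<in>T\<^sub>0. sat_equational M a) \<and> (\<forall>a\<in>A. sat_disjunctive M a)}"
  let ?M\<^sub>0 = "{M \<in> structures \<W> \<Sigma>. \<forall>a\<in>T\<^sub>0. sat_equational M a}"
  have C: "C = full_subcat \<Sigma> ?M" and C\<^sub>0: "C\<^sub>0 = full_subcat \<Sigma> ?M\<^sub>0"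
    by (simp_all add: C_def C\<^sub>0_def Mod_def Mod\<^sub>0_def)
  interpret M: model_class \<W> \<Sigma> ?M using assms(1-3) by (rule model_class_Mod)
  \<comment> \<open>Models of \<open>T\<^sub>0\<close> are treated as the case with no disjunctive
    axioms; the annotation fixes the otherwise undetermined type of indices.\<close>
  have "disjunctive_axioms \<W> \<Sigma> ({} :: ('s, 'f, 'i) disjunctive_axiom set)"
    using assms(3) by (auto simp: disjunctive_axioms_def intro: set_sized_subset)
  then have M\<^sub>0: "model_class \<W> \<Sigma> ?M\<^sub>0"
    using model_class_Mod[OF assms(1,2), of "{} :: ('s, 'f, 'i) disjunctive_axiom set"] by simp
  have sub: "?M \<subseteq> ?M\<^sub>0" by blast
  show ?thesis
    unfolding C C\<^sub>0
    using M.noetherian_form M.quotients_eq M.embeddings_eq full_inclusion[OF sub]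
      transfer_inclusion[OF M.model_class_axioms M\<^sub>0 sub]
    by (intro conjI exI[of _ vector_form])
      (simp_all add: subspaces_complete subspaces_algebraic subspaces_modular)
qed

end
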